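(* Let $m,n\ge1$ and $G = G(m, 1, n)$. Then, for integers $i,k$, $\mathcal{SH}_{G(m, 1, n)}^{i, k} \neq 0$ if and only if $i, k \geq 0$ and $$i+k+m\binom{k}{2} \leq m \binom{n}{2} + (m-1)n.$$
   Context: Setting. $K \subset \mathbb{C}$ is a subfield closed under complex conjugation containing the $m$th roots of unity, $V = K^n$. $G(m,1,n)\subset\mathrm{GL}(V)$ is the group of $n\times n$ matrices with exactly one non-zero entry in each row and column, each such entry being an $m$th root of unity. Differential forms. $x_1,\dots,x_n$ are the coordinate functions on $V$. $K[x_1,\dots,x_n,\theta_1,\dots,\theta_n]$ is the $K$-algebra with $x_ix_j=x_jx_i$, $x_i\theta_j=\theta_jx_i$, $\theta_i\theta_j=-\theta_j\theta_i$ (so $\theta_i^2=0$), bigraded by $x$-degree and $\theta$-degree. $G$ acts by $K$-algebra automorphisms with $\sigma\cdot x_j=\sum_i\overline{\sigma_{ij}}x_i$, $\sigma\cdot\theta_j=\sum_i\overline{\sigma_{ij}}\theta_i$. $\partial_{x_i}$ is the usual ($\theta$-linear) partial derivative; $\partial_{\theta_i}$ is the $x$-linear interior product: for $i_1<\dots<i_k$, $\partial_{\theta_i}\theta_{i_1}\cdots\theta_{i_k}=(-1)^{\ell-1}\theta_{i_1}\cdots\widehat{\theta_{i_\ell}}\cdots\theta_{i_k}$ if $i=i_\ell$, and $0$ otherwise. For $\omega=\sum c_{\alpha,I}x^\alpha\theta_{i_1}\cdots\theta_{i_k}$ put $\partial_\omega=\sum\overline{c_{\alpha,I}}\,\partial_{x_1}^{\alpha_1}\cdots\partial_{x_n}^{\alpha_n}\partial_{\theta_{i_k}}\cdots\partial_{\theta_{i_1}}$.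 Super harmonics. $\mathcal{J}_G$ is the ideal of $K[x_1,\dots,x_n,\theta_1,\dots,\theta_n]$ generated by the bi-homogeneous $G$-invariant elements of positive total degree, and $\mathcal{SH}_G=\{\eta:\partial_\omega\eta=0\text{ for all }\omega\in\mathcal{J}_G\}$; $\mathcal{SH}_G^{i,k}$ is its component of $x$-degree $i$ and $\theta$-degree $k$. *)

theory Defs
  imports
    "HOL-Algebra.Algebraic_Closure_Type"
    "HOL-Library.Poly_Mapping"
    "HOL-Library.FSet"
    "Jordan_Normal_Form.Matrix"
begin

text \<open>
  Variables are indexed from 0: the coordinates of \<open>K\<^sup>n\<close> are \<open>x\<^sub>0, \<dots>, x\<^sub>n\<^sub>-\<^sub>1\<close>.
  A pair \<open>(\<alpha>, I)\<close> stands for the basis element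
  \<open>x\<^sup>\<alpha> \<theta>\<^bsub>i1\<^esub> \<dots> \<theta>\<^bsub>ik\<^esub>\<close>, where \<open>I = {i1 < \<dots> < ik}\<close>.  The type below has infinitely
  many variables; \<open>super_ring K n\<close> cuts out those with \<open>n\<close> variables and coefficients in \<open>K\<close>.
\<close>

type_synonym super_index = "(nat \<Rightarrow>\<^sub>0 nat) \<times> nat fset"

typedef superpoly = "UNIV :: (super_index \<Rightarrow>\<^sub>0 complex) set"
  morphisms coeffs of_coeffs ..

setup_lifting type_definition_superpoly

definition supp :: "superpoly \<Rightarrow> super_index set" where
  "supp f = Poly_Mapping.keys (coeffs f)"

definition scoeff :: "superpoly \<Rightarrow> super_index \<Rightarrow> complex" where
  "scoeff f p = Poly_Mapping.lookup (coeffs f) p"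

text \<open>
  \<open>\<theta>\<^sub>I \<theta>\<^sub>J = ext_sign I J \<theta>\<^bsub>I \<union> J\<^esub>\<close>: sorting the concatenation of the two increasing words
  takes one transposition for each pair in \<open>inversions I J\<close>.
\<close>

definition inversions :: "nat fset \<Rightarrow> nat fset \<Rightarrow> (nat \<times> nat) set" where
  "inversions I J = {(i, j). i |\<in>| I \<and> j |\<in>| J \<and> j < i}"

definition ext_sign :: "nat fset \<Rightarrow> nat fset \<Rightarrow> complex" where
  "ext_sign I J = (if I |\<inter>| J = {||} then (-1) ^ card (inversions I J) else 0)"

definition index_mult :: "super_index \<Rightarrow> super_index \<Rightarrow> super_index" where
  "index_mult p q = (fst p + fst q, snd p |\<union>| snd q)"

definition super_times ::
  "(super_index \<Rightarrow>\<^sub>0 complex) \<Rightarrow> (super_index \<Rightarrow>\<^sub>0 complex) \<Rightarrow> (super_index \<Rightarrow>\<^sub>0 complex)" where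
  "super_times f g =
     (\<Sum>p\<in>Poly_Mapping.keys f. \<Sum>q\<in>Poly_Mapping.keys g.
        Poly_Mapping.single (index_mult p q)
          (Poly_Mapping.lookup f p * Poly_Mapping.lookup g q * ext_sign (snd p) (snd q)))"

lemma finite_inversions [simp]: "finite (inversions I J)"
proof -
  have "inversions I J \<subseteq> fset I \<times> fset J" by (auto simp: inversions_def)
  thus ?thesis by (rule finite_subset) auto
qed

lemma card_inversions_union_left:
  assumes "I |\<inter>| J = {||}"
  shows "card (inversions (I |\<union>| J) L) = card (inversions I L) + card (inversions J L)"
proof -
  have "inversions (I |\<union>| J) L = inversions I L \<union> inversions J L"
    by (auto simp: inversions_def)
  moreover have "inversions I L \<inter> inversions J L = {}"
    using assms by (auto simp: inversions_def)
  ultimately show ?thesis by (simp add: card_Un_disjoint)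
qed

lemma card_inversions_union_right:
  assumes "J |\<inter>| L = {||}"
  shows "card (inversions I (J |\<union>| L)) = card (inversions I J) + card (inversions I L)"
proof -
  have "inversions I (J |\<union>| L) = inversions I J \<union> inversions I L"
    by (auto simp: inversions_def)
  moreover have "inversions I J \<inter> inversions I L = {}"
    using assms by (auto simp: inversions_def)
  ultimately show ?thesis by (simp add: card_Un_disjoint)
qed

lemma ext_sign_assoc:
  "ext_sign I J * ext_sign (I |\<union>| J) L = ext_sign J L * ext_sign I (J |\<union>| L)"
proof (cases "I |\<inter>| J = {||} \<and> I |\<inter>| L = {||} \<and> J |\<inter>| L = {||}")
  case True
  hence "(I |\<union>| J) |\<inter>| L = {||}" "I |\<inter>| (J |\<union>| L) = {||}" by auto
  with True show ?thesis
    by (simp add: ext_sign_def card_inversions_union_left card_inversions_union_right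
        flip: power_add) (simp add: algebra_simps)
next
  case False
  hence "I |\<inter>| J \<noteq> {||} \<or> (I |\<union>| J) |\<inter>| L \<noteq> {||}"
    and "J |\<inter>| L \<noteq> {||} \<or> I |\<inter>| (J |\<union>| L) \<noteq> {||}" by auto
  thus ?thesis by (auto simp: ext_sign_def)
qed

lemma ext_sign_empty [simp]: "ext_sign {||} J = 1" "ext_sign I {||} = 1"
  by (auto simp: ext_sign_def inversions_def)

lemma super_times_superset:
  assumes "finite A" "finite B" "Poly_Mapping.keys f \<subseteq> A" "Poly_Mapping.keys g \<subseteq> B"
  shows "super_times f g =
     (\<Sum>p\<in>A. \<Sum>q\<in>B. Poly_Mapping.single (index_mult p q)
          (Poly_Mapping.lookup f p * Poly_Mapping.lookup g q * ext_sign (snd p) (snd q)))"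
proof -
  have "(\<Sum>q\<in>Poly_Mapping.keys g. Poly_Mapping.single (index_mult p q)
          (Poly_Mapping.lookup f p * Poly_Mapping.lookup g q * ext_sign (snd p) (snd q))) =
        (\<Sum>q\<in>B. Poly_Mapping.single (index_mult p q)
          (Poly_Mapping.lookup f p * Poly_Mapping.lookup g q * ext_sign (snd p) (snd q)))" for p
    by (rule sum.mono_neutral_left) (use assms in \<open>auto simp: in_keys_iff\<close>)
  hence "super_times f g = (\<Sum>p\<in>Poly_Mapping.keys f. \<Sum>q\<in>B. Poly_Mapping.single (index_mult p q)
          (Poly_Mapping.lookup f p * Poly_Mapping.lookup g q * ext_sign (snd p) (snd q)))"
    by (simp add: super_times_def)
  also have "\<dots> = (\<Sum>p\<in>A. \<Sum>q\<in>B. Poly_Mapping.single (index_mult p q)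
          (Poly_Mapping.lookup f p * Poly_Mapping.lookup g q * ext_sign (snd p) (snd q)))"
    by (rule sum.mono_neutral_left) (use assms in \<open>auto simp: in_keys_iff\<close>)
  finally show ?thesis .
qed

lemma super_times_add_left: "super_times (f + f') g = super_times f g + super_times f' g"
proof -
  let ?A = "Poly_Mapping.keys f \<union> Poly_Mapping.keys f'" and ?B = "Poly_Mapping.keys g"
  note sup = super_times_superset[of ?A ?B, OF _ _ _ subset_refl]
  have "super_times (f + f') g = (\<Sum>p\<in>?A. \<Sum>q\<in>?B. Poly_Mapping.single (index_mult p q)
      (Poly_Mapping.lookup (f + f') p * Poly_Mapping.lookup g q * ext_sign (snd p) (snd q)))"
    by (rule sup) (simp_all add: keys_add)
  also have "\<dots> = super_times f g + super_times f' g"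
    by (subst (1 2) sup) (simp_all add: lookup_add single_add distrib_right sum.distrib)
  finally show ?thesis .
qed

lemma super_times_add_right: "super_times f (g + g') = super_times f g + super_times f g'"
proof -
  let ?A = "Poly_Mapping.keys f" and ?B = "Poly_Mapping.keys g \<union> Poly_Mapping.keys g'"
  note sup = super_times_superset[of ?A ?B, OF _ _ subset_refl]
  have "super_times f (g + g') = (\<Sum>p\<in>?A. \<Sum>q\<in>?B. Poly_Mapping.single (index_mult p q)
      (Poly_Mapping.lookup f p * Poly_Mapping.lookup (g + g') q * ext_sign (snd p) (snd q)))"
    by (rule sup) (simp_all add: keys_add)
  also have "\<dots> = super_times f g + super_times f g'"
    by (subst (1 2) sup)
      (simp_all add: lookup_add single_add distrib_left distrib_right sum.distrib)
  finally show ?thesis .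
qed

lemma super_times_single:
  "super_times (Poly_Mapping.single p a) (Poly_Mapping.single q b) =
     Poly_Mapping.single (index_mult p q) (a * b * ext_sign (snd p) (snd q))"
  by (subst super_times_superset[of "{p}" "{q}"]) auto

lemma super_times_zero [simp]: "super_times 0 g = 0" "super_times f 0 = 0"
  by (simp_all add: super_times_def)

lemma super_index_induct [case_names single add]:
  assumes "\<And>p a. P (Poly_Mapping.single p (a :: complex))"
    and "\<And>f g. P f \<Longrightarrow> P g \<Longrightarrow> P (f + g)"
  shows "P (f :: super_index \<Rightarrow>\<^sub>0 complex)"
proof -
  have "P (\<Sum>p\<in>A. Poly_Mapping.single p (Poly_Mapping.lookup f p))" if "finite A" for A
    using that
  proof (induction A)
    case empty
    show ?case using assms(1)[of undefined 0] by simp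
  qed (auto intro: assms)
  moreover have "(\<Sum>p\<in>Poly_Mapping.keys f. Poly_Mapping.single p (Poly_Mapping.lookup f p)) = f"
    by (rule poly_mapping_eqI)
      (simp add: lookup_sum lookup_single when_def in_keys_iff)
  ultimately show ?thesis by (metis finite_keys)
qed

lemma super_times_assoc:
  "super_times (super_times f g) h = super_times f (super_times g h)"
proof (induction f rule: super_index_induct)
  case (single p a)
  show ?case
  proof (induction g rule: super_index_induct)
    case (single q b)
    show ?case
    proof (induction h rule: super_index_induct)
      case (single r c)
      show ?case
        using ext_sign_assoc[of "snd p" "snd q" "snd r"]
        by (simp add: super_times_single index_mult_def ac_simps funion_assoc)
    qed (simp add: super_times_add_right)
  qed (simp add: super_times_add_left super_times_add_right)
qed (simp add: super_times_add_left)

instantiation superpoly :: ring_1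
begin

lift_definition zero_superpoly :: superpoly is 0 .
lift_definition one_superpoly :: superpoly is "Poly_Mapping.single (0, {||}) 1" .
lift_definition plus_superpoly :: "superpoly \<Rightarrow> superpoly \<Rightarrow> superpoly" is "(+)" .
lift_definition uminus_superpoly :: "superpoly \<Rightarrow> superpoly" is uminus .
lift_definition minus_superpoly :: "superpoly \<Rightarrow> superpoly \<Rightarrow> superpoly" is "(-)" .
lift_definition times_superpoly :: "superpoly \<Rightarrow> superpoly \<Rightarrow> superpoly" is super_times .

lemma super_times_one_left: "super_times (Poly_Mapping.single (0, {||}) 1) f = f"
  by (induction f rule: super_index_induct)
    (simp_all add: super_times_single index_mult_def super_times_add_right)

lemma super_times_one_right: "super_times f (Poly_Mapping.single (0, {||}) 1) = f"
  by (induction f rule: super_index_induct)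
    (simp_all add: super_times_single index_mult_def super_times_add_left)

instance
proof
  show "(0 :: superpoly) \<noteq> 1"
    by transfer (metis lookup_single_eq lookup_zero zero_neq_one)
qed (transfer; simp add: super_times_assoc super_times_add_left super_times_add_right
       super_times_one_left super_times_one_right algebra_simps)+

end

definition super_monom :: "(nat \<Rightarrow>\<^sub>0 nat) \<Rightarrow> nat fset \<Rightarrow> complex \<Rightarrow> superpoly" where
  "super_monom \<alpha> I c = of_coeffs (Poly_Mapping.single (\<alpha>, I) c)"

lemma coeffs_super_monom [simp]: "coeffs (super_monom \<alpha> I c) = Poly_Mapping.single (\<alpha>, I) c"
  by (simp add: super_monom_def of_coeffs_inverse)

definition super_const :: "complex \<Rightarrow> superpoly" where
  "super_const c = super_monom 0 {||} c"

definition xvar :: "nat \<Rightarrow> superpoly" where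
  "xvar i = super_monom (Poly_Mapping.single i 1) {||} 1"

definition tvar :: "nat \<Rightarrow> superpoly" where
  "tvar i = super_monom 0 {|i|} 1"

lemma super_monom_mult:
  "super_monom \<alpha> I a * super_monom \<beta> J b =
     super_monom (\<alpha> + \<beta>) (I |\<union>| J) (a * b * ext_sign I J)"
  by (simp add: super_times_single index_mult_def times_superpoly.rep_eq flip: coeffs_inject)

lemma xvar_commute: "xvar i * xvar j = xvar j * xvar i"
  and xvar_tvar_commute: "xvar i * tvar j = tvar j * xvar i"
  by (simp_all add: xvar_def tvar_def super_monom_mult add.commute)

lemma tvar_square: "tvar i * tvar i = 0"
  by (simp add: tvar_def super_monom_mult ext_sign_def zero_superpoly.rep_eq flip: coeffs_inject)

lemma tvar_anticommute: "tvar i * tvar j = - (tvar j * tvar i)"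
proof (cases i j rule: linorder_cases)
  case less
  hence "inversions {|i|} {|j|} = {}" "inversions {|j|} {|i|} = {(j, i)}"
    by (auto simp: inversions_def)
  with less show ?thesis
    by (simp add: tvar_def super_monom_mult ext_sign_def finsert_commute single_uminus
        uminus_superpoly.rep_eq flip: coeffs_inject)
next
  case greater
  hence "inversions {|j|} {|i|} = {}" "inversions {|i|} {|j|} = {(i, j)}"
    by (auto simp: inversions_def)
  with greater show ?thesis
    by (simp add: tvar_def super_monom_mult ext_sign_def finsert_commute single_uminus
        uminus_superpoly.rep_eq flip: coeffs_inject)
qed (simp add: tvar_square)

definition linear_ext :: "(super_index \<Rightarrow> superpoly) \<Rightarrow> superpoly \<Rightarrow> superpoly" where
  "linear_ext b f = (\<Sum>p\<in>supp f. super_const (scoeff f p) * b p)"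

text \<open>\<open>K[x\<^sub>0, \<dots>, x\<^sub>n\<^sub>-\<^sub>1, \<theta>\<^sub>0, \<dots>, \<theta>\<^sub>n\<^sub>-\<^sub>1]\<close>, for a set \<open>K\<close> of complex numbers.\<close>

definition superpolys :: "complex set \<Rightarrow> nat \<Rightarrow> superpoly set" where
  "superpolys K n =
     {f. \<forall>(\<alpha>, I)\<in>supp f.
           Poly_Mapping.keys \<alpha> \<subseteq> {..<n} \<and> fset I \<subseteq> {..<n} \<and> scoeff f (\<alpha>, I) \<in> K}"

definition super_ring :: "complex set \<Rightarrow> nat \<Rightarrow> superpoly ring" where
  "super_ring K n =
     \<lparr>carrier = superpolys K n, monoid.mult = (*), one = 1, ring.zero = 0, add = (+)\<rparr>"

lemma superpolys_iff:
  assumes "0 \<in> K"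
  shows "f \<in> superpolys K n \<longleftrightarrow>
    (\<forall>p. Poly_Mapping.lookup (coeffs f) p \<in> K \<and>
       (\<not> (Poly_Mapping.keys (fst p) \<subseteq> {..<n} \<and> fset (snd p) \<subseteq> {..<n}) \<longrightarrow>
        Poly_Mapping.lookup (coeffs f) p = 0))"
  unfolding superpolys_def supp_def scoeff_def mem_Collect_eq Ball_def in_keys_iff case_prod_beta
    prod.collapse
  using assms by metis

lemma superpolys_mult:
  assumes K: "0 \<in> K" "1 \<in> K" "\<And>a b. a \<in> K \<Longrightarrow> b \<in> K \<Longrightarrow> a + b \<in> K"
    "\<And>a b. a \<in> K \<Longrightarrow> b \<in> K \<Longrightarrow> a * b \<in> K" "\<And>a. a \<in> K \<Longrightarrow> - a \<in> K"
    and f: "f \<in> superpolys K n" and g: "g \<in> superpolys K n"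
  shows "f * g \<in> superpolys K n"
proof -
  have sum_K: "sum h A \<in> K" if "\<And>x. x \<in> A \<Longrightarrow> h x \<in> K" for h and A :: "super_index set"
    using that by (induction A rule: infinite_finite_induct) (auto intro: K)
  have sign_K: "ext_sign I J \<in> K" for I J
    using K by (cases "even (card (inversions I J))") (auto simp: ext_sign_def)
  let ?ok = "\<lambda>p :: super_index. Poly_Mapping.keys (fst p) \<subseteq> {..<n} \<and> fset (snd p) \<subseteq> {..<n}"
  let ?t = "\<lambda>p q. Poly_Mapping.single (index_mult p q)
    (Poly_Mapping.lookup (coeffs f) p * Poly_Mapping.lookup (coeffs g) q *
      ext_sign (snd p) (snd q))"
  have fK: "Poly_Mapping.lookup (coeffs f) p \<in> K"
    and f0: "\<not> ?ok p \<Longrightarrow> Poly_Mapping.lookup (coeffs f) p = 0" for p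
    using spec[OF iffD1[OF superpolys_iff[OF K(1)] f], of p] by simp_all
  have fok: "?ok p" if "p \<in> Poly_Mapping.keys (coeffs f)" for p
    using f0[of p] that[unfolded in_keys_iff] by argo
  have gK: "Poly_Mapping.lookup (coeffs g) p \<in> K"
    and g0: "\<not> ?ok p \<Longrightarrow> Poly_Mapping.lookup (coeffs g) p = 0" for p
    using spec[OF iffD1[OF superpolys_iff[OF K(1)] g], of p] by simp_all
  have gok: "?ok p" if "p \<in> Poly_Mapping.keys (coeffs g)" for p
    using g0[of p] that[unfolded in_keys_iff] by argo
  have ok: "?ok (index_mult p q)"
    if "p \<in> Poly_Mapping.keys (coeffs f)" "q \<in> Poly_Mapping.keys (coeffs g)" for p q
    using fok[OF that(1)] gok[OF that(2)] keys_add[of "fst p" "fst q"]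
    unfolding index_mult_def fst_conv snd_conv union_fset by (meson Un_least order_trans)
  have 1: "Poly_Mapping.lookup (?t p q) r \<in> K" for p q r
    using K fK gK sign_K by (auto simp: lookup_single when_def)
  have 2: "Poly_Mapping.lookup (?t p q) r = 0"
    if "p \<in> Poly_Mapping.keys (coeffs f)" "q \<in> Poly_Mapping.keys (coeffs g)" "\<not> ?ok r" for p q r
    using ok[OF that(1,2)] that(3) by (auto simp: lookup_single when_def)
  show ?thesis
    unfolding superpolys_iff[OF K(1)] times_superpoly.rep_eq super_times_def lookup_sum
  proof (intro allI conjI impI)
    fix r
    show "(\<Sum>p\<in>Poly_Mapping.keys (coeffs f). \<Sum>q\<in>Poly_Mapping.keys (coeffs g).
        Poly_Mapping.lookup (?t p q) r) \<in> K"
      by (intro sum_K 1)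
    assume "\<not> ?ok r"
    thus "(\<Sum>p\<in>Poly_Mapping.keys (coeffs f). \<Sum>q\<in>Poly_Mapping.keys (coeffs g).
        Poly_Mapping.lookup (?t p q) r) = 0"
      by (intro sum.neutral ballI 2)
  qed
qed

lemma ring_super_ring:
  assumes "subfield K (ring_of_type_algebra :: complex ring)"
  shows "ring (super_ring K n)"
proof -
  let ?C = "ring_of_type_algebra :: complex ring"
  interpret C: ring ?C by (rule ring_from_type_algebra)
  have sub: "subring K ?C" using assms by (simp add: subfield_def subdomain_def subcring_def)
  have minus_C: "\<ominus>\<^bsub>?C\<^esub> a = - a" for a
    using C.minus_equality[of "- a" a] by (simp add: ring_of_type_algebra_def)
  have K: "0 \<in> K" "1 \<in> K" "\<And>a b. a \<in> K \<Longrightarrow> b \<in> K \<Longrightarrow> a + b \<in> K"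
    "\<And>a b. a \<in> K \<Longrightarrow> b \<in> K \<Longrightarrow> a * b \<in> K" "\<And>a. a \<in> K \<Longrightarrow> - a \<in> K"
    using subringE(2,3,5,6,7)[OF sub] unfolding minus_C by (simp_all add: ring_of_type_algebra_def)
  note iff = superpolys_iff[OF K(1)]
  have zero: "0 \<in> superpolys K n" and one: "1 \<in> superpolys K n"
    using K by (auto simp: iff zero_superpoly.rep_eq one_superpoly.rep_eq lookup_single when_def)
  have add: "f + g \<in> superpolys K n" if "f \<in> superpolys K n" "g \<in> superpolys K n" for f g
    using that K by (simp add: iff plus_superpoly.rep_eq lookup_add)
  have uminus: "- f \<in> superpolys K n" if "f \<in> superpolys K n" for f
    using that K by (simp add: iff uminus_superpoly.rep_eq)
  have "abelian_group (super_ring K n)"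
  proof (rule abelian_groupI)
    fix f assume "f \<in> carrier (super_ring K n)"
    thus "\<exists>g\<in>carrier (super_ring K n). g \<oplus>\<^bsub>super_ring K n\<^esub> f = \<zero>\<^bsub>super_ring K n\<^esub>"
      using uminus by (intro bexI[of _ "- f"]) (auto simp: super_ring_def)
  qed (auto simp: super_ring_def zero add algebra_simps)
  moreover have "monoid (super_ring K n)"
    by (rule monoidI) (auto simp: super_ring_def one superpolys_mult K algebra_simps)
  ultimately show ?thesis
    by (rule ringI) (auto simp: super_ring_def algebra_simps)
qed

definition bihomogeneous :: "int \<Rightarrow> int \<Rightarrow> superpoly \<Rightarrow> bool" where
  "bihomogeneous i k f \<longleftrightarrow>
     (\<forall>(\<alpha>, I)\<in>supp f.
        int (\<Sum>j\<in>Poly_Mapping.keys \<alpha>. Poly_Mapping.lookup \<alpha> j) = i \<and> int (fcard I) = k)"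

text \<open>
  The algebra endomorphism with \<open>x\<^sub>j \<mapsto> u j\<close> and \<open>\<theta>\<^sub>j \<mapsto> v j\<close>, written out on the monomial basis.
\<close>

definition super_subst ::
  "(nat \<Rightarrow> superpoly) \<Rightarrow> (nat \<Rightarrow> superpoly) \<Rightarrow> superpoly \<Rightarrow> superpoly" where
  "super_subst u v =
     linear_ext (\<lambda>(\<alpha>, I).
       prod_list (map (\<lambda>j. u j ^ Poly_Mapping.lookup \<alpha> j)
         (sorted_list_of_set (Poly_Mapping.keys \<alpha>))) *
       prod_list (map v (sorted_list_of_fset I)))"

definition mat_act :: "complex mat \<Rightarrow> superpoly \<Rightarrow> superpoly" where
  "mat_act \<sigma> =
     super_subst
       (\<lambda>j. \<Sum>i<dim_row \<sigma>. super_const (cnj (\<sigma> $$ (i, j))) * xvar i)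
       (\<lambda>j. \<Sum>i<dim_row \<sigma>. super_const (cnj (\<sigma> $$ (i, j))) * tvar i)"

definition x_deriv :: "nat \<Rightarrow> superpoly \<Rightarrow> superpoly" where
  "x_deriv i =
     linear_ext (\<lambda>(\<alpha>, I).
       super_monom (\<alpha> - Poly_Mapping.single i 1) I (of_nat (Poly_Mapping.lookup \<alpha> i)))"

text \<open>If \<open>i\<close> is the \<open>l\<close>-th smallest element of \<open>I\<close>, then \<open>l - 1\<close> elements of \<open>I\<close> are below \<open>i\<close>.\<close>

definition t_deriv :: "nat \<Rightarrow> superpoly \<Rightarrow> superpoly" where
  "t_deriv i =
     linear_ext (\<lambda>(\<alpha>, I).
       if i |\<in>| I
       then super_monom \<alpha> (I |-| {|i|}) ((-1) ^ card {j. j |\<in>| I \<and> j < i})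
       else 0)"

text \<open>
  The operator \<open>\<partial>\<^sub>\<omega>\<close>.  \<open>fold\<close> applies the operator belonging to the first list element first, so for
  \<open>I = {i1 < \<dots> < ik}\<close> it yields the composition \<open>\<partial>\<^bsub>\<theta>ik\<^esub> \<dots> \<partial>\<^bsub>\<theta>i1\<^esub>\<close> as required.
\<close>

definition super_deriv :: "superpoly \<Rightarrow> superpoly \<Rightarrow> superpoly" where
  "super_deriv \<omega> \<eta> =
     (\<Sum>(\<alpha>, I)\<in>supp \<omega>.
        super_const (cnj (scoeff \<omega> (\<alpha>, I))) *
        fold (\<lambda>j. x_deriv j ^^ Poly_Mapping.lookup \<alpha> j)
          (sorted_list_of_set (Poly_Mapping.keys \<alpha>))
          (fold t_deriv (sorted_list_of_fset I) \<eta>))"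

text \<open>
  \<open>genideal\<close> gives the two-sided ideal.  As bihomogeneous elements commute or anticommute with each
  other, it coincides with the left and the right ideal generated by the same set.
\<close>

definition super_invariant_ideal :: "complex set \<Rightarrow> nat \<Rightarrow> complex mat set \<Rightarrow> superpoly set" where
  "super_invariant_ideal K n G =
     genideal (super_ring K n)
       {f \<in> superpolys K n.
          (\<exists>i k. bihomogeneous i k f \<and> i + k > 0) \<and> (\<forall>\<sigma>\<in>G. mat_act \<sigma> f = f)}"

definition super_harmonics :: "complex set \<Rightarrow> nat \<Rightarrow> complex mat set \<Rightarrow> superpoly set" where
  "super_harmonics K n G =
     {\<eta> \<in> superpolys K n. \<forall>\<omega>\<in>super_invariant_ideal K n G. super_deriv \<omega> \<eta> = 0}"

definition super_harmonics_component ::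
  "complex set \<Rightarrow> nat \<Rightarrow> complex mat set \<Rightarrow> int \<Rightarrow> int \<Rightarrow> superpoly set" where
  "super_harmonics_component K n G i k = {\<eta> \<in> super_harmonics K n G. bihomogeneous i k \<eta>}"

text \<open>The group \<open>G(m, 1, n)\<close>.\<close>

definition monomial_group :: "nat \<Rightarrow> nat \<Rightarrow> complex mat set" where
  "monomial_group m n =
     {\<sigma> \<in> carrier_mat n n.
        (\<forall>i<n. \<exists>!j. j < n \<and> \<sigma> $$ (i, j) \<noteq> 0) \<and>
        (\<forall>j<n. \<exists>!i. i < n \<and> \<sigma> $$ (i, j) \<noteq> 0) \<and>
        (\<forall>i<n. \<forall>j<n. \<sigma> $$ (i, j) \<noteq> 0 \<longrightarrow> \<sigma> $$ (i, j) ^ m = 1)}"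

end

theory Submission
  imports Defs "HOL-Combinatorics.Permutations"
begin

text \<open>
  Write \<open>y\<^sub>j = x\<^sub>j\<^sup>m\<close>, let \<open>h\<^sub>r(S)\<close> be the complete homogeneous symmetric polynomial of degree \<open>r\<close> in
  the \<open>y\<^sub>j\<close> with \<open>j \<in> S\<close>, and let polynomials in the \<open>x\<^sub>j\<close> act on superpolynomials as constant
  coefficient differential operators.

  Upper bound.  Let \<open>\<eta>\<close> be harmonic with a monomial \<open>x\<^sup>\<alpha> \<theta>\<^sub>I\<close>, where \<open>|\<alpha>| = i\<close> and \<open>|I| = k\<close>, and let
  \<open>F\<close> be its coefficient at \<open>\<theta>\<^sub>I\<close>.  Only the invariants \<open>\<Sum>\<^sub>j y\<^sub>j\<^sup>r\<close> and their differentials are used.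
  By Newton's identities the former give that \<open>F\<close> is killed by \<open>h\<^sub>r(S)\<close> whenever \<open>r + |S| > n\<close>; the
  latter give that \<open>F\<close> is killed by \<open>c\<^sub>a = x\<^sub>a\<^sup>m\<^sup>-\<^sup>1 h\<^sub>n\<^sub>-\<^sub>k(y\<^sub>a, y\<^sub>I)\<close> for \<open>a \<in> I\<close> (\<open>corner_kills\<close>).  It
  remains to bound the degree of a polynomial killed by all these operators.  Call a list of
  operators coregular if each one is surjective on the joint kernel of the others before it; this
  is dual to being a regular sequence, and local nilpotency makes it independent of the order.
  If \<open>e = c g\<close> modulo the other members, then \<open>e\<close> may be replaced by \<open>g\<close>, and the new joint kernel
  is the image under \<open>c\<close> of the old one (\<open>cancel_factor\<close>).  Starting from the powers \<open>y\<^sub>j\<^sup>n\<close>, whose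
  joint kernel lives in degree at most \<open>n(mn - 1)\<close>, the identities
  \<open>h\<^sub>r\<^sub>+\<^sub>1(a, S) - h\<^sub>r\<^sub>+\<^sub>1(c, S) = (a - c) h\<^sub>r(a, c, S)\<close> and
  \<open>r h\<^sub>r(S) = \<Sum>\<^sub>a\<^sub>\<in>\<^sub>S a h\<^sub>r\<^sub>-\<^sub>1(a, S)\<close> lead by such cancellations to the operators \<open>c\<^sub>a\<close> and suitable
  \<open>h\<^sub>r(S)\<close>.  So \<open>F\<close> is the image of a polynomial of degree at most \<open>n(mn - 1)\<close> under the product of
  all cancelled factors, and subtracting the degree of that product leaves exactly the claimed
  bound (\<open>degree_bound\<close>).  If \<open>m = 1\<close> and \<open>k = n\<close>, then \<open>c\<^sub>a = 1\<close> and already \<open>F = 0\<close>.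

  Lower bound.  Let \<open>\<Delta>\<close> be the alternant \<open>\<Sum>\<^sub>p sgn(p) \<Prod>\<^sub>j x\<^sub>j\<^sup>m\<^sup>-\<^sup>1\<^sup>+\<^sup>m\<^sup>p\<^sup>(\<^sup>j\<^sup>)\<close> and let
  \<open>d\<^sub>l = \<Sum>\<^sub>j \<partial>\<^bsub>x\<^sub>j\<^esub>\<^sup>m\<^sup>l\<^sup>+\<^sup>1 \<theta>\<^sub>j\<close>.  For an invariant \<open>\<omega>\<close> of positive degree, \<open>\<partial>\<^sub>\<omega> \<Delta>\<close> transforms like \<open>\<Delta>\<close> but
  has smaller degree, so it vanishes (\<open>annihilated_alternant\<close>).  The supercommutator of \<open>\<partial>\<^sub>\<omega>\<close> with
  \<open>d\<^sub>l\<close> is \<open>\<partial>\<^bsub>\<omega>'\<^esub>\<close> for another invariant \<open>\<omega>'\<close> of positive degree, so \<open>D = d\<^sub>0 \<dots> d\<^sub>k\<^sub>-\<^sub>1 \<Delta>\<close> is harmonic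
  as well (\<open>annihilated_theta_op\<close>).  Its degree is the upper bound.  It is not zero, because a
  Laplace expansion and the antisymmetry of \<open>\<Delta>\<close> write a certain derivative of \<open>D\<close> as \<open>k!\<close> times
  one coefficient of \<open>\<Delta>\<close>, up to a nonzero factor (\<open>Laplace_expansion\<close>).  Derivatives of \<open>D\<close> in
  the \<open>x\<^sub>j\<close> fill all lower \<open>x\<close>-degrees.
\<close>

section \<open>Complete homogeneous symmetric polynomials\<close>

fun complete_hom :: "nat \<Rightarrow> 'a :: comm_ring_1 list \<Rightarrow> 'a" where
  "complete_hom 0 xs = 1"
| "complete_hom (Suc r) [] = 0"
| "complete_hom (Suc r) (x # xs) = complete_hom (Suc r) xs + x * complete_hom r (x # xs)"

lemma complete_hom_swap: "complete_hom r (a # b # xs) = complete_hom r (b # a # xs)"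
proof (induction r rule: less_induct)
  case (less r)
  consider "r = 0" | "r = 1" | s where "r = Suc (Suc s)"
    by (metis One_nat_def not0_implies_Suc)
  thus ?case
  proof cases
    case 3
    have IH: "complete_hom (Suc s) (a # b # xs) = complete_hom (Suc s) (b # a # xs)"
      "complete_hom s (a # b # xs) = complete_hom s (b # a # xs)" by (rule less.IH; simp add: 3)+
    have e: "complete_hom (Suc s) (b # a # xs) = complete_hom (Suc s) (b # xs) + a * complete_hom s (b # a # xs)"
      "complete_hom (Suc s) (b # a # xs) = complete_hom (Suc s) (a # xs) + b * complete_hom s (b # a # xs)"
      by (metis IH complete_hom.simps(3), rule complete_hom.simps(3))
    have "b * complete_hom (Suc s) (b # xs) + a * complete_hom (Suc s) (b # a # xs)
       = a * complete_hom (Suc s) (a # xs) + b * complete_hom (Suc s) (b # a # xs)"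
      using arg_cong[OF e(1), of "\<lambda>z. b * z"] arg_cong[OF e(2), of "\<lambda>z. a * z"]
      by (simp add: algebra_simps del: complete_hom.simps)
    thus ?thesis unfolding 3 complete_hom.simps(3)[of "Suc s"] IH by (simp add: add.assoc del: complete_hom.simps)
  qed (auto simp: algebra_simps)
qed

lemma complete_hom_cons_cong:
  assumes "\<And>r. complete_hom r xs = complete_hom r ys"
  shows "complete_hom r (a # xs) = complete_hom r (a # ys)"
  using assms by (induction r) auto

lemma complete_hom_mset_eq: "mset xs = mset ys \<Longrightarrow> complete_hom r xs = complete_hom r ys"
proof (induction xs arbitrary: ys r)
  case (Cons a xs)
  have move: "complete_hom r (a # us @ vs) = complete_hom r (us @ a # vs)" for us vs r
  proof (induction us arbitrary: r)
    case (Cons u us)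
    have "complete_hom r (a # (u # us) @ vs) = complete_hom r (u # a # us @ vs)" by (simp add: complete_hom_swap)
    also have "\<dots> = complete_hom r (u # us @ a # vs)" by (rule complete_hom_cons_cong) (rule Cons)
    finally show ?case by simp
  qed simp
  from Cons.prems obtain us vs where ys: "ys = us @ a # vs"
    by (metis in_set_conv_decomp list.set_intros(1) mset_eq_setD)
  with Cons.prems have "mset xs = mset (us @ vs)" by simp
  hence "complete_hom r (a # xs) = complete_hom r (a # us @ vs)" by (intro complete_hom_cons_cong Cons.IH)
  thus ?case by (simp add: move ys)
qed simp

text \<open>
  Expand \<open>h\<^sub>r\<^sub>+\<^sub>1(a, c, S)\<close> once with respect to \<open>a\<close> and once with respect to \<open>c\<close>.
\<close>

lemma complete_hom_difference:
  "complete_hom (Suc r) (a # xs) - complete_hom (Suc r) (c # xs) = (a - c) * complete_hom r (a # c # xs)"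
proof -
  have "complete_hom (Suc r) (a # c # xs) = complete_hom (Suc r) (c # a # xs)" by (rule complete_hom_swap)
  thus ?thesis by (simp only: complete_hom.simps complete_hom_swap[of r c a]) (simp add: algebra_simps del: complete_hom.simps)
qed

lemma complete_hom_cons_expand: "complete_hom r (a # xs) = (\<Sum>i\<le>r. a ^ i * complete_hom (r - i) xs)"
proof (induction r)
  case (Suc r)
  have "(\<Sum>i\<le>Suc r. a ^ i * complete_hom (Suc r - i) xs)
     = complete_hom (Suc r) xs + (\<Sum>i\<le>r. a ^ Suc i * complete_hom (r - i) xs)"
    by (subst sum.atMost_Suc_shift) simp
  also have "(\<Sum>i\<le>r. a ^ Suc i * complete_hom (r - i) xs) = a * complete_hom r (a # xs)"
    by (simp only: Suc sum_distrib_left) (simp add: mult.assoc)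
  finally show ?case by simp
qed simp

text \<open>
  Euler's identity for a homogeneous polynomial: \<open>h\<^sub>r(a, S)\<close> is the partial derivative of
  \<open>h\<^sub>r\<^sub>+\<^sub>1(S)\<close> in the variable \<open>a\<close>.  Expanding \<open>h\<^sub>r(a, S)\<close> in powers of \<open>a\<close> turns it into Newton's
  identity, and both readings are used below.
\<close>

lemma complete_hom_Euler:
  "(\<Sum>a\<leftarrow>xs. a * complete_hom r (a # xs)) = of_nat (Suc r) * complete_hom (Suc r) xs"
proof (induction xs arbitrary: r)
  case (Cons c xs)
  show ?case
  proof (induction r)
    case 0
    have "(\<Sum>a\<leftarrow>xs. a) = complete_hom 1 xs" using Cons[of 0] by simp
    thus ?case by simp
  next
    case (Suc r)
    have ex: "complete_hom (Suc r) (a # c # xs) = complete_hom (Suc r) (a # xs) + c * complete_hom r (a # c # xs)" for a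
      by (metis complete_hom.simps(3) complete_hom_swap)
    have "(\<Sum>a\<leftarrow>xs. a * complete_hom (Suc r) (a # c # xs))
       = (\<Sum>a\<leftarrow>xs. a * complete_hom (Suc r) (a # xs) + c * (a * complete_hom r (a # c # xs)))"
      by (simp add: ex algebra_simps del: complete_hom.simps)
    also have "\<dots> = of_nat (Suc (Suc r)) * complete_hom (Suc (Suc r)) xs
        + c * (\<Sum>a\<leftarrow>xs. a * complete_hom r (a # c # xs))"
      by (simp only: sum_list_addf sum_list_const_mult Cons)
    also have "(\<Sum>a\<leftarrow>xs. a * complete_hom r (a # c # xs))
      = of_nat (Suc r) * complete_hom (Suc r) (c # xs) - c * complete_hom r (c # c # xs)"
      using Suc by (simp add: algebra_simps del: complete_hom.simps of_nat_Suc)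
    finally have *: "(\<Sum>a\<leftarrow>xs. a * complete_hom (Suc r) (a # c # xs)) =
      of_nat (Suc (Suc r)) * complete_hom (Suc (Suc r)) xs
        + c * (of_nat (Suc r) * complete_hom (Suc r) (c # xs) - c * complete_hom r (c # c # xs))" .
    have 2: "complete_hom (Suc r) (c # c # xs) = complete_hom (Suc r) (c # xs) + c * complete_hom r (c # c # xs)"
      "complete_hom (Suc (Suc r)) (c # xs) = complete_hom (Suc (Suc r)) xs + c * complete_hom (Suc r) (c # xs)"
      by simp_all
    show ?case
      unfolding list.map sum_list.Cons * 2 by (simp add: algebra_simps del: complete_hom.simps)
  qed
qed simp

section \<open>Coregular systems of operators\<close>

text \<open>
  A commutative ring acts on an abelian group like differential operators act on polynomials:
  each \<open>x j\<close> is locally nilpotent and has a right inverse, integration, which commutes with the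
  other \<open>x i\<close>.  The abstraction separates the argument from the encoding of polynomials.
\<close>

locale nilpotent_action =
  fixes act :: "'r :: comm_ring_1 \<Rightarrow> 'v :: ab_group_add \<Rightarrow> 'v"
    and x :: "nat \<Rightarrow> 'r" and antideriv :: "nat \<Rightarrow> 'v \<Rightarrow> 'v" and n m :: nat
  assumes act_add_left: "act (f + g) v = act f v + act g v"
    and act_add_right: "act f (v + w) = act f v + act f w"
    and act_mult: "act (f * g) v = act f (act g v)"
    and act_one: "act 1 v = v"
    and of_nat_unit: "\<exists>u :: 'r. u * of_nat (Suc k) = 1"
    and x_nilpotent: "j < n \<Longrightarrow> \<exists>l. act (x j ^ l) v = 0"
    and act_antideriv: "j < n \<Longrightarrow> act (x j) (antideriv j v) = v"
    and antideriv_commute: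
      "j < n \<Longrightarrow> i < n \<Longrightarrow> i \<noteq> j \<Longrightarrow> act (x i) (antideriv j v) = antideriv j (act (x i) v)"
    and antideriv_zero: "j < n \<Longrightarrow> antideriv j 0 = 0"
    and m_pos: "m > 0"
begin

lemma act_zero_left [simp]: "act 0 v = 0"
  using act_add_left[of 0 0 v] by simp

lemma act_zero_right [simp]: "act f 0 = 0"
  using act_add_right[of f 0 0] by simp

lemma act_uminus_left: "act (- f) v = - act f v"
  using act_add_left[of f "- f" v] by (simp add: eq_neg_iff_add_eq_0 add.commute)

lemma act_uminus_right: "act f (- v) = - act f v"
  using act_add_right[of f v "- v"] by (simp add: eq_neg_iff_add_eq_0 add.commute)

lemma act_diff_left: "act (f - g) v = act f v - act g v"
  using act_add_left[of f "- g" v] by (simp add: act_uminus_left)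

lemma act_diff_right: "act f (v - w) = act f v - act f w"
  using act_add_right[of f v "- w"] by (simp add: act_uminus_right)

lemma act_sum_left: "act (sum f A) v = (\<Sum>a\<in>A. act (f a) v)"
  by (induction A rule: infinite_finite_induct) (auto simp: act_add_left)

lemma act_sum_right: "act f (sum v A) = (\<Sum>a\<in>A. act f (v a))"
  by (induction A rule: infinite_finite_induct) (auto simp: act_add_right)

lemma act_commute: "act f (act g v) = act g (act f v)"
  by (metis act_mult mult.commute)

definition loc_nilpotent :: "'r \<Rightarrow> bool" where
  "loc_nilpotent f \<longleftrightarrow> (\<forall>v. \<exists>l. act (f ^ l) v = 0)"

lemma act_power_vanish_mono:
  assumes "act (f ^ l) v = 0" "l \<le> l'"
  shows "act (f ^ l' * g) v = 0"
proof -
  have "f ^ l' * g = (f ^ (l' - l) * g) * f ^ l" using assms(2)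
    by (simp add: mult_ac flip: power_add)
  thus ?thesis by (simp only: act_mult assms) simp
qed

lemma loc_nilpotent_mult: "loc_nilpotent f \<Longrightarrow> loc_nilpotent (g * f)"
  unfolding loc_nilpotent_def power_mult_distrib act_mult by (metis act_zero_right)

lemma loc_nilpotent_add:
  assumes "loc_nilpotent f" "loc_nilpotent g"
  shows "loc_nilpotent (f + g)"
  unfolding loc_nilpotent_def
proof
  fix v
  obtain k l where k: "act (f ^ k) v = 0" and l: "act (g ^ l) v = 0"
    using assms unfolding loc_nilpotent_def by blast
  have "act (of_nat ((k + l) choose i) * f ^ i * g ^ (k + l - i)) v = 0" for i
  proof (cases "k \<le> i")
    case True
    thus ?thesis using act_power_vanish_mono[OF k True, of "of_nat ((k + l) choose i) * g ^ (k + l - i)"]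
      by (simp add: mult_ac)
  next
    case False
    hence "l \<le> k + l - i" by simp
    from act_power_vanish_mono[OF l this, of "of_nat ((k + l) choose i) * f ^ i"]
    show ?thesis by (simp add: mult_ac)
  qed
  hence "act ((f + g) ^ (k + l)) v = 0"
    by (simp add: binomial_ring act_sum_left)
  thus "\<exists>l. act ((f + g) ^ l) v = 0" ..
qed

lemma loc_nilpotent_power: "loc_nilpotent f \<Longrightarrow> e > 0 \<Longrightarrow> loc_nilpotent (f ^ e)"
  using loc_nilpotent_mult[of f "f ^ (e - 1)"] by (cases e) (auto simp: mult.commute)

lemma loc_nilpotent_zero: "loc_nilpotent 0"
  unfolding loc_nilpotent_def by (metis act_zero_left power_one_right)

lemma loc_nilpotent_complete_hom:
  "(\<And>z. z \<in> set zs \<Longrightarrow> loc_nilpotent z) \<Longrightarrow> loc_nilpotent (complete_hom (Suc r) zs)"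
proof (induction zs arbitrary: r)
  case (Cons z zs)
  have "loc_nilpotent (complete_hom r (z # zs) * z)" by (rule loc_nilpotent_mult) (use Cons in auto)
  thus ?case using Cons by (auto intro!: loc_nilpotent_add simp: mult.commute)
qed (auto intro: loc_nilpotent_zero)

lemma loc_nilpotent_x: "j < n \<Longrightarrow> loc_nilpotent (x j)"
  using x_nilpotent by (auto simp: loc_nilpotent_def)

definition joint_kernel :: "'r set \<Rightarrow> 'v set" where
  "joint_kernel F = {v. \<forall>f\<in>F. act f v = 0}"

lemma joint_kernel_insert: "v \<in> joint_kernel (insert f F) \<longleftrightarrow> act f v = 0 \<and> v \<in> joint_kernel F"
  by (auto simp: joint_kernel_def)

lemma act_in_joint_kernel: "v \<in> joint_kernel F \<Longrightarrow> act f v \<in> joint_kernel F"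
  by (simp add: joint_kernel_def act_commute[of _ f])

lemma diff_in_joint_kernel: "v \<in> joint_kernel F \<Longrightarrow> w \<in> joint_kernel F \<Longrightarrow> v - w \<in> joint_kernel F"
  by (simp add: joint_kernel_def act_diff_right)

text \<open>
  The dual of a regular sequence: the last element of the list comes first, and the head acts
  surjectively on the joint kernel of the tail.
\<close>

fun coregular :: "'r list \<Rightarrow> bool" where
  "coregular [] \<longleftrightarrow> True"
| "coregular (f # fs) \<longleftrightarrow>
     coregular fs \<and> (\<forall>v\<in>joint_kernel (set fs). \<exists>w\<in>joint_kernel (set fs). act f w = v)"

text \<open>
  The counterpart of the fact that a homogeneous regular sequence may be permuted.  To solve
  \<open>g w = v\<close> on the joint kernel \<open>V\<close> of \<open>fs\<close>, one first solves \<open>g w = f v\<close>, by induction on the power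
  of \<open>f\<close> that kills \<open>v\<close>, and divides \<open>w\<close> by \<open>f\<close>; the error lies in the kernel of \<open>f\<close>, where \<open>g\<close> is
  surjective.
\<close>

lemma coregular_swap:
  assumes "coregular (g # f # fs)" "loc_nilpotent f"
  shows "coregular (f # g # fs)"
proof -
  let ?V = "joint_kernel (set fs)"
  have f: "\<exists>w\<in>?V. act f w = v" if "v \<in> ?V" for v using that assms by auto
  have g: "\<exists>w\<in>?V. act f w = 0 \<and> act g w = v" if "v \<in> ?V" "act f v = 0" for v
    using that assms(1) by (fastforce simp: joint_kernel_insert)
  have g': "\<exists>w\<in>?V. act g w = v" if "v \<in> ?V" "act (f ^ l) v = 0" for l v
    using that
  proof (induction l arbitrary: v)
    case 0
    hence "v = 0" by (simp add: act_one)
    thus ?case by (intro bexI[of _ 0]) (auto simp: joint_kernel_def)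
  next
    case (Suc l)
    have "act (f ^ l) (act f v) = 0"
      using Suc.prems by (simp add: act_mult[symmetric] mult.commute)
    with Suc.IH[of "act f v"] Suc.prems obtain w where w: "w \<in> ?V" "act g w = act f v"
      by (auto intro: act_in_joint_kernel)
    obtain w' where w': "w' \<in> ?V" "act f w' = w" using f w by blast
    have "act f (v - act g w') = 0"
      using w w' by (simp add: act_diff_right act_commute[of f g])
    moreover have "v - act g w' \<in> ?V" using Suc.prems w' by (intro diff_in_joint_kernel act_in_joint_kernel)
    ultimately obtain u where "u \<in> ?V" "act g u = v - act g w'" using g by blast
    hence "u + w' \<in> ?V" "act g (u + w') = v"
      using w' by (auto simp: joint_kernel_def act_add_right)
    thus ?case by blast
  qed
  have "\<exists>w\<in>?V. act g w = v" if "v \<in> ?V" for v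
    using assms(2) g'[OF that] unfolding loc_nilpotent_def by blast
  moreover have "\<exists>w\<in>joint_kernel (set (g # fs)). act f w = v" if v: "v \<in> joint_kernel (set (g # fs))" for v
  proof -
    from v have v': "v \<in> ?V" "act g v = 0" by (auto simp: joint_kernel_insert)
    obtain w where w: "w \<in> ?V" "act f w = v" using f v' by blast
    have "act f (act g w) = 0" using w v' by (simp add: act_commute[of f g])
    with g[of "act g w"] w obtain u where u: "u \<in> ?V" "act f u = 0" "act g u = act g w"
      by (auto intro: act_in_joint_kernel)
    have "act g (w - u) = 0" "act f (w - u) = v" "w - u \<in> ?V"
      using u w by (auto simp: act_diff_right intro: diff_in_joint_kernel)
    thus ?thesis by (intro bexI[of _ "w - u"]) (auto simp: joint_kernel_insert)
  qed
  ultimately show ?thesis using assms(1) by simp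
qed

lemma coregular_cong_head:
  "coregular (f # fs) \<Longrightarrow> coregular gs \<Longrightarrow> set fs = set gs \<Longrightarrow> coregular (f # gs)"
  by simp

lemma coregular_move_front:
  assumes "coregular fs" "f \<in> set fs" "\<And>g. g \<in> set fs \<Longrightarrow> loc_nilpotent g"
  shows "coregular (f # remove1 f fs)"
  using assms
proof (induction fs)
  case (Cons g fs)
  show ?case
  proof (cases "f = g")
    case False
    with Cons have IH: "coregular (f # remove1 f fs)" and f: "f \<in> set fs" by auto
    have "set (f # remove1 f fs) = set fs"
      using f by (induction fs) auto
    with Cons.prems IH have "coregular (g # f # remove1 f fs)"
      using coregular_cong_head[of g fs "f # remove1 f fs"] by blast
    hence "coregular (f # g # remove1 f fs)"
      by (rule coregular_swap) (use f Cons in auto)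
    thus ?thesis using False by simp
  qed (use Cons in auto)
qed simp

lemma coregular_permute:
  "coregular fs \<Longrightarrow> mset gs = mset fs \<Longrightarrow> \<forall>g\<in>set fs. loc_nilpotent g \<Longrightarrow> coregular gs"
proof (induction gs arbitrary: fs)
  case (Cons g gs)
  have g: "g \<in> set fs" using Cons.prems(2) by (metis list.set_intros(1) mset_eq_setD)
  have *: "coregular (g # remove1 g fs)"
    by (rule coregular_move_front) (use Cons g in auto)
  have m: "mset gs = mset (remove1 g fs)" using Cons.prems(2) by (simp flip: Cons.prems(2))
  have "coregular gs"
    by (rule Cons.IH[OF _ m]) (use * Cons.prems(3) in \<open>auto dest: notin_set_remove1\<close>)
  from coregular_cong_head[OF * this] mset_eq_setD[OF m] show ?case by metis
qed simp

definition coregular_system :: "'r multiset \<Rightarrow> bool" where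
  "coregular_system M \<longleftrightarrow> (\<forall>f\<in>#M. loc_nilpotent f) \<and> (\<forall>fs. mset fs = M \<longrightarrow> coregular fs)"

lemma coregular_systemI:
  assumes "coregular fs" "\<And>f. f \<in> set fs \<Longrightarrow> loc_nilpotent f"
  shows "coregular_system (mset fs)"
  unfolding coregular_system_def using coregular_permute[OF assms(1)] assms(2) by auto

text \<open>
  For polynomials, \<open>vanish_above d v\<close> says that \<open>v\<close> has degree at most \<open>d\<close>.  The bound is an integer,
  since a negative one forces \<open>v = 0\<close>.
\<close>

definition vanish_above :: "int \<Rightarrow> 'v \<Rightarrow> bool" where
  "vanish_above d v \<longleftrightarrow>
     (\<forall>js. set js \<subseteq> {..<n} \<longrightarrow> int (length js) > d \<longrightarrow> act (prod_list (map x js)) v = 0)"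

definition lowers :: "nat \<Rightarrow> 'r \<Rightarrow> bool" where
  "lowers s c \<longleftrightarrow> (\<forall>d v. vanish_above d v \<longrightarrow> vanish_above (d - int s) (act c v))"

text \<open>
  The joint kernel of \<open>M'\<close> arises from that of \<open>M\<close> by an operator which lowers degrees by \<open>s\<close>.
\<close>

definition lifts :: "nat \<Rightarrow> 'r multiset \<Rightarrow> 'r multiset \<Rightarrow> bool" where
  "lifts s M M' \<longleftrightarrow>
     (\<forall>v\<in>joint_kernel (set_mset M'). \<exists>w\<in>joint_kernel (set_mset M).
        \<forall>d. vanish_above d w \<longrightarrow> vanish_above (d - int s) v)"

lemma lifts_refl: "lifts 0 M M"
  by (auto simp: lifts_def)

lemma lifts_trans:
  assumes "lifts s M M'" "lifts t M' M''"
  shows "lifts (s + t) M M''"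
  unfolding lifts_def
proof
  fix v assume "v \<in> joint_kernel (set_mset M'')"
  with assms(2) obtain u where u: "u \<in> joint_kernel (set_mset M')"
    "\<And>d. vanish_above d u \<Longrightarrow> vanish_above (d - int t) v" unfolding lifts_def by blast
  with assms(1) obtain w where w: "w \<in> joint_kernel (set_mset M)"
    "\<And>d. vanish_above d w \<Longrightarrow> vanish_above (d - int s) u" unfolding lifts_def by blast
  have "vanish_above (d - int (s + t)) v" if "vanish_above d w" for d
    using u(2)[OF w(2)[OF that]] by (simp add: algebra_simps)
  with w(1) show "\<exists>w\<in>joint_kernel (set_mset M).
      \<forall>d. vanish_above d w \<longrightarrow> vanish_above (d - int (s + t)) v" by blast
qed

text \<open>
  The basic move.  On the joint kernel of \<open>M\<close> the operators \<open>e\<close> and \<open>c g\<close> agree.  As \<open>e\<close> is surjective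
  there, so is \<open>g\<close>; and if \<open>g v = 0\<close> and \<open>v = e u\<close>, then \<open>v = c (g u)\<close> with \<open>e (g u) = 0\<close>.
\<close>

lemma cancel_factor:
  assumes sys: "coregular_system (add_mset e M)" and e: "e = c * g + r"
    and r: "\<And>v. v \<in> joint_kernel (set_mset M) \<Longrightarrow> act r v = 0"
    and g: "loc_nilpotent g" and c: "lowers s c"
  shows "coregular_system (add_mset g M) \<and> lifts s (add_mset e M) (add_mset g M)"
proof
  obtain fs where fs: "mset fs = M" using ex_mset by blast
  hence set: "set_mset M = set fs" by auto
  from sys fs have reg: "coregular (e # fs)" unfolding coregular_system_def by (metis mset.simps(2))
  have ev: "act e v = act g (act c v)" "act e v = act c (act g v)" if "v \<in> joint_kernel (set fs)" for v
    using r that set by (simp_all add: e act_add_left act_mult act_commute[of g])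
  have "coregular (g # fs)"
    using reg by (auto simp: ev) (metis act_in_joint_kernel ev(1))
  hence "coregular_system (mset (g # fs))"
    by (rule coregular_systemI) (use sys g set in \<open>auto simp: coregular_system_def\<close>)
  thus "coregular_system (add_mset g M)" by (simp add: fs)
  show "lifts s (add_mset e M) (add_mset g M)"
    unfolding lifts_def set_mset_add_mset_insert set
  proof
    fix v assume v: "v \<in> joint_kernel (insert g (set fs))"
    hence v': "v \<in> joint_kernel (set fs)" "act g v = 0" by (auto simp: joint_kernel_insert)
    with reg obtain u where u: "u \<in> joint_kernel (set fs)" "act e u = v" by auto
    have "act c (act g u) = v" using ev(2)[OF u(1)] u by simp
    moreover have "act e (act g u) = 0"
      using u v' by (simp add: act_commute[of e g])
    ultimately show "\<exists>w\<in>joint_kernel (insert e (set fs)).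
        \<forall>d. vanish_above d w \<longrightarrow> vanish_above (d - int s) v"
      using c u unfolding lowers_def
      by (intro bexI[of _ "act g u"]) (auto simp: joint_kernel_insert intro: act_in_joint_kernel)
  qed
qed

lemma cancel_factor_family:
  assumes "finite B" and "coregular_system (M + image_mset e (mset_set B))"
    and "\<And>b. b \<in> B \<Longrightarrow> e b = c b * g b + r b"
    and "\<And>b v. b \<in> B \<Longrightarrow> v \<in> joint_kernel (set_mset M) \<Longrightarrow> act (r b) v = 0"
    and "\<And>b. b \<in> B \<Longrightarrow> loc_nilpotent (g b)" and "\<And>b. b \<in> B \<Longrightarrow> lowers s (c b)"
  shows "coregular_system (M + image_mset g (mset_set B)) \<and>
    lifts (s * card B) (M + image_mset e (mset_set B)) (M + image_mset g (mset_set B))"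
  using assms
proof (induction B arbitrary: M rule: finite_induct)
  case empty
  thus ?case by (simp add: lifts_refl)
next
  case (insert b B)
  let ?E = "\<lambda>B. image_mset e (mset_set B)" and ?G = "\<lambda>B. image_mset g (mset_set B)"
  let ?M = "add_mset (e b) M"
  have 1: "M + ?E (insert b B) = ?M + ?E B" and 2: "M + ?G (insert b B) = add_mset (g b) (M + ?G B)"
    using insert.hyps by simp_all
  have sub: "joint_kernel (set_mset ?M) \<subseteq> joint_kernel (set_mset M)" by (auto simp: joint_kernel_def)
  have IH: "coregular_system (?M + ?G B) \<and> lifts (s * card B) (?M + ?E B) (?M + ?G B)"
    by (rule insert.IH) (use insert.prems 1 sub in auto)
  have step: "coregular_system (add_mset (g b) (M + ?G B)) \<and>
      lifts s (add_mset (e b) (M + ?G B)) (add_mset (g b) (M + ?G B))"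
  proof (rule cancel_factor)
    show "coregular_system (add_mset (e b) (M + ?G B))" using IH by simp
    show "e b = c b * g b + r b" "loc_nilpotent (g b)" "lowers s (c b)" using insert.prems by auto
    show "act (r b) v = 0" if "v \<in> joint_kernel (set_mset (M + ?G B))" for v
      using insert.prems(3)[of b v] that by (auto simp: joint_kernel_def)
  qed
  have "lifts (s * card B + s) (?M + ?E B) (add_mset (g b) (M + ?G B))"
    by (rule lifts_trans[of _ _ "?M + ?G B"]) (use IH step in auto)
  thus ?case unfolding 1 2 using step insert.hyps by (simp add: add.commute)
qed

lemma lowers_x_power:
  assumes "j < n"
  shows "lowers e (x j ^ e)"
  unfolding lowers_def vanish_above_def
proof (intro allI impI)
  fix d v js
  assume v: "\<forall>js. set js \<subseteq> {..<n} \<longrightarrow> d < int (length js) \<longrightarrow> act (prod_list (map x js)) v = 0"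
    and js: "set js \<subseteq> {..<n}" "d - int e < int (length js)"
  have "act (prod_list (map x (js @ replicate e j))) v = 0"
    by (rule v[rule_format]) (use js assms in auto)
  thus "act (prod_list (map x js)) (act (x j ^ e) v) = 0" by (simp add: act_mult prod_list_replicate)
qed

lemma lowers_diff: "lowers s c \<Longrightarrow> lowers s c' \<Longrightarrow> lowers s (c - c')"
  by (simp add: lowers_def vanish_above_def act_diff_left act_diff_right)

lemma lowers_mult: "lowers s c \<Longrightarrow> lowers s (u * c)"
  by (simp add: lowers_def vanish_above_def act_mult act_commute[of _ u])


text \<open>
  Iterated integration in \<open>x j\<close> solves \<open>x j ^ e w = v\<close> without leaving the kernels of the other powers.
\<close>

lemma coregular_powers:
  assumes "e > 0" "distinct js" "set js \<subseteq> {..<n}"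
  shows "coregular (map (\<lambda>j. x j ^ e) js)"
  using assms(2,3)
proof (induction js)
  case (Cons j js)
  have anti: "act (x j ^ k) ((antideriv j ^^ k) v) = v" for k v
    using Cons.prems by (induction k) (auto simp: act_one act_mult act_commute[of "x j"] act_antideriv)
  have comm: "act (x i ^ l) ((antideriv j ^^ k) v) = (antideriv j ^^ k) (act (x i ^ l) v)"
    if "i \<in> set js" for i k l v
  proof -
    have 1: "act (x i ^ l) (antideriv j v) = antideriv j (act (x i ^ l) v)" for l v
    proof (induction l arbitrary: v)
      case (Suc l)
      have "j < n" "i < n" "i \<noteq> j" using Cons.prems that by auto
      with Suc show ?case by (simp add: act_mult antideriv_commute)
    qed (simp add: act_one)
    show ?thesis by (induction k) (simp_all add: 1)
  qed
  have zero: "(antideriv j ^^ k) 0 = 0" for k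
    using Cons.prems by (induction k) (auto simp: antideriv_zero)
  show ?case
  proof (simp only: list.map coregular.simps, intro conjI ballI)
    fix v assume "v \<in> joint_kernel (set (map (\<lambda>j. x j ^ e) js))"
    hence "(antideriv j ^^ e) v \<in> joint_kernel (set (map (\<lambda>j. x j ^ e) js))"
      by (auto simp: joint_kernel_def comm zero)
    with anti show "\<exists>w\<in>joint_kernel (set (map (\<lambda>j. x j ^ e) js)). act (x j ^ e) w = v" by blast
  qed (use Cons in auto)
qed simp

text \<open>
  Pigeonhole: a product of more than \<open>n (e - 1)\<close> variables contains some \<open>x j\<close> at least \<open>e\<close> times.
\<close>

lemma vanish_above_powers:
  assumes "e > 0" and v: "\<And>j. j < n \<Longrightarrow> act (x j ^ e) v = 0"
  shows "vanish_above (int (n * (e - 1))) v"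
  unfolding vanish_above_def
proof (intro allI impI)
  fix js assume js: "set js \<subseteq> {..<n}" "int (n * (e - 1)) < int (length js)"
  have "\<exists>j\<in>set js. count (mset js) j \<ge> e"
  proof (rule ccontr)
    assume "\<not> ?thesis"
    hence "count (mset js) j \<le> e - 1" if "j \<in> set js" for j using that by force
    hence "length js \<le> card (set js) * (e - 1)"
      using sum_bounded_above[of "set js" "count (mset js)" "e - 1"]
      by (simp add: size_mset[symmetric] size_multiset_overloaded_eq del: size_mset)
    also have "\<dots> \<le> n * (e - 1)" using js(1) by (intro mult_right_mono) (auto dest: card_mono[rotated])
    finally show False using js(2) unfolding of_nat_less_iff by simp
  qed
  then obtain j where j: "j \<in> set js" "count (mset js) j \<ge> e" by blast
  hence "replicate_mset e j \<subseteq># mset js" by (simp add: count_le_replicate_mset_subset_eq)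
  then obtain M where "mset js = replicate_mset e j + M" by (metis mset_subset_eq_exists_conv)
  hence "prod_mset (image_mset x (mset js)) = prod_mset (image_mset x M) * x j ^ e"
    by (simp add: mult.commute)
  hence "prod_list (map x js) = prod_mset (image_mset x M) * x j ^ e"
    by (metis mset_map prod_mset_prod_list)
  thus "act (prod_list (map x js)) v = 0" using v[of j] j js by (auto simp: act_mult)
qed

section \<open>From powers of the variables to the corner polynomials\<close>

definition y :: "nat \<Rightarrow> 'r" where
  "y j = x j ^ m"

text \<open>
  Up to the factor \<open>m\<close>, the polynomial \<open>corner I a\<close> is the partial derivative in \<open>x a\<close> of
  \<open>h\<^sub>n\<^sub>-\<^sub>|\<^sub>I\<^sub>|\<^sub>+\<^sub>1(y\<^sub>I)\<close>.
\<close>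

definition corner :: "nat list \<Rightarrow> nat \<Rightarrow> 'r" where
  "corner I a = x a ^ (m - 1) * complete_hom (n - length I) (y a # map y I)"

text \<open>
  These systems interpolate between the powers \<open>y b ^ n\<close> (for \<open>I = []\<close>) and a system that contains
  all polynomials \<open>corner I a\<close>.
\<close>

definition stage :: "nat list \<Rightarrow> 'r multiset" where
  "stage I = image_mset (corner I) (mset_set (set I)) +
     image_mset (\<lambda>b. complete_hom (n - length I) (y b # map y I)) (mset_set ({..<n} - set I))"

lemma y_eq: "y j = x j * x j ^ (m - 1)"
  using power_minus_mult[OF m_pos, of "x j"] by (simp add: y_def mult.commute)

lemma lowers_y_diff: "i < n \<Longrightarrow> j < n \<Longrightarrow> lowers m (y i - y j)"
  unfolding y_def by (intro lowers_diff lowers_x_power)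

lemma loc_nilpotent_complete_hom_y:
  "set S \<subseteq> {..<n} \<Longrightarrow> r > 0 \<Longrightarrow> loc_nilpotent (complete_hom r (map y S))"
  using loc_nilpotent_complete_hom[of "map y S" "r - 1"] m_pos
  by (auto simp: y_def intro!: loc_nilpotent_power loc_nilpotent_x)

lemma loc_nilpotent_corner:
  assumes "set I \<subseteq> {..<n}" "a < n" "m - 1 + (n - length I) > 0"
  shows "loc_nilpotent (corner I a)"
proof (cases "n - length I > 0")
  case True
  thus ?thesis unfolding corner_def
    using loc_nilpotent_mult[OF loc_nilpotent_complete_hom_y[of "a # I" "n - length I"]] assms by simp
next
  case False
  hence "m - 1 > 0" using assms by simp
  thus ?thesis unfolding corner_def mult.commute[of "x a ^ (m - 1)"]
    by (intro loc_nilpotent_mult loc_nilpotent_power loc_nilpotent_x assms)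
qed

lemma coregular_stage_Nil: "n > 0 \<Longrightarrow> coregular_system (stage [])"
proof -
  assume "n > 0"
  have "complete_hom r [a] = a ^ r" for r and a :: 'r by (induction r) auto
  hence "stage [] = mset (map (\<lambda>j. x j ^ (m * n)) [0..<n])"
    by (simp add: stage_def y_def atLeast0LessThan flip: power_mult)
  moreover have "m * n > 0" using m_pos \<open>n > 0\<close> by simp
  hence "coregular_system (mset (map (\<lambda>j. x j ^ (m * n)) [0..<n]))"
    by (intro coregular_systemI coregular_powers)
      (auto intro!: loc_nilpotent_power loc_nilpotent_x)
  ultimately show ?thesis by simp
qed

text \<open>
  With \<open>f = h\<^sub>N\<^sub>+\<^sub>1(y\<^sub>c, y\<^sub>I)\<close>, which belongs to the old stage, the difference identity splits the
  factor \<open>y a - y c\<close> off every other member modulo \<open>f\<close>.  After that, Euler's identity makes \<open>f\<close>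
  itself a multiple of \<open>x c\<close> modulo the new corner polynomials.  In total this cancels \<open>n - 1\<close>
  factors of degree \<open>m\<close> and one of degree \<open>1\<close>.
\<close>

lemma stage_Cons:
  assumes dist: "distinct (c # I)" and sub: "set (c # I) \<subseteq> {..<n}"
    and pos: "m - 1 + (n - length (c # I)) > 0" and sys: "coregular_system (stage I)"
  shows "coregular_system (stage (c # I)) \<and> lifts (m * (n - 1) + 1) (stage I) (stage (c # I))"
proof -
  have len: "length (c # I) \<le> n"
    using card_mono[OF _ sub] distinct_card[OF dist] by simp
  define N where "N = n - length (c # I)"
  have N: "n - length I = Suc N" "n - length (c # I) = N" using len by (auto simp: N_def)
  define B where "B = {..<n} - set I - {c}"
  have c: "c < n" "c \<notin> set I" "c \<notin> B" and finB [simp]: "finite B"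
    using dist sub by (auto simp: B_def)
  have B1: "{..<n} - set I = insert c B" and B2: "{..<n} - set (c # I) = B"
    using c by (auto simp: B_def)
  have cardB: "card B = N"
    unfolding B2[symmetric] using sub distinct_card[OF dist] by (simp add: card_Diff_subset N_def)
  define f where "f = complete_hom (Suc N) (y c # map y I)"
  define e where "e b = complete_hom (Suc N) (y b # map y I)" for b
  define g where "g b = complete_hom N (y b # map y (c # I))" for b
  let ?C = "\<lambda>J. image_mset (corner J) (mset_set (set I))"
  have st1: "stage I = ({#f#} + image_mset e (mset_set B)) + ?C I"
    unfolding stage_def B1 using c by (simp add: N f_def e_def[abs_def] del: complete_hom.simps)
  have st2: "stage (c # I) = add_mset (corner (c # I) c) (?C (c # I) + image_mset g (mset_set B))"
    unfolding stage_def B2 N(2) using c by (simp add: g_def[abs_def] del: complete_hom.simps)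
  have diff: "e b = (y b - y c) * g b + f" for b
    using complete_hom_difference[of N "y b" "map y I" "y c"]
    unfolding e_def f_def g_def by (simp add: algebra_simps del: complete_hom.simps)
  have 1: "coregular_system (({#f#} + image_mset e (mset_set B)) + ?C (c # I)) \<and>
      lifts (m * card (set I)) (stage I) (({#f#} + image_mset e (mset_set B)) + ?C (c # I))"
    unfolding st1
  proof (rule cancel_factor_family)
    show "coregular_system (({#f#} + image_mset e (mset_set B)) + ?C I)" using sys st1 by simp
    show "corner I a = (y a - y c) * corner (c # I) a + x a ^ (m - 1) * f" for a
    proof -
      have "corner I a = x a ^ (m - 1) * e a" "corner (c # I) a = x a ^ (m - 1) * g a"
        unfolding corner_def N e_def g_def by simp_all
      thus ?thesis by (simp add: diff[of a] algebra_simps)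
    qed
    show "act (x a ^ (m - 1) * f) v = 0" if "v \<in> joint_kernel (set_mset ({#f#} + image_mset e (mset_set B)))" for a v
      using that by (simp add: act_mult joint_kernel_def)
    show "loc_nilpotent (corner (c # I) a)" if "a \<in> set I" for a
      using that sub pos by (intro loc_nilpotent_corner) auto
    show "lowers m (y a - y c)" if "a \<in> set I" for a
      using that sub by (intro lowers_y_diff) auto
  qed simp_all
  have 2: "coregular_system (({#f#} + ?C (c # I)) + image_mset g (mset_set B)) \<and>
      lifts (m * card B) (({#f#} + ?C (c # I)) + image_mset e (mset_set B))
        (({#f#} + ?C (c # I)) + image_mset g (mset_set B))"
  proof (rule cancel_factor_family)
    show "coregular_system (({#f#} + ?C (c # I)) + image_mset e (mset_set B))"
      using 1 by (simp add: add_ac)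
    show "e b = (y b - y c) * g b + f" for b by (rule diff)
    show "act f v = 0" if "v \<in> joint_kernel (set_mset ({#f#} + ?C (c # I)))" for v
      using that by (simp add: joint_kernel_def)
    show "loc_nilpotent (g b)" if "b \<in> B" for b
    proof -
      have "N > 0" using that cardB card_gt_0_iff[of B] by auto
      thus ?thesis using loc_nilpotent_complete_hom_y[of "b # c # I" N] that sub
        by (simp add: g_def B_def)
    qed
    show "lowers m (y b - y c)" if "b \<in> B" for b
      using that c by (intro lowers_y_diff) (auto simp: B_def)
  qed simp
  obtain u :: 'r where u: "u * of_nat (Suc N) = 1" using of_nat_unit by blast
  have 3: "coregular_system (add_mset (corner (c # I) c) (?C (c # I) + image_mset g (mset_set B))) \<and>
      lifts 1 (add_mset f (?C (c # I) + image_mset g (mset_set B)))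
        (add_mset (corner (c # I) c) (?C (c # I) + image_mset g (mset_set B)))"
  proof (rule cancel_factor)
    show "coregular_system (add_mset f (?C (c # I) + image_mset g (mset_set B)))" using 2 by simp
    have "of_nat (Suc N) * f = (\<Sum>z\<leftarrow>map y (c # I). z * complete_hom N (z # map y (c # I)))"
      unfolding complete_hom_Euler by (simp add: f_def)
    also have "\<dots> = (\<Sum>a\<leftarrow>c # I. x a * corner (c # I) a)"
    proof -
      have "y a * complete_hom N (y a # map y (c # I)) = x a * corner (c # I) a" for a
        unfolding corner_def N mult.assoc[symmetric] y_eq[symmetric] by simp
      thus ?thesis by (simp add: comp_def)
    qed
    also have "\<dots> = x c * corner (c # I) c + (\<Sum>a\<in>set I. x a * corner (c # I) a)"
      using dist by (simp add: sum_list_distinct_conv_sum_set)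
    finally have "u * of_nat (Suc N) * f =
        u * x c * corner (c # I) c + (\<Sum>a\<in>set I. u * x a * corner (c # I) a)"
      by (simp only: mult.assoc distrib_left sum_distrib_left)
    thus "f = u * x c * corner (c # I) c + (\<Sum>a\<in>set I. u * x a * corner (c # I) a)"
      by (simp add: u del: of_nat_Suc)
    show "act (\<Sum>a\<in>set I. u * x a * corner (c # I) a) v = 0"
      if "v \<in> joint_kernel (set_mset (?C (c # I) + image_mset g (mset_set B)))" for v
      using that by (auto simp: act_sum_left act_mult joint_kernel_def intro!: sum.neutral)
    show "loc_nilpotent (corner (c # I) c)" using sub pos c by (intro loc_nilpotent_corner) auto
    show "lowers 1 (u * x c)" using lowers_x_power[of c 1] c by (intro lowers_mult) simp
  qed
  have "m * card (set I) + m * card B + 1 = m * (n - 1) + 1"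
    using len dist by (simp add: cardB N_def distinct_card flip: distrib_left)
  moreover have "lifts (m * card (set I) + m * card B + 1) (stage I) (stage (c # I))"
  proof (intro lifts_trans)
    show "lifts (m * card (set I)) (stage I) (({#f#} + ?C (c # I)) + image_mset e (mset_set B))"
      using 1 by (simp add: add_ac)
    show "lifts (m * card B) (({#f#} + ?C (c # I)) + image_mset e (mset_set B))
      (({#f#} + ?C (c # I)) + image_mset g (mset_set B))" using 2 by blast
    show "lifts 1 (({#f#} + ?C (c # I)) + image_mset g (mset_set B)) (stage (c # I))"
      using 3 by (simp add: st2)
  qed
  ultimately show ?thesis using 3 by (simp add: st2)
qed

lemma stage_from_powers:
  assumes "n > 0" "distinct I" "set I \<subseteq> {..<n}" "m - 1 + (n - length I) > 0"
  shows "coregular_system (stage I) \<and> lifts (length I * (m * (n - 1) + 1)) (stage []) (stage I)"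
  using assms(2-)
proof (induction I)
  case Nil
  thus ?case using assms(1) by (simp add: coregular_stage_Nil lifts_refl)
next
  case (Cons c I)
  have IH: "coregular_system (stage I) \<and> lifts (length I * (m * (n - 1) + 1)) (stage []) (stage I)"
    by (rule Cons.IH) (use Cons.prems in auto)
  have step: "coregular_system (stage (c # I)) \<and> lifts (m * (n - 1) + 1) (stage I) (stage (c # I))"
    by (rule stage_Cons) (use Cons.prems IH in auto)
  have "lifts (length I * (m * (n - 1) + 1) + (m * (n - 1) + 1)) (stage []) (stage (c # I))"
    using IH step by (blast intro: lifts_trans)
  thus ?case using step by (simp add: add_ac)
qed

definition symmetric_killed :: "'v \<Rightarrow> bool" where
  "symmetric_killed v \<longleftrightarrow> (\<forall>S r. distinct S \<longrightarrow> set S \<subseteq> {..<n} \<longrightarrow> r + length S > n \<longrightarrow>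
     act (complete_hom r (map y S)) v = 0)"

text \<open>
  The members of the last stage that are not corner polynomials, indexed by \<open>B\<close>, still differ
  from each other by multiples of \<open>y b - y c\<close>.  Cancelling these factors for all pairs in \<open>B\<close> gives
  a further gain of \<open>m (|B| choose 2)\<close>; each new polynomial kills \<open>v\<close>, because it is an \<open>h\<^sub>r(S)\<close> with
  \<open>r + |S| > n\<close>.
\<close>

lemma chain_lift:
  assumes "finite B" "B \<inter> set Z = {}" "B \<union> set Z = {..<n}" "distinct Z"
    and "coregular_system (M + image_mset (\<lambda>b. complete_hom (card B) (y b # map y Z)) (mset_set B))"
    and "v \<in> joint_kernel (set_mset M)" "symmetric_killed v"
  shows "\<exists>w\<in>joint_kernel (set_mset (M + image_mset (\<lambda>b. complete_hom (card B) (y b # map y Z)) (mset_set B))).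
    \<forall>d. vanish_above d w \<longrightarrow> vanish_above (d - int (m * (card B choose 2))) v"
  using assms
proof (induction B arbitrary: Z M rule: finite_induct)
  case empty
  have "(0 :: nat) choose 2 = 0" by simp
  with empty show ?case by (auto simp del: binomial_eq_0_iff)
next
  case (insert c B)
  define f where "f = complete_hom (Suc (card B)) (y c # map y Z)"
  define e where "e b = complete_hom (Suc (card B)) (y b # map y Z)" for b
  define g where "g b = complete_hom (card B) (y b # map y (c # Z))" for b
  have card: "card (insert c B) = Suc (card B)" using insert by simp
  have M: "M + image_mset (\<lambda>b. complete_hom (card (insert c B)) (y b # map y Z)) (mset_set (insert c B))
      = add_mset f M + image_mset e (mset_set B)"
    using insert.hyps by (simp add: card e_def[abs_def] f_def del: complete_hom.simps)
  have sub: "insert c B \<subseteq> {..<n}" "set Z \<subseteq> {..<n}" using insert.prems(2) by auto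
  have fam: "coregular_system (add_mset f M + image_mset g (mset_set B)) \<and>
      lifts (m * card B) (add_mset f M + image_mset e (mset_set B)) (add_mset f M + image_mset g (mset_set B))"
  proof (rule cancel_factor_family)
    show "coregular_system (add_mset f M + image_mset e (mset_set B))" using insert.prems(4) M by simp
    show "e b = (y b - y c) * g b + f" for b
      using complete_hom_difference[of "card B" "y b" "map y Z" "y c"]
      unfolding e_def f_def g_def by (simp add: algebra_simps del: complete_hom.simps)
    show "act f w = 0" if "w \<in> joint_kernel (set_mset (add_mset f M))" for w
      using that by (simp add: joint_kernel_def)
    show "loc_nilpotent (g b)" if "b \<in> B" for b
    proof -
      have "card B > 0" using that insert.hyps by (auto simp: card_gt_0_iff)
      thus ?thesis using loc_nilpotent_complete_hom_y[of "b # c # Z" "card B"] that sub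
        by (auto simp: g_def)
    qed
    show "lowers m (y b - y c)" if "b \<in> B" for b
      using that sub by (intro lowers_y_diff) auto
  qed (rule insert)
  have cZ: "distinct (c # Z)" "set (c # Z) \<subseteq> {..<n}" using insert by auto
  have "n = card (insert c B \<union> set Z)" using insert.prems(2) by simp
  also have "\<dots> = card (insert c B) + card (set Z)"
    by (rule card_Un_disjoint) (use insert in auto)
  finally have "n < Suc (card B) + length (c # Z)"
    using insert.hyps insert.prems(3) by (simp add: distinct_card)
  with insert.prems(6) cZ have "act f v = 0"
    unfolding symmetric_killed_def f_def by (metis list.simps(9))
  hence "v \<in> joint_kernel (set_mset (add_mset f M))" using insert.prems(5) by (simp add: joint_kernel_insert)
  moreover have "B \<inter> set (c # Z) = {}" "B \<union> set (c # Z) = {..<n}"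
    using insert by auto
  moreover have "coregular_system (add_mset f M + image_mset (\<lambda>b. complete_hom (card B) (y b # map y (c # Z))) (mset_set B))"
    using fam by (simp add: g_def[abs_def])
  ultimately obtain w where w: "w \<in> joint_kernel (set_mset (add_mset f M + image_mset g (mset_set B)))"
    "\<And>d. vanish_above d w \<Longrightarrow> vanish_above (d - int (m * (card B choose 2))) v"
    using insert.IH[of "c # Z" "add_mset f M"] cZ insert.prems(6) unfolding g_def by blast
  from fam w(1) obtain u where u: "u \<in> joint_kernel (set_mset (add_mset f M + image_mset e (mset_set B)))"
    "\<And>d. vanish_above d u \<Longrightarrow> vanish_above (d - int (m * card B)) w" unfolding lifts_def by blast
  have "(card (insert c B) choose 2) = card B + (card B choose 2)"
    unfolding card by (simp add: numeral_2_eq_2)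
  hence "vanish_above (d - int (m * (card (insert c B) choose 2))) v" if "vanish_above d u" for d
    using w(2)[OF u(2)[OF that]] by (simp add: algebra_simps)
  with u(1) show ?case unfolding M by blast
qed

text \<open>
  With \<open>k = |I|\<close>, the cancelled factors have total degree
  \<open>k (m (n - 1) + 1) + m ((n - k) choose 2)\<close>, to be subtracted from \<open>n (m n - 1)\<close>.
\<close>

theorem degree_bound:
  assumes "n > 0" "distinct I" "set I \<subseteq> {..<n}" and sym: "symmetric_killed v"
    and corner: "\<And>a. a \<in> set I \<Longrightarrow> act (corner I a) v = 0"
  shows "vanish_above (int m * int (n choose 2) + (int m - 1) * int n
    - int (length I) - int m * int (length I choose 2)) v"
proof -
  define k where "k = length I"
  have k: "k \<le> n" using card_mono[OF _ assms(3)] distinct_card[OF assms(2)] by (simp add: k_def)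
  show ?thesis
  proof (cases "m - 1 + (n - k) > 0")
    case False
    \<comment> \<open>Here the corner polynomial is the constant 1, which is not locally nilpotent.\<close>
    hence m: "m = 1" "n = k" using m_pos k by auto
    then obtain a where "a \<in> set I" using assms(1) k_def by (cases I) auto
    have "m - 1 = 0" "n - length I = 0" using m by (simp_all add: k_def)
    hence "corner I a = 1" unfolding corner_def by (simp only:) simp
    with corner[OF \<open>a \<in> set I\<close>] have "v = 0" by (simp add: act_one)
    thus ?thesis by (simp add: vanish_above_def)
  next
    case True
    define N where "N = n - k"
    define B where "B = {..<n} - set I"
    have cardB: "card B = N"
      using assms(2,3) by (simp add: B_def N_def k_def card_Diff_subset distinct_card)
    from True assms have st: "coregular_system (stage I)" "lifts (k * (m * (n - 1) + 1)) (stage []) (stage I)"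
      using stage_from_powers[of I] by (auto simp: k_def)
    have stI: "stage I = image_mset (corner I) (mset_set (set I)) +
        image_mset (\<lambda>b. complete_hom (card B) (y b # map y I)) (mset_set B)"
      unfolding cardB by (simp add: stage_def N_def k_def B_def)
    have "v \<in> joint_kernel (set_mset (image_mset (corner I) (mset_set (set I))))"
      using corner by (auto simp: joint_kernel_def)
    then obtain w where w: "w \<in> joint_kernel (set_mset (stage I))"
      "\<And>d. vanish_above d w \<Longrightarrow> vanish_above (d - int (m * (N choose 2))) v"
      using chain_lift[of B I "image_mset (corner I) (mset_set (set I))" v] st assms
      unfolding stI cardB[symmetric] by (auto simp: B_def)
    from st(2) w(1) obtain u where u: "u \<in> joint_kernel (set_mset (stage []))"
      "\<And>d. vanish_above d u \<Longrightarrow> vanish_above (d - int (k * (m * (n - 1) + 1))) w"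
      unfolding lifts_def by blast
    have "complete_hom r [a] = a ^ r" for r and a :: 'r by (induction r) auto
    hence "act (x j ^ (m * n)) u = 0" if "j < n" for j
      using u(1) that by (auto simp: stage_def joint_kernel_def y_def power_mult)
    hence "vanish_above (int (n * (m * n - 1))) u"
      using m_pos assms(1) by (intro vanish_above_powers) auto
    from w(2)[OF u(2)[OF this]]
    have main: "vanish_above (int (n * (m * n - 1)) - int (k * (m * (n - 1) + 1)) - int (m * (N choose 2))) v" .
    have ch: "2 * int (r choose 2) = int r * (int r - 1)" for r
    proof (cases r)
      case (Suc s)
      have "2 * (r choose 2) = r * (r - 1)"
        unfolding choose_two by (rule dvd_mult_div_cancel) (simp add: Suc)
      hence "2 * int (r choose 2) = int r * int (r - 1)" by (metis of_nat_mult of_nat_numeral)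
      thus ?thesis using Suc by simp
    qed simp
    have n: "int n = int N + int k" using k by (simp add: N_def)
    have sub: "int (m * n - 1) = int m * int n - 1" "int (n - 1) = int n - 1"
      using m_pos assms(1) by (simp_all add: of_nat_diff)
    have "2 * (int (n * (m * n - 1)) - int (k * (m * (n - 1) + 1)) - int (m * (N choose 2)))
      = 2 * int n * (int m * int n - 1) - 2 * int k * (int m * (int n - 1) + 1) - int m * (int N * (int N - 1))"
      by (simp only: of_nat_mult of_nat_add of_nat_1 sub ch[symmetric]) (simp add: algebra_simps)
    also have "\<dots> = int m * (int n * (int n - 1)) + 2 * (int m - 1) * int n - 2 * int k - int m * (int k * (int k - 1))"
      unfolding n by (simp add: algebra_simps)
    also have "\<dots> = 2 * (int m * int (n choose 2) + (int m - 1) * int n - int k - int m * int (k choose 2))"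
      by (simp only: ch[symmetric]) (simp add: algebra_simps)
    finally have "int (n * (m * n - 1)) - int (k * (m * (n - 1) + 1)) - int (m * (N choose 2))
      = int m * int (n choose 2) + (int m - 1) * int n - int k - int m * int (k choose 2)" by simp
    from main[unfolded this] show ?thesis unfolding k_def .
  qed
qed

text \<open>
  Newton's identities give \<open>h\<^sub>r\<close> in all variables for \<open>r > 0\<close>.  Variables are then removed one at a
  time by \<open>h\<^sub>r(S) = h\<^sub>r(b, S) - y\<^sub>b h\<^sub>r\<^sub>-\<^sub>1(b, S)\<close>.
\<close>

lemma symmetric_killed_if_power_sums_kill:
  assumes p: "\<And>r. act (\<Sum>j<n. y j ^ Suc r) v = 0"
  shows "symmetric_killed v"
proof -
  let ?all = "map y [0..<n]"
  have full: "act (complete_hom (Suc r) ?all) v = 0" for r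
  proof -
    have "of_nat (Suc r) * complete_hom (Suc r) ?all = (\<Sum>a\<leftarrow>?all. a * complete_hom r (a # ?all))"
      by (rule complete_hom_Euler[symmetric])
    also have "\<dots> = (\<Sum>j<n. y j * complete_hom r (y j # ?all))"
      by (simp add: comp_def interv_sum_list_conv_sum_set_nat atLeast0LessThan)
    also have "\<dots> = (\<Sum>j<n. \<Sum>i\<le>r. complete_hom (r - i) ?all * y j ^ Suc i)"
      by (simp add: complete_hom_cons_expand sum_distrib_left mult_ac del: complete_hom.simps)
    also have "\<dots> = (\<Sum>i\<le>r. complete_hom (r - i) ?all * (\<Sum>j<n. y j ^ Suc i))"
      by (subst sum.swap) (simp only: sum_distrib_left)
    finally have "act (of_nat (Suc r) * complete_hom (Suc r) ?all) v = 0"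
      by (simp only: act_sum_left act_mult p[unfolded act_sum_left] act_zero_right sum.neutral_const)
    moreover obtain u :: 'r where u: "u * of_nat (Suc r) = 1" using of_nat_unit by blast
    ultimately have "act (u * (of_nat (Suc r) * complete_hom (Suc r) ?all)) v = 0"
      by (simp only: act_mult act_zero_right)
    thus ?thesis by (simp only: mult.assoc[symmetric] u mult_1_left)
  qed
  have "act (complete_hom r (map y S)) v = 0"
    if "distinct S" "set S \<subseteq> {..<n}" "r + length S > n" for S r
    using that
  proof (induction "n - length S" arbitrary: S r)
    case 0
    have le: "length S \<le> n" using card_mono[OF _ 0(3)] distinct_card[OF 0(2)] by simp
    have "set S = {..<n}"
      by (rule card_subset_eq) (use 0 le in \<open>simp_all add: distinct_card\<close>)
    hence "mset S = mset [0..<n]"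
      using 0(2) by (intro set_eq_iff_mset_eq_distinct[THEN iffD1]) (auto simp: atLeast0LessThan)
    hence "complete_hom r (map y S) = complete_hom r ?all" by (intro complete_hom_mset_eq) (simp del: mset_upt)
    moreover obtain r' where "r = Suc r'" using 0 le by (cases r) auto
    ultimately show ?case using full by simp
  next
    case (Suc d)
    have "card (set S) < card {..<n}" using Suc.hyps(2) Suc.prems(1) by (simp add: distinct_card)
    hence "\<not> {..<n} \<subseteq> set S" by (metis List.finite_set card_mono not_less)
    then obtain b where b: "b < n" "b \<notin> set S" by auto
    obtain r' where r: "r = Suc r'" using Suc by (cases r) auto
    have "act (complete_hom r (map y (b # S))) v = 0" "act (complete_hom r' (map y (b # S))) v = 0"
      by (rule Suc.hyps; use Suc.prems Suc.hyps(2) b r in simp)+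
    moreover have "complete_hom r (map y S) = complete_hom r (map y (b # S)) - y b * complete_hom r' (map y (b # S))"
      by (simp add: r)
    ultimately show ?case by (simp only: act_diff_left act_mult act_zero_right diff_zero)
  qed
  thus ?thesis by (auto simp: symmetric_killed_def)
qed

text \<open>
  The relations \<open>rel\<close> may be combined with coefficients \<open>h\<^sub>N\<^sub>-\<^sub>s(y\<^sub>I)\<close>, \<open>N = n - |I|\<close>, which turns
  \<open>y\<^sub>j\<^sup>s\<close> into \<open>h\<^sub>N(y\<^sub>j, y\<^sub>I)\<close>.  For \<open>j\<close> outside \<open>I\<close> these are \<open>|I| + 1\<close> distinct variables, so that
  \<open>h\<^sub>N\<close> kills \<open>w j\<close>; only the term of \<open>a\<close> survives.
\<close>

lemma corner_kills:
  assumes I: "distinct I" "set I \<subseteq> {..<n}" "a \<in> set I"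
    and rel: "\<And>s. (\<Sum>j<n. act (x j ^ (m - 1) * y j ^ s) (w j)) = 0"
    and zero: "\<And>j. j \<in> set I \<Longrightarrow> j \<noteq> a \<Longrightarrow> w j = 0"
    and sym: "\<And>j. j < n \<Longrightarrow> symmetric_killed (w j)"
  shows "act (corner I a) (w a) = 0"
proof -
  define N where "N = n - length I"
  have corner: "corner I j = (\<Sum>i\<le>N. complete_hom (N - i) (map y I) * (x j ^ (m - 1) * y j ^ i))" for j
    unfolding corner_def complete_hom_cons_expand by (simp add: N_def sum_distrib_left mult_ac)
  have "(\<Sum>j<n. act (corner I j) (w j)) =
    (\<Sum>i\<le>N. act (complete_hom (N - i) (map y I)) (\<Sum>j<n. act (x j ^ (m - 1) * y j ^ i) (w j)))"
    unfolding corner act_sum_left act_mult act_sum_right by (rule sum.swap)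
  also have "\<dots> = 0" by (simp only: rel act_zero_right sum.neutral_const)
  finally have "(\<Sum>j<n. act (corner I j) (w j)) = 0" .
  moreover have "act (corner I j) (w j) = 0" if j: "j < n" "j \<noteq> a" for j
  proof (cases "j \<in> set I")
    case False
    have "length I \<le> n" using card_mono[OF _ I(2)] distinct_card[OF I(1)] by simp
    hence "act (complete_hom N (map y (j # I))) (w j) = 0"
      using sym[OF j(1)] False I j unfolding symmetric_killed_def
      by (elim allE[of _ "j # I"] allE[of _ N]) (auto simp: N_def)
    thus ?thesis unfolding corner_def N_def[symmetric] act_mult by simp
  qed (simp add: zero j)
  moreover have "a < n" using I by auto
  ultimately show ?thesis by (simp add: sum.remove[of _ a])
qed

end

section \<open>Calculus of superpolynomials\<close>

abbreviation "lookup \<equiv> Poly_Mapping.lookup"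
abbreviation "single \<equiv> Poly_Mapping.single"
abbreviation "keys \<equiv> Poly_Mapping.keys"
abbreviation "map_key \<equiv> Poly_Mapping.map_key"

lemma superpoly_eqI: "(\<And>p. scoeff f p = scoeff g p) \<Longrightarrow> f = g"
  by (simp add: scoeff_def poly_mapping_eqI flip: coeffs_inject)

lemma scoeff_zero [simp]: "scoeff 0 p = 0"
  by (simp add: scoeff_def zero_superpoly.rep_eq)

lemma scoeff_add [simp]: "scoeff (f + g) p = scoeff f p + scoeff g p"
  by (simp add: scoeff_def plus_superpoly.rep_eq lookup_add)

lemma scoeff_uminus [simp]: "scoeff (- f) p = - scoeff f p"
  by (simp add: scoeff_def uminus_superpoly.rep_eq)

lemma scoeff_diff [simp]: "scoeff (f - g) p = scoeff f p - scoeff g p"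
  by (simp add: scoeff_def minus_superpoly.rep_eq lookup_minus)

lemma scoeff_sum: "scoeff (sum f A) p = (\<Sum>a\<in>A. scoeff (f a) p)"
  by (induction A rule: infinite_finite_induct) auto

lemma scoeff_monom: "scoeff (super_monom \<alpha> I c) p = (if p = (\<alpha>, I) then c else 0)"
  by (auto simp: scoeff_def lookup_single when_def)

lemma finite_supp [simp]: "finite (supp f)"
  by (simp add: supp_def)

lemma in_supp_iff: "p \<in> supp f \<longleftrightarrow> scoeff f p \<noteq> 0"
  by (simp add: supp_def scoeff_def in_keys_iff)

lemma super_monom_add: "super_monom \<alpha> I (c + d) = super_monom \<alpha> I c + super_monom \<alpha> I d"
  by (rule superpoly_eqI) (simp add: scoeff_monom)

lemma super_monom_zero [simp]: "super_monom \<alpha> I 0 = 0"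
  by (rule superpoly_eqI) (simp add: scoeff_monom)

lemma super_monom_uminus: "super_monom \<alpha> I (- c) = - super_monom \<alpha> I c"
  by (rule superpoly_eqI) (simp add: scoeff_monom)

lemma superpoly_expand: "f = (\<Sum>p\<in>supp f. super_monom (fst p) (snd p) (scoeff f p))"
  by (rule superpoly_eqI) (simp add: scoeff_sum scoeff_monom in_supp_iff)

lemma const_mult_monom: "super_const c * super_monom \<alpha> I d = super_monom \<alpha> I (c * d)"
  by (simp add: super_const_def super_monom_mult)

lemma superpoly_monom_induct [case_names monom add]:
  assumes "\<And>\<alpha> I c. P (super_monom \<alpha> I c)" "\<And>f g. P f \<Longrightarrow> P g \<Longrightarrow> P (f + g)"
  shows "P f"
proof -
  have "P 0" using assms(1)[of 0 "{||}" 0] by simp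
  hence "P (\<Sum>p\<in>A. super_monom (fst p) (snd p) (scoeff f p))" for A
    by (induction A rule: infinite_finite_induct) (auto intro: assms)
  thus ?thesis by (subst superpoly_expand) simp
qed

lemma scoeff_const_mult [simp]: "scoeff (super_const c * f) p = c * scoeff f p"
  by (induction f rule: superpoly_monom_induct)
    (auto simp: const_mult_monom scoeff_monom distrib_left)

lemma const_mult_commute: "f * super_const c = super_const c * f"
  by (induction f rule: superpoly_monom_induct)
    (simp_all add: super_const_def super_monom_mult mult.commute distrib_left distrib_right)

lemma xvar_mult_commute: "f * xvar j = xvar j * f"
  by (induction f rule: superpoly_monom_induct)
    (simp_all add: xvar_def super_monom_mult add.commute distrib_left distrib_right)

lemma const_mult: "super_const c * (super_const d * f) = super_const (c * d) * f"
  by (rule superpoly_eqI) simp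

lemma const_add: "super_const (c + d) = super_const c + super_const d"
  by (simp add: super_const_def super_monom_add)

lemma const_0 [simp]: "super_const 0 = 0"
  by (simp add: super_const_def)

lemma const_1 [simp]: "super_const 1 = 1"
  by (simp add: super_const_def super_monom_def one_superpoly_def)

lemma const_left_commute: "f * (super_const c * g) = super_const c * (f * g)"
  by (metis const_mult_commute mult.assoc)

lemma linear_ext_superset:
  assumes "finite A" "supp f \<subseteq> A"
  shows "linear_ext b f = (\<Sum>p\<in>A. super_const (scoeff f p) * b p)"
  unfolding linear_ext_def
  by (rule sum.mono_neutral_left) (use assms in \<open>auto simp: in_supp_iff\<close>)

lemma linear_ext_add: "linear_ext b (f + g) = linear_ext b f + linear_ext b g"
proof -
  let ?A = "supp f \<union> supp g"
  have "supp (f + g) \<subseteq> ?A" by (auto simp: in_supp_iff)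
  thus ?thesis
    by (subst (1 2 3) linear_ext_superset[of ?A])
      (auto simp: const_add distrib_right sum.distrib)
qed

lemma linear_ext_const: "linear_ext b (super_const c * f) = super_const c * linear_ext b f"
proof -
  have "supp (super_const c * f) \<subseteq> supp f" by (auto simp: in_supp_iff)
  thus ?thesis
    by (subst (1 2) linear_ext_superset[of "supp f"]) (auto simp: sum_distrib_left const_mult)
qed

lemma linear_ext_monom: "linear_ext b (super_monom \<alpha> I c) = super_const c * b (\<alpha>, I)"
  by (subst linear_ext_superset[of "{(\<alpha>, I)}"]) (auto simp: in_supp_iff scoeff_monom split: if_splits)

lemma x_deriv_add [simp]: "x_deriv i (f + g) = x_deriv i f + x_deriv i g"
  by (simp add: x_deriv_def linear_ext_add)

lemma x_deriv_const [simp]: "x_deriv i (super_const c * f) = super_const c * x_deriv i f"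
  by (simp add: x_deriv_def linear_ext_const)

lemma x_deriv_monom: "x_deriv i (super_monom \<alpha> I c) =
    super_monom (\<alpha> - single i 1) I (c * of_nat (lookup \<alpha> i))"
  by (simp add: x_deriv_def linear_ext_monom const_mult_monom)

lemma t_deriv_add [simp]: "t_deriv i (f + g) = t_deriv i f + t_deriv i g"
  by (simp add: t_deriv_def linear_ext_add)

lemma t_deriv_const [simp]: "t_deriv i (super_const c * f) = super_const c * t_deriv i f"
  by (simp add: t_deriv_def linear_ext_const)

text \<open>
  The sign \<open>(-1) ^ below j I\<close> moves \<open>\<theta>\<^sub>j\<close> to its place in the sorted word of \<open>I\<close>; it governs both
  multiplication by \<open>\<theta>\<^sub>j\<close> and \<open>\<partial>\<^bsub>\<theta>j\<^esub>\<close>.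
\<close>

definition below :: "nat \<Rightarrow> nat fset \<Rightarrow> nat" where
  "below j I = card {l. l |\<in>| I \<and> l < j}"

lemma finite_below [simp]: "finite {l. l |\<in>| I \<and> l < j}"
  by (rule finite_subset[of _ "fset I"]) auto

lemma t_deriv_monom: "t_deriv j (super_monom \<alpha> I c) =
    (if j |\<in>| I then super_monom \<alpha> (I |-| {|j|}) (c * (-1) ^ below j I) else 0)"
  by (simp add: t_deriv_def linear_ext_monom const_mult_monom below_def)

lemma tvar_monom: "tvar j * super_monom \<alpha> I c =
    (if j |\<in>| I then 0 else super_monom \<alpha> (finsert j I) (c * (-1) ^ below j I))"
proof -
  have "inversions {|j|} I = (\<lambda>l. (j, l)) ` {l. l |\<in>| I \<and> l < j}"
    by (auto simp: inversions_def)
  hence "card (inversions {|j|} I) = below j I"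
    by (simp add: card_image inj_on_def below_def)
  thus ?thesis by (auto simp: tvar_def super_monom_mult ext_sign_def)
qed

lemma xvar_monom: "xvar j * super_monom \<alpha> I c = super_monom (single j 1 + \<alpha>) I c"
  by (simp add: xvar_def super_monom_mult)

lemma x_deriv_diff [simp]: "x_deriv i (f - g) = x_deriv i f - x_deriv i g"
  using x_deriv_add[of i "f - g" g] by simp

lemma t_deriv_diff [simp]: "t_deriv i (f - g) = t_deriv i f - t_deriv i g"
  using t_deriv_add[of i "f - g" g] by simp

lemma x_deriv_0 [simp]: "x_deriv i 0 = 0" using x_deriv_diff[of i 0 0] by simp
lemma t_deriv_0 [simp]: "t_deriv i 0 = 0" using t_deriv_diff[of i 0 0] by simp
lemma x_deriv_uminus [simp]: "x_deriv i (- f) = - x_deriv i f" using x_deriv_diff[of i 0 f] by simp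
lemma t_deriv_uminus [simp]: "t_deriv i (- f) = - t_deriv i f" using t_deriv_diff[of i 0 f] by simp

lemma t_deriv_sum: "t_deriv i (sum f A) = (\<Sum>a\<in>A. t_deriv i (f a))"
  by (induction A rule: infinite_finite_induct) auto

lemma x_deriv_1 [simp]: "x_deriv i 1 = 0" and t_deriv_1 [simp]: "t_deriv i 1 = 0"
  using x_deriv_monom[of i 0 "{||}" 1] t_deriv_monom[of i 0 "{||}" 1] const_1
  by (simp_all add: super_const_def)

lemma x_deriv_xvar_mult:
  "x_deriv i (xvar j * f) = (if i = j then f else 0) + xvar j * x_deriv i f"
proof (induction f rule: superpoly_monom_induct)
  case (monom \<alpha> I c)
  have *: "single j 1 + \<alpha> - single i 1 =
      single j 1 + (\<alpha> - single i (1 :: nat))"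
    if "i \<noteq> j \<or> lookup \<alpha> i > 0"
    using that by (intro poly_mapping_eqI) (auto simp: lookup_add lookup_minus lookup_single when_def)
  have **: "single j (1 :: nat) + \<alpha> - single j 1 = \<alpha>" by simp
  show ?case
  proof (cases "lookup \<alpha> i > 0")
    case True
    hence "single i 1 + (\<alpha> - single i (1 :: nat)) = \<alpha>"
      by (intro poly_mapping_eqI) (auto simp: lookup_add lookup_minus lookup_single when_def)
    thus ?thesis using True
      by (auto simp: xvar_monom x_deriv_monom * lookup_add lookup_single super_monom_add distrib_left simp del: One_nat_def)
  next
    case False
    thus ?thesis
      by (auto simp: xvar_monom x_deriv_monom ** lookup_add lookup_single simp del: One_nat_def)
  qed
qed (simp add: distrib_left)

lemma x_deriv_tvar_mult: "x_deriv i (tvar j * f) = tvar j * x_deriv i f"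
  by (induction f rule: superpoly_monom_induct)
    (auto simp: tvar_monom x_deriv_monom distrib_left mult_ac)

lemma t_deriv_xvar_mult: "t_deriv i (xvar j * f) = xvar j * t_deriv i f"
  by (induction f rule: superpoly_monom_induct)
    (auto simp: xvar_monom t_deriv_monom distrib_left)

lemma below_insert:
  assumes "j |\<notin>| I"
  shows "below i (finsert j I) = below i I + (if j < i then 1 else 0)"
proof (cases "j < i")
  case True
  hence "{l. l |\<in>| finsert j I \<and> l < i} = insert j {l. l |\<in>| I \<and> l < i}" by auto
  thus ?thesis using assms True by (simp add: below_def)
next
  case False
  hence "{l. l |\<in>| finsert j I \<and> l < i} = {l. l |\<in>| I \<and> l < i}" by auto
  thus ?thesis using False by (simp add: below_def)
qed

lemma below_self: "below i (finsert i I) = below i I" "below i (I |-| {|i|}) = below i I"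
  unfolding below_def by (intro arg_cong[where f = card]; auto)+

text \<open>
  The canonical anticommutation relation.  With its companions for \<open>x_deriv\<close> and \<open>xvar\<close> it replaces
  all further sign bookkeeping: identities between operators follow by induction over products of
  generators.
\<close>

lemma t_deriv_tvar_mult:
  "t_deriv i (tvar j * f) = (if i = j then f else 0) - tvar j * t_deriv i f"
proof (induction f rule: superpoly_monom_induct)
  case (monom \<alpha> I c)
  show ?case
  proof (cases "i = j")
    case True
    have "finsert i (I |-| {|i|}) = I" if "i |\<in>| I" using that by auto
    moreover have "(finsert i I) |-| {|i|} = I" if "i |\<notin>| I" using that by auto
    moreover have "(-1 :: complex) ^ k * (-1) ^ k = 1" for k by (simp flip: power_mult_distrib)
    ultimately show ?thesis using True
      by (auto simp: tvar_monom t_deriv_monom below_self mult.assoc)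
  next
    case False
    show ?thesis
    proof (cases "i |\<in>| I \<and> j |\<notin>| I")
      case True
      define J where "J = I |-| {|i|}"
      have I: "I = finsert i J" "i |\<notin>| J" "j |\<notin>| J" using True by (auto simp: J_def)
      have J: "finsert j I |-| {|i|} = finsert j J" using I False by auto
      show ?thesis using True False I(2,3)
        by (simp add: tvar_monom t_deriv_monom J flip: J_def)
          (auto simp: I(1) below_insert super_monom_uminus[symmetric] mult_ac)
    qed (use False in \<open>auto simp: tvar_monom t_deriv_monom\<close>)
  qed
qed (simp add: distrib_left)

lemma zero_in_superpolys [simp]: "0 \<in> superpolys K n"
  by (simp add: superpolys_def supp_def zero_superpoly.rep_eq)

text \<open>
  Prepending a smaller index needs no sign, so monomials are built up from their largest index
  downwards.
\<close>

lemma tvar_monom_less: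
  assumes "\<And>l. l |\<in>| I \<Longrightarrow> j < l"
  shows "tvar j * super_monom \<alpha> I c = super_monom \<alpha> (finsert j I) c"
proof -
  have "{l. l |\<in>| I \<and> l < j} = {}" using assms by fastforce
  hence "below j I = 0" unfolding below_def by (simp only: card.empty)
  thus ?thesis using assms[of j] by (auto simp: tvar_monom)
qed

lemma fset_min_induct [case_names empty insert]:
  assumes "P {||}" and "\<And>j I. (\<And>l. l |\<in>| I \<Longrightarrow> j < l) \<Longrightarrow> P I \<Longrightarrow> P (finsert j I)"
  shows "P (I :: nat fset)"
proof (induction "fcard I" arbitrary: I rule: less_induct)
  case less
  show ?case
  proof (cases "I = {||}")
    case False
    define j where "j = fMin I"
    have j: "j |\<in>| I" "\<And>l. l |\<in>| I \<Longrightarrow> j \<le> l" using False by (auto simp: j_def)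
    have I: "I = finsert j (I |-| {|j|})" using j by auto
    have "fcard (I |-| {|j|}) < fcard I" using j(1) by (rule fcard_fminus1_less)
    hence "P (I |-| {|j|})" by (rule less)
    moreover have "j < l" if "l |\<in>| I |-| {|j|}" for l using that j(2)[of l] by auto
    ultimately show ?thesis using assms(2)[of "I |-| {|j|}" j] I by simp
  qed (simp add: assms(1))
qed

lemma x_monom_induct [case_names zero single]:
  assumes "P 0" and "\<And>j \<alpha>. P \<alpha> \<Longrightarrow> P (single j 1 + \<alpha>)"
  shows "P (\<alpha> :: nat \<Rightarrow>\<^sub>0 nat)"
proof (induction \<alpha> rule: update_induct)
  case (update \<alpha> j e)
  have up: "Poly_Mapping.update j e \<alpha> = single j e + \<alpha>"
    using update(1) by (intro poly_mapping_eqI)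
      (auto simp: lookup_update lookup_add lookup_single when_def in_keys_iff)
  have "P (single j k + \<alpha>)" for k
  proof (induction k)
    case (Suc k)
    from assms(2)[OF Suc, of j] show ?case by (simp add: add.assoc[symmetric] flip: single_add)
  qed (use update in simp)
  thus ?case by (simp add: up)
qed (rule assms(1))

lemma superpoly_induct [consumes 1, case_names one const x t add]:
  assumes "f \<in> superpolys K n" and one: "P 1"
    and const: "\<And>c f. P f \<Longrightarrow> P (super_const c * f)"
    and x: "\<And>j f. j < n \<Longrightarrow> P f \<Longrightarrow> P (xvar j * f)"
    and t: "\<And>j f. j < n \<Longrightarrow> P f \<Longrightarrow> P (tvar j * f)"
    and add: "\<And>f g. P f \<Longrightarrow> P g \<Longrightarrow> P (f + g)"
  shows "P f"
proof -
  have thetas: "P (super_monom 0 I 1)" if "fset I \<subseteq> {..<n}" for I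
    using that
  proof (induction I rule: fset_min_induct)
    case empty
    show ?case using one const_1 by (simp add: super_const_def)
  next
    case (insert j I)
    from insert have "P (tvar j * super_monom 0 I 1)" by (intro t) auto
    thus ?case using insert by (simp add: tvar_monom_less)
  qed
  have monom: "P (super_monom \<alpha> I 1)" if "keys \<alpha> \<subseteq> {..<n}" "fset I \<subseteq> {..<n}" for \<alpha> I
    using that(1)
  proof (induction \<alpha> rule: x_monom_induct)
    case zero
    show ?case using thetas that(2) by simp
  next
    case (single j \<alpha>)
    have "j \<in> keys (single j 1 + \<alpha>)"
      "keys \<alpha> \<subseteq> keys (single j 1 + \<alpha>)"
      by (auto simp: in_keys_iff lookup_add)
    hence "P (xvar j * super_monom \<alpha> I 1)" using single by (intro x) auto
    thus ?case by (simp add: xvar_monom)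
  qed
  have ok: "keys (fst p) \<subseteq> {..<n} \<and> fset (snd p) \<subseteq> {..<n}" if "p \<in> supp f" for p
    using bspec[OF assms(1)[unfolded superpolys_def mem_Collect_eq] that] by (simp add: case_prod_beta)
  have 0: "P 0" using const[OF one, of 0] by simp
  have "P (\<Sum>p\<in>A. super_monom (fst p) (snd p) (scoeff f p))" if "finite A" "A \<subseteq> supp f" for A
    using that
  proof (induction A)
    case (insert p A)
    have "P (super_const (scoeff f p) * super_monom (fst p) (snd p) 1)"
      using insert ok[of p] by (intro const monom) auto
    thus ?case using insert by (auto simp: const_mult_monom intro: add)
  qed (simp add: 0)
  thus ?thesis by (subst superpoly_expand) simp
qed

lemma ex_superpolys: "\<exists>n. f \<in> superpolys UNIV n"
proof -
  define A where "A = (\<Union>p\<in>supp f. keys (fst p) \<union> fset (snd p))"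
  have "finite A" by (auto simp: A_def)
  then obtain n where n: "A \<subseteq> {..<n}" using finite_nat_iff_bounded by blast
  have "f \<in> superpolys UNIV n"
    unfolding superpolys_def using n by (fastforce simp: A_def)
  thus ?thesis ..
qed

lemma superpoly_induct_all [case_names one const x t add]:
  assumes "P 1"
    and "\<And>c f. P f \<Longrightarrow> P (super_const c * f)"
    and "\<And>j f. P f \<Longrightarrow> P (xvar j * f)"
    and "\<And>j f. P f \<Longrightarrow> P (tvar j * f)"
    and "\<And>f g. P f \<Longrightarrow> P g \<Longrightarrow> P (f + g)"
  shows "P f"
proof -
  obtain n where "f \<in> superpolys UNIV n" using ex_superpolys by blast
  thus ?thesis by (induction rule: superpoly_induct) (use assms in blast)+
qed

lemma x_deriv_commute: "x_deriv i (x_deriv j f) = x_deriv j (x_deriv i f)"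
  by (induction f rule: superpoly_induct_all)
    (auto simp: x_deriv_xvar_mult x_deriv_tvar_mult algebra_simps)

lemma x_t_deriv_commute: "x_deriv i (t_deriv j f) = t_deriv j (x_deriv i f)"
  by (induction f rule: superpoly_induct_all)
    (auto simp: x_deriv_xvar_mult x_deriv_tvar_mult t_deriv_xvar_mult t_deriv_tvar_mult)

lemma t_deriv_anticommute: "t_deriv i (t_deriv j f) = - t_deriv j (t_deriv i f)"
  by (induction f rule: superpoly_induct_all)
    (auto simp: t_deriv_xvar_mult t_deriv_tvar_mult)

lemma t_deriv_square: "t_deriv i (t_deriv i f) = 0"
  by (induction f rule: superpoly_induct_all)
    (auto simp: t_deriv_xvar_mult t_deriv_tvar_mult)

lemma scoeff_x_deriv: "scoeff (x_deriv j f) (\<alpha>, I) =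
    of_nat (Suc (lookup \<alpha> j)) * scoeff f (\<alpha> + single j 1, I)"
proof (induction f rule: superpoly_monom_induct)
  case (monom \<beta> J c)
  show ?case
  proof (cases "lookup \<beta> j = 0")
    case True
    hence "\<beta> \<noteq> \<alpha> + single j 1" by (auto simp: lookup_add)
    thus ?thesis using True by (auto simp: x_deriv_monom scoeff_monom)
  next
    case False
    hence "\<beta> = (\<beta> - single j 1) + single j 1"
      by (intro poly_mapping_eqI) (auto simp: lookup_add lookup_minus lookup_single when_def)
    hence "\<alpha> = \<beta> - single j 1 \<longleftrightarrow> \<beta> = \<alpha> + single j 1"
      by (metis add_diff_cancel_right')
    thus ?thesis by (auto simp: x_deriv_monom scoeff_monom lookup_add)
  qed
qed (simp add: distrib_left)

lemma scoeff_t_deriv: "scoeff (t_deriv j f) (\<alpha>, I) =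
    (if j |\<in>| I then 0 else (-1) ^ below j I * scoeff f (\<alpha>, finsert j I))"
proof (induction f rule: superpoly_monom_induct)
  case (monom \<beta> J c)
  have "J = finsert j I \<and> j |\<notin>| I \<longleftrightarrow> I = J |-| {|j|} \<and> j |\<in>| J" by auto
  thus ?case by (auto simp: t_deriv_monom scoeff_monom below_self)
qed (auto simp: distrib_left)

section \<open>The operators attached to superpolynomials\<close>

definition x_derivs :: "(nat \<Rightarrow>\<^sub>0 nat) \<Rightarrow> superpoly \<Rightarrow> superpoly" where
  "x_derivs \<alpha> = fold (\<lambda>j. x_deriv j ^^ lookup \<alpha> j)
     (sorted_list_of_set (keys \<alpha>))"

definition t_derivs :: "nat fset \<Rightarrow> superpoly \<Rightarrow> superpoly" where
  "t_derivs I = fold t_deriv (sorted_list_of_fset I)"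

lemma sorted_keys_eq_filter:
  assumes "keys (\<alpha> :: nat \<Rightarrow>\<^sub>0 nat) \<subseteq> {..<N}"
  shows "sorted_list_of_set (keys \<alpha>) = filter (\<lambda>j. j \<in> keys \<alpha>) [0..<N]"
  by (rule sorted_distinct_set_unique) (use assms in \<open>auto simp: sorted_wrt_filter\<close>)

lemma keys_bounded: "\<exists>N. j < N \<and> keys (\<alpha> :: nat \<Rightarrow>\<^sub>0 nat) \<subseteq> {..<N}"
proof -
  have "finite (insert j (keys \<alpha>))" by simp
  then obtain N where "insert j (keys \<alpha>) \<subseteq> {..<N}" using finite_nat_iff_bounded by blast
  thus ?thesis by auto
qed

lemma x_derivs_upt:
  assumes "keys \<alpha> \<subseteq> {..<N}"
  shows "x_derivs \<alpha> = fold (\<lambda>j. x_deriv j ^^ lookup \<alpha> j) [0..<N]"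
  unfolding x_derivs_def sorted_keys_eq_filter[OF assms] fold_filter
  by (intro fold_cong ext refl) (auto simp: in_keys_iff id_def)

lemma funpow_commute: "(\<And>v. f (g v) = g (f v)) \<Longrightarrow> (f ^^ k) (g v) = g ((f ^^ k) v)"
  by (induction k) auto

lemma x_derivs_single_add: "x_derivs (single j 1 + \<alpha>) v = x_derivs \<alpha> (x_deriv j v)"
proof -
  let ?\<beta> = "single j 1 + \<alpha>"
  obtain N where N: "j < N" "keys \<alpha> \<subseteq> {..<N}" using keys_bounded by blast
  have k: "keys ?\<beta> \<subseteq> {..<N}" using N keys_add[of "single j 1" \<alpha>] by auto
  have "fold (\<lambda>l. x_deriv l ^^ lookup ?\<beta> l) xs v =
      fold (\<lambda>l. x_deriv l ^^ lookup \<alpha> l) xs (x_deriv j v)"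
    if "distinct xs" "j \<in> set xs" for xs v
    using that
  proof (induction xs arbitrary: v)
    case (Cons l xs)
    show ?case
    proof (cases "l = j")
      case True
      with Cons have "j \<notin> set xs" by simp
      hence "fold (\<lambda>l. x_deriv l ^^ lookup ?\<beta> l) xs = fold (\<lambda>l. x_deriv l ^^ lookup \<alpha> l) xs"
        by (intro ext fold_cong) (auto simp: lookup_add lookup_single when_def)
      thus ?thesis using True by (simp add: lookup_add funpow_swap1)
    next
      case False
      thus ?thesis using Cons
        by (simp add: lookup_add lookup_single when_def funpow_commute[of "x_deriv l" "x_deriv j"] x_deriv_commute)
    qed
  qed simp
  from this[of "[0..<N]"] show ?thesis unfolding x_derivs_upt[OF k] x_derivs_upt[OF N(2)] using N by simp
qed

lemma sorted_list_finsert_less: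
  assumes "\<And>l. l |\<in>| I \<Longrightarrow> (j :: nat) < l"
  shows "sorted_list_of_fset (finsert j I) = j # sorted_list_of_fset I"
proof -
  have "j \<notin> fset I" using assms by fastforce
  thus ?thesis using assms
    by (simp add: sorted_list_of_fset.rep_eq sorted_list_of_set.sorted_key_list_of_set_insert
        insort_is_Cons less_imp_le)
qed

lemma t_derivs_finsert_less:
  assumes "\<And>l. l |\<in>| I \<Longrightarrow> j < l"
  shows "t_derivs (finsert j I) v = t_derivs I (t_deriv j v)"
  unfolding t_derivs_def using sorted_list_finsert_less[OF assms] by simp

lemma x_derivs_0 [simp]: "x_derivs 0 v = v" and t_derivs_empty [simp]: "t_derivs {||} v = v"
  by (simp_all add: x_derivs_def t_derivs_def sorted_list_of_fset.rep_eq)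

lemma x_derivs_single: "x_derivs (single j k + \<alpha>) v = x_derivs \<alpha> ((x_deriv j ^^ k) v)"
proof (induction k arbitrary: v)
  case (Suc k)
  have "single j (Suc k) + \<alpha> = single j 1 + (single j k + \<alpha>)"
    by (simp add: add.assoc[symmetric] flip: single_add)
  thus ?case by (simp only: x_derivs_single_add Suc) (simp add: funpow_swap1)
qed simp

lemma x_derivs_linear:
  "x_derivs \<alpha> (v + w) = x_derivs \<alpha> v + x_derivs \<alpha> w"
  "x_derivs \<alpha> (super_const c * v) = super_const c * x_derivs \<alpha> v"
  by (induction \<alpha> arbitrary: v w rule: x_monom_induct) (simp_all add: x_derivs_single_add del: One_nat_def)

lemma t_derivs_linear:
  "t_derivs I (v + w) = t_derivs I v + t_derivs I w"
  "t_derivs I (super_const c * v) = super_const c * t_derivs I v"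
  by (induction I arbitrary: v w rule: fset_min_induct) (simp_all add: t_derivs_finsert_less)

lemma super_deriv_eq:
  "super_deriv \<omega> v = (\<Sum>p\<in>supp \<omega>. super_const (cnj (scoeff \<omega> p)) * x_derivs (fst p) (t_derivs (snd p) v))"
  unfolding super_deriv_def x_derivs_def t_derivs_def by (intro sum.cong) auto

lemma super_deriv_superset:
  assumes "finite A" "supp \<omega> \<subseteq> A"
  shows "super_deriv \<omega> v =
    (\<Sum>p\<in>A. super_const (cnj (scoeff \<omega> p)) * x_derivs (fst p) (t_derivs (snd p) v))"
  unfolding super_deriv_eq
  by (rule sum.mono_neutral_left) (use assms in \<open>auto simp: in_supp_iff\<close>)

lemma super_deriv_add_left: "super_deriv (\<omega> + \<omega>') v = super_deriv \<omega> v + super_deriv \<omega>' v"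
proof -
  let ?A = "supp \<omega> \<union> supp \<omega>'"
  have "supp (\<omega> + \<omega>') \<subseteq> ?A" by (auto simp: in_supp_iff)
  thus ?thesis
    by (subst (1 2 3) super_deriv_superset[of ?A])
      (auto simp: const_add distrib_right sum.distrib)
qed

lemma super_deriv_const_left:
  "super_deriv (super_const c * \<omega>) v = super_const (cnj c) * super_deriv \<omega> v"
proof -
  have "supp (super_const c * \<omega>) \<subseteq> supp \<omega>" by (auto simp: in_supp_iff)
  thus ?thesis
    by (subst (1 2) super_deriv_superset[of "supp \<omega>"]) (auto simp: sum_distrib_left const_mult)
qed

lemma super_deriv_monom:
  "super_deriv (super_monom \<alpha> I c) v = super_const (cnj c) * x_derivs \<alpha> (t_derivs I v)"
  by (subst super_deriv_superset[of "{(\<alpha>, I)}"])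
    (auto simp: in_supp_iff scoeff_monom split: if_splits)

lemma super_deriv_add_right: "super_deriv \<omega> (v + w) = super_deriv \<omega> v + super_deriv \<omega> w"
  by (simp add: super_deriv_eq x_derivs_linear t_derivs_linear distrib_left sum.distrib)

lemma super_deriv_const_right:
  "super_deriv \<omega> (super_const c * v) = super_const c * super_deriv \<omega> v"
  by (simp add: super_deriv_eq x_derivs_linear t_derivs_linear const_mult sum_distrib_left mult.commute)

lemma super_deriv_0_right [simp]: "super_deriv \<omega> 0 = 0"
  using super_deriv_add_right[of \<omega> 0 0] by simp

lemma super_deriv_uminus_right: "super_deriv \<omega> (- v) = - super_deriv \<omega> v"
  using super_deriv_add_right[of \<omega> v "- v"] by (simp add: eq_neg_iff_add_eq_0 add.commute)

lemma super_deriv_sum_right: "super_deriv \<omega> (sum f A) = (\<Sum>a\<in>A. super_deriv \<omega> (f a))"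
  by (induction A rule: infinite_finite_induct) (auto simp: super_deriv_add_right)

lemma super_deriv_0_left [simp]: "super_deriv 0 v = 0"
  by (simp add: super_deriv_eq supp_def zero_superpoly.rep_eq)

lemma super_deriv_uminus_left: "super_deriv (- \<omega>) v = - super_deriv \<omega> v"
  using super_deriv_add_left[of \<omega> "- \<omega>" v] by (simp add: eq_neg_iff_add_eq_0 add.commute)

lemma super_deriv_sum_left: "super_deriv (sum f A) v = (\<Sum>a\<in>A. super_deriv (f a) v)"
  by (induction A rule: infinite_finite_induct) (auto simp: super_deriv_add_left)

lemma super_deriv_1 [simp]: "super_deriv 1 v = v"
  using super_deriv_monom[of 0 "{||}" 1 v] const_1 by (simp add: super_const_def)

lemma x_deriv_x_derivs: "x_derivs \<alpha> (x_deriv j v) = x_deriv j (x_derivs \<alpha> v)"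
  by (induction \<alpha> arbitrary: v rule: x_monom_induct)
    (simp_all add: x_derivs_single_add x_deriv_commute[of _ j] del: One_nat_def)

lemma x_deriv_t_derivs: "t_derivs I (x_deriv j v) = x_deriv j (t_derivs I v)"
  by (induction I arbitrary: v rule: fset_min_induct)
    (simp_all add: t_derivs_finsert_less x_t_deriv_commute[symmetric])

lemma super_deriv_xvar: "super_deriv (xvar j * \<omega>) v = super_deriv \<omega> (x_deriv j v)"
proof (induction \<omega> rule: superpoly_monom_induct)
  case (monom \<alpha> I c)
  show ?case unfolding xvar_monom super_deriv_monom x_derivs_single_add x_deriv_t_derivs ..
qed (simp add: distrib_left super_deriv_add_left)

lemma tvar_swap: "tvar i * (tvar j * f) = - (tvar j * (tvar i * f))"
  by (simp add: tvar_anticommute[of i j] flip: mult.assoc)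

lemma super_deriv_tvar_less:
  assumes "\<And>l. l |\<in>| I \<Longrightarrow> j < l"
  shows "super_deriv (tvar j * super_monom \<alpha> I c) v = super_deriv (super_monom \<alpha> I c) (t_deriv j v)"
  using assms by (simp add: tvar_monom_less super_deriv_monom t_derivs_finsert_less)

text \<open>
  The definition applies derivatives in the sorted order of \<open>I\<close>.  The case where \<open>j\<close> is smaller than
  all indices is immediate; otherwise \<open>\<theta>\<^sub>j\<close> is moved past the least index \<open>i\<close>, and \<open>\<partial>\<^bsub>\<theta>j\<^esub>\<close> past \<open>\<partial>\<^bsub>\<theta>i\<^esub>\<close>,
  with the same sign.
\<close>

lemma super_deriv_tvar: "super_deriv (tvar j * \<omega>) v = super_deriv \<omega> (t_deriv j v)"
proof (induction \<omega> rule: superpoly_monom_induct)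
  case (monom \<alpha> I c)
  show ?case
  proof (induction I arbitrary: j c v rule: fset_min_induct)
    case empty
    show ?case by (rule super_deriv_tvar_less) simp
  next
    case (insert i I)
    let ?\<omega> = "super_monom \<alpha> I c"
    have i: "super_monom \<alpha> (finsert i I) c = tvar i * ?\<omega>"
      using insert.hyps by (simp add: tvar_monom_less)
    consider "j < i" | "j = i" | "i < j" by linarith
    thus ?case
    proof cases
      case 1
      thus ?thesis using insert.hyps by (intro super_deriv_tvar_less) fastforce
    next
      case 2
      thus ?thesis using insert.IH
        by (simp add: i t_deriv_square tvar_square flip: mult.assoc)
    next
      case 3
      have "super_deriv (tvar i * (tvar j * ?\<omega>)) v = super_deriv (tvar j * ?\<omega>) (t_deriv i v)"
      proof (cases "j |\<in>| I")
        case False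
        have "super_deriv (tvar i * super_monom \<alpha> (finsert j I) d) v
            = super_deriv (super_monom \<alpha> (finsert j I) d) (t_deriv i v)" for d
          by (rule super_deriv_tvar_less) (use 3 insert.hyps in auto)
        thus ?thesis using False by (simp add: tvar_monom[of j])
      qed (simp add: tvar_monom[of j])
      thus ?thesis unfolding i tvar_swap[of j i]
        by (simp add: super_deriv_uminus_left super_deriv_uminus_right insert.IH t_deriv_anticommute[of j i])
    qed
  qed
qed (simp add: distrib_left super_deriv_add_left)

text \<open>
  The order is reversed because \<open>\<partial>\<^sub>\<omega>\<close> applies the derivatives of the leftmost generators first.
\<close>

lemma super_deriv_mult: "super_deriv (f * g) v = super_deriv g (super_deriv f v)"
  by (induction f arbitrary: v rule: superpoly_induct_all)
    (simp_all add: mult.assoc super_deriv_xvar super_deriv_tvar super_deriv_const_left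
      super_deriv_const_right distrib_right super_deriv_add_left super_deriv_add_right)

lemma super_deriv_x_deriv: "super_deriv \<omega> (x_deriv j v) = x_deriv j (super_deriv \<omega> v)"
  by (metis super_deriv_mult super_deriv_xvar xvar_mult_commute mult_1_right super_deriv_1)

section \<open>Substitutions and the action of matrices\<close>

lemma super_subst_add: "super_subst u v (f + g) = super_subst u v f + super_subst u v g"
  and super_subst_const: "super_subst u v (super_const c * f) = super_const c * super_subst u v f"
  by (simp_all add: super_subst_def linear_ext_add linear_ext_const)

lemma super_subst_0 [simp]: "super_subst u v 0 = 0"
  using super_subst_add[of u v 0 0] by simp

lemma super_subst_uminus: "super_subst u v (- f) = - super_subst u v f"
  using super_subst_add[of u v f "- f"] by (simp add: eq_neg_iff_add_eq_0 add.commute)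

lemma super_subst_monom:
  "super_subst u v (super_monom \<alpha> I c) = super_const c *
     (prod_list (map (\<lambda>j. u j ^ lookup \<alpha> j) (sorted_list_of_set (keys \<alpha>))) *
      prod_list (map v (sorted_list_of_fset I)))"
  by (simp add: super_subst_def linear_ext_monom)

lemma super_subst_1 [simp]: "super_subst u v 1 = 1"
  using super_subst_monom[of u v 0 "{||}" 1] const_1
  by (simp add: super_const_def sorted_list_of_fset.rep_eq)

text \<open>
  For central \<open>u\<close> and anticommuting \<open>v\<close> of square zero the substitution is multiplicative.  It is
  enough to know this for products with generators; the reduction of \<open>\<theta>\<^sub>j\<close> to the case of a smallest
  index is the one of \<open>super_deriv_tvar\<close>.
\<close>

context
  fixes u v :: "nat \<Rightarrow> superpoly"
  assumes u_central: "\<And>j f. f * u j = u j * f"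
    and v_anti: "\<And>i j. v i * v j = - (v j * v i)" and v_sq: "\<And>i. v i * v i = 0"
begin

lemma u_power_central: "f * u j ^ k = u j ^ k * f"
  by (induction k) (simp, metis mult.assoc power_Suc u_central)

lemma super_subst_xvar: "super_subst u v (xvar j * f) = u j * super_subst u v f"
proof (induction f rule: superpoly_monom_induct)
  case (monom \<alpha> I c)
  let ?\<beta> = "single j 1 + \<alpha>"
  let ?P = "\<lambda>\<alpha> xs. prod_list (map (\<lambda>j. u j ^ lookup \<alpha> j) xs)"
  obtain N where N: "j < N" "keys \<alpha> \<subseteq> {..<N}" using keys_bounded by blast
  have k: "keys ?\<beta> \<subseteq> {..<N}" using N keys_add[of "single j 1" \<alpha>] by auto
  have upt: "?P \<gamma> (sorted_list_of_set (keys \<gamma>)) = ?P \<gamma> [0..<N]"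
    if "keys \<gamma> \<subseteq> {..<N}" for \<gamma>
  proof -
    have "?P \<gamma> (filter (\<lambda>j. j \<in> keys \<gamma>) xs) = ?P \<gamma> xs" for xs
      by (induction xs) (auto simp: in_keys_iff)
    thus ?thesis unfolding sorted_keys_eq_filter[OF that] .
  qed
  have "?P ?\<beta> xs = u j * ?P \<alpha> xs" if "distinct xs" "j \<in> set xs" for xs
    using that
  proof (induction xs)
    case (Cons l xs)
    show ?case
    proof (cases "l = j")
      case True
      with Cons have "j \<notin> set xs" by simp
      hence "map (\<lambda>j. u j ^ lookup ?\<beta> j) xs = map (\<lambda>j. u j ^ lookup \<alpha> j) xs"
        by (intro map_cong) (auto simp: lookup_add lookup_single when_def)
      hence p: "?P ?\<beta> xs = ?P \<alpha> xs" by (simp only:)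
      show ?thesis using True by (simp only: list.map prod_list.Cons p) (simp add: lookup_add mult.assoc)
    next
      case False
      thus ?thesis using Cons
        by (simp add: lookup_add lookup_single when_def flip: mult.assoc) (simp add: u_central)
    qed
  qed simp
  hence P: "?P ?\<beta> [0..<N] = u j * ?P \<alpha> [0..<N]" using N by simp
  show ?case unfolding xvar_monom super_subst_monom upt[OF k] upt[OF N(2)] P
    by (simp add: mult.assoc const_left_commute)
qed (simp add: distrib_left super_subst_add)

lemma super_subst_tvar_less:
  assumes "\<And>l. l |\<in>| I \<Longrightarrow> j < l"
  shows "super_subst u v (tvar j * super_monom \<alpha> I c) = v j * super_subst u v (super_monom \<alpha> I c)"
proof -
  have c: "f * prod_list (map (\<lambda>j. u j ^ e j) xs) = prod_list (map (\<lambda>j. u j ^ e j) xs) * f" for f xs e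
  proof (induction xs)
    case (Cons l xs)
    have "f * (u l ^ e l * p) = u l ^ e l * (f * p)" for p by (metis mult.assoc u_power_central)
    with Cons show ?case by (simp add: mult.assoc)
  qed simp
  have "super_subst u v (tvar j * super_monom \<alpha> I c) = super_subst u v (super_monom \<alpha> (finsert j I) c)"
    using assms by (simp add: tvar_monom_less)
  also have "\<dots> = super_const c *
     (prod_list (map (\<lambda>j. u j ^ lookup \<alpha> j) (sorted_list_of_set (keys \<alpha>))) *
      (v j * prod_list (map v (sorted_list_of_fset I))))"
    using sorted_list_finsert_less[of I j] assms by (simp add: super_subst_monom)
  also have "\<dots> = super_const c * (v j * (prod_list (map (\<lambda>j. u j ^ lookup \<alpha> j)
      (sorted_list_of_set (keys \<alpha>))) * prod_list (map v (sorted_list_of_fset I))))"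
    by (metis c mult.assoc)
  also have "\<dots> = v j * super_subst u v (super_monom \<alpha> I c)"
    by (simp add: super_subst_monom const_left_commute)
  finally show ?thesis .
qed

lemma super_subst_tvar: "super_subst u v (tvar j * f) = v j * super_subst u v f"
proof (induction f rule: superpoly_monom_induct)
  case (monom \<alpha> I c)
  show ?case
  proof (induction I arbitrary: j c rule: fset_min_induct)
    case empty
    show ?case by (rule super_subst_tvar_less) simp
  next
    case (insert i I)
    let ?f = "super_monom \<alpha> I c"
    have i: "super_monom \<alpha> (finsert i I) c = tvar i * ?f"
      using insert.hyps by (simp add: tvar_monom_less)
    consider "j < i" | "j = i" | "i < j" by linarith
    thus ?case
    proof cases
      case 1
      thus ?thesis using insert.hyps by (intro super_subst_tvar_less) fastforce
    next
      case 2
      have "super_subst u v (tvar i * (tvar i * ?f)) = v i * (v i * super_subst u v ?f)"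
        by (simp add: tvar_square v_sq flip: mult.assoc)
      thus ?thesis using 2 insert.IH by (simp add: i)
    next
      case 3
      have "super_subst u v (tvar i * (tvar j * ?f)) = v i * super_subst u v (tvar j * ?f)"
      proof (cases "j |\<in>| I")
        case False
        have "super_subst u v (tvar i * super_monom \<alpha> (finsert j I) d)
            = v i * super_subst u v (super_monom \<alpha> (finsert j I) d)" for d
          by (rule super_subst_tvar_less) (use 3 insert.hyps in auto)
        thus ?thesis using False by (simp add: tvar_monom[of j])
      qed (simp add: tvar_monom[of j])
      thus ?thesis unfolding i tvar_swap[of j i]
        by (simp add: super_subst_uminus insert.IH v_anti[of j i] flip: mult.assoc)
    qed
  qed
qed (simp add: distrib_left super_subst_add)

end

definition row_x :: "complex mat \<Rightarrow> nat \<Rightarrow> superpoly" where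
  "row_x \<sigma> j = (\<Sum>i<dim_row \<sigma>. super_const (cnj (\<sigma> $$ (i, j))) * xvar i)"

definition row_t :: "complex mat \<Rightarrow> nat \<Rightarrow> superpoly" where
  "row_t \<sigma> j = (\<Sum>i<dim_row \<sigma>. super_const (cnj (\<sigma> $$ (i, j))) * tvar i)"

lemma mat_act_eq: "mat_act \<sigma> = super_subst (row_x \<sigma>) (row_t \<sigma>)"
  by (simp add: mat_act_def row_x_def[abs_def] row_t_def[abs_def])

lemma row_x_central: "f * row_x \<sigma> j = row_x \<sigma> j * f"
  unfolding row_x_def sum_distrib_left sum_distrib_right
  by (intro sum.cong refl) (metis const_left_commute mult.assoc xvar_mult_commute)

lemma row_t_anticommute: "row_t \<sigma> i * row_t \<sigma> j = - (row_t \<sigma> j * row_t \<sigma> i)"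
proof -
  have "row_t \<sigma> i * row_t \<sigma> j = (\<Sum>a<dim_row \<sigma>. \<Sum>b<dim_row \<sigma>.
      super_const (cnj (\<sigma> $$ (a, i))) * tvar a * (super_const (cnj (\<sigma> $$ (b, j))) * tvar b))"
    by (simp add: row_t_def sum_product)
  also have "\<dots> = (\<Sum>b<dim_row \<sigma>. \<Sum>a<dim_row \<sigma>.
      super_const (cnj (\<sigma> $$ (a, i))) * tvar a * (super_const (cnj (\<sigma> $$ (b, j))) * tvar b))"
    by (rule sum.swap)
  also have "\<dots> = (\<Sum>b<dim_row \<sigma>. \<Sum>a<dim_row \<sigma>.
      - (super_const (cnj (\<sigma> $$ (b, j))) * tvar b * (super_const (cnj (\<sigma> $$ (a, i))) * tvar a)))"
  proof (intro sum.cong refl)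
    fix a b
    have "super_const c * tvar a * (super_const d * tvar b) = super_const (c * d) * (tvar a * tvar b)"
      for a b c d by (simp only: mult.assoc const_left_commute[of "tvar a"] const_mult)
    hence "super_const c * tvar a * (super_const d * tvar b)
        = - (super_const d * tvar b * (super_const c * tvar a))" for c d
      by (simp only: tvar_anticommute[of a b] mult.commute[of c d] mult_minus_right)
    thus "super_const (cnj (\<sigma> $$ (a, i))) * tvar a * (super_const (cnj (\<sigma> $$ (b, j))) * tvar b)
      = - (super_const (cnj (\<sigma> $$ (b, j))) * tvar b * (super_const (cnj (\<sigma> $$ (a, i))) * tvar a))" .
  qed
  also have "\<dots> = - (row_t \<sigma> j * row_t \<sigma> i)" by (simp add: row_t_def sum_product sum_negf)
  finally show ?thesis .
qed

lemma row_t_square: "row_t \<sigma> i * row_t \<sigma> i = 0"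
proof (rule superpoly_eqI)
  fix p
  have "scoeff (row_t \<sigma> i * row_t \<sigma> i) p = - scoeff (row_t \<sigma> i * row_t \<sigma> i) p"
    using row_t_anticommute[of \<sigma> i i] by (metis scoeff_uminus)
  thus "scoeff (row_t \<sigma> i * row_t \<sigma> i) p = scoeff 0 p" by simp
qed

lemma mat_act_add: "mat_act \<sigma> (f + g) = mat_act \<sigma> f + mat_act \<sigma> g"
  and mat_act_const: "mat_act \<sigma> (super_const c * f) = super_const c * mat_act \<sigma> f"
  and mat_act_1 [simp]: "mat_act \<sigma> 1 = 1"
  unfolding mat_act_eq by (simp_all add: super_subst_add super_subst_const)

lemma mat_act_xvar: "mat_act \<sigma> (xvar j * f) = row_x \<sigma> j * mat_act \<sigma> f"
  unfolding mat_act_eq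
  by (rule super_subst_xvar[OF row_x_central row_t_anticommute row_t_square])

lemma mat_act_tvar: "mat_act \<sigma> (tvar j * f) = row_t \<sigma> j * mat_act \<sigma> f"
  unfolding mat_act_eq
  by (rule super_subst_tvar[OF row_x_central row_t_anticommute row_t_square])

lemma mat_act_0 [simp]: "mat_act \<sigma> 0 = 0"
  using mat_act_add[of \<sigma> 0 0] by simp

lemma mat_act_sum: "mat_act \<sigma> (sum f A) = (\<Sum>a\<in>A. mat_act \<sigma> (f a))"
  by (induction A rule: infinite_finite_induct) (auto simp: mat_act_add)

section \<open>Degrees and coefficient rings\<close>

definition xdeg :: "(nat \<Rightarrow>\<^sub>0 nat) \<Rightarrow> nat" where
  "xdeg \<alpha> = (\<Sum>j\<in>keys \<alpha>. lookup \<alpha> j)"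

lemma xdeg_add: "xdeg (\<alpha> + \<beta>) = xdeg \<alpha> + xdeg \<beta>"
  unfolding xdeg_def by (rule setsum_keys_plus_distrib[of "\<lambda>_ e. e"]) auto

lemma xdeg_0 [simp]: "xdeg 0 = 0" and xdeg_single [simp]: "xdeg (single j e) = e"
  by (simp_all add: xdeg_def)

lemma bihomogeneous_iff:
  "bihomogeneous i k f \<longleftrightarrow>
    (\<forall>\<alpha> I. scoeff f (\<alpha>, I) \<noteq> 0 \<longrightarrow> int (xdeg \<alpha>) = i \<and> int (fcard I) = k)"
  unfolding bihomogeneous_def xdeg_def by (auto simp: in_supp_iff)

lemma bihomogeneous_0 [simp]: "bihomogeneous i k 0"
  by (simp add: bihomogeneous_iff)

lemma bihomogeneous_add: "bihomogeneous i k f \<Longrightarrow> bihomogeneous i k g \<Longrightarrow> bihomogeneous i k (f + g)"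
  unfolding bihomogeneous_iff scoeff_add by (metis add.right_neutral)

lemma bihomogeneous_sum: "(\<And>a. a \<in> A \<Longrightarrow> bihomogeneous i k (f a)) \<Longrightarrow> bihomogeneous i k (sum f A)"
  by (induction A rule: infinite_finite_induct) (auto intro: bihomogeneous_add)

lemma bihomogeneous_const: "bihomogeneous i k f \<Longrightarrow> bihomogeneous i k (super_const c * f)"
  by (auto simp: bihomogeneous_iff)

lemma bihomogeneous_monom: "bihomogeneous (int (xdeg \<alpha>)) (int (fcard I)) (super_monom \<alpha> I c)"
  by (simp add: bihomogeneous_iff scoeff_monom)

lemma bihomogeneous_map:
  assumes f: "bihomogeneous i k f" and add: "\<And>f g. L (f + g) = L f + L g"
    and monom: "\<And>\<alpha> I c. int (xdeg \<alpha>) = i \<Longrightarrow> int (fcard I) = k \<Longrightarrow> bihomogeneous i' k' (L (super_monom \<alpha> I c))"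
  shows "bihomogeneous i' k' (L f)"
proof -
  have L0: "L 0 = 0" using add[of 0 0] by simp
  have "L (sum g A) = (\<Sum>a\<in>A. L (g a))" for g and A :: "super_index set"
    by (induction A rule: infinite_finite_induct) (auto simp: add L0)
  hence "L f = (\<Sum>p\<in>supp f. L (super_monom (fst p) (snd p) (scoeff f p)))"
    by (metis superpoly_expand)
  moreover have "bihomogeneous i' k' (L (super_monom (fst p) (snd p) (scoeff f p)))" if "p \<in> supp f" for p
    using f that by (intro monom) (cases p; simp add: bihomogeneous_iff in_supp_iff)+
  ultimately show ?thesis by (simp add: bihomogeneous_sum)
qed

lemma bihomogeneous_xvar: "bihomogeneous i k f \<Longrightarrow> bihomogeneous (i + 1) k (xvar j * f)"
  by (rule bihomogeneous_map[of i k f])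
    (auto simp: distrib_left xvar_monom bihomogeneous_iff scoeff_monom xdeg_add)

lemma bihomogeneous_tvar: "bihomogeneous i k f \<Longrightarrow> bihomogeneous i (k + 1) (tvar j * f)"
  by (rule bihomogeneous_map[of i k f])
    (auto simp: distrib_left tvar_monom bihomogeneous_iff scoeff_monom fcard_finsert_disjoint)

lemma bihomogeneous_x_deriv:
  assumes "bihomogeneous i k f"
  shows "bihomogeneous (i - 1) k (x_deriv j f)"
  unfolding bihomogeneous_iff scoeff_x_deriv
proof (intro allI impI)
  fix \<alpha> I
  assume "of_nat (Suc (lookup \<alpha> j)) * scoeff f (\<alpha> + single j 1, I) \<noteq> 0"
  hence "scoeff f (\<alpha> + single j 1, I) \<noteq> 0" by auto
  with assms have "int (xdeg (\<alpha> + single j 1)) = i \<and> int (fcard I) = k"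
    unfolding bihomogeneous_iff by blast
  thus "int (xdeg \<alpha>) = i - 1 \<and> int (fcard I) = k" by (simp add: xdeg_add)
qed

lemma bihomogeneous_t_deriv:
  assumes "bihomogeneous i k f"
  shows "bihomogeneous i (k - 1) (t_deriv j f)"
  unfolding bihomogeneous_iff scoeff_t_deriv
proof (intro allI impI)
  fix \<alpha> I
  assume "(if j |\<in>| I then 0 else (-1) ^ below j I * scoeff f (\<alpha>, finsert j I)) \<noteq> 0"
  hence j: "j |\<notin>| I" and "scoeff f (\<alpha>, finsert j I) \<noteq> 0" by (auto split: if_splits)
  with assms have "int (xdeg \<alpha>) = i \<and> int (fcard (finsert j I)) = k"
    unfolding bihomogeneous_iff by blast
  with j show "int (xdeg \<alpha>) = i \<and> int (fcard I) = k - 1" by (auto simp: fcard_finsert_disjoint)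
qed

lemma bihomogeneous_x_derivs:
  "bihomogeneous i k f \<Longrightarrow> bihomogeneous (i - int (xdeg \<alpha>)) k (x_derivs \<alpha> f)"
proof (induction \<alpha> arbitrary: i f rule: x_monom_induct)
  case (single j \<alpha>)
  from single.IH[OF bihomogeneous_x_deriv[OF single.prems, of j]]
  show ?case unfolding x_derivs_single_add xdeg_add xdeg_single by (simp add: algebra_simps)
qed simp

lemma bihomogeneous_t_derivs:
  "bihomogeneous i k f \<Longrightarrow> bihomogeneous i (k - int (fcard I)) (t_derivs I f)"
proof (induction I arbitrary: k f rule: fset_min_induct)
  case (insert j I)
  have "j |\<notin>| I" using insert.hyps by fastforce
  with insert.IH[OF bihomogeneous_t_deriv[OF insert.prems, of j]] insert.hyps
  show ?case by (simp add: t_derivs_finsert_less fcard_finsert_disjoint algebra_simps)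
qed (simp add: fcard.rep_eq)

lemma bihomogeneous_super_deriv:
  assumes "bihomogeneous a b \<omega>" "bihomogeneous i k v"
  shows "bihomogeneous (i - a) (k - b) (super_deriv \<omega> v)"
proof (rule bihomogeneous_map[OF assms(1)])
  fix \<alpha> and I :: "nat fset" and c assume "int (xdeg \<alpha>) = a" "int (fcard I) = b"
  thus "bihomogeneous (i - a) (k - b) (super_deriv (super_monom \<alpha> I c) v)"
    using bihomogeneous_x_derivs[OF bihomogeneous_t_derivs[OF assms(2), of I], of \<alpha>]
    unfolding super_deriv_monom by (intro bihomogeneous_const) simp
qed (rule super_deriv_add_left)

lemma bihomogeneous_degree_nonneg:
  assumes "bihomogeneous i k f" "f \<noteq> 0"
  shows "i \<ge> 0 \<and> k \<ge> 0"
proof -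
  obtain p where "scoeff f p \<noteq> 0"
    using assms(2) superpoly_eqI[of f 0] by auto
  with assms(1) have "int (xdeg (fst p)) = i \<and> int (fcard (snd p)) = k"
    unfolding bihomogeneous_iff by (metis prod.collapse)
  thus ?thesis by auto
qed

definition subring_set :: "complex set \<Rightarrow> bool" where
  "subring_set K \<longleftrightarrow> 0 \<in> K \<and> 1 \<in> K \<and> (\<forall>a\<in>K. \<forall>b\<in>K. a + b \<in> K \<and> a * b \<in> K) \<and> (\<forall>a\<in>K. - a \<in> K)"

lemma subring_set_UNIV [simp]: "subring_set UNIV"
  by (simp add: subring_set_def)

lemma subring_set_subfield:
  assumes "subfield K (ring_of_type_algebra :: complex ring)"
  shows "subring_set K"
proof -
  let ?C = "ring_of_type_algebra :: complex ring"
  interpret C: ring ?C by (rule ring_from_type_algebra)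
  have sub: "subring K ?C" using assms by (simp add: subfield_def subdomain_def subcring_def)
  have minus_C: "\<ominus>\<^bsub>?C\<^esub> a = - a" for a
    using C.minus_equality[of "- a" a] by (simp add: ring_of_type_algebra_def)
  show ?thesis
    using subringE(2,3,5,6,7)[OF sub] unfolding minus_C subring_set_def
    by (simp add: ring_of_type_algebra_def)
qed

lemma of_nat_in_subring: "subring_set K \<Longrightarrow> of_nat e \<in> K"
  by (induction e) (auto simp: subring_set_def)

lemma sign_in_subring: "subring_set K \<Longrightarrow> (-1) ^ e \<in> K"
  by (induction e) (auto simp: subring_set_def)

lemma superpolys_iff_scoeff:
  assumes "subring_set K"
  shows "f \<in> superpolys K n \<longleftrightarrow> (\<forall>\<alpha> I. scoeff f (\<alpha>, I) \<in> K \<and>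
    (scoeff f (\<alpha>, I) \<noteq> 0 \<longrightarrow> keys \<alpha> \<subseteq> {..<n} \<and> fset I \<subseteq> {..<n}))"
proof -
  have "0 \<in> K" using assms by (simp add: subring_set_def)
  show ?thesis
    unfolding superpolys_iff[OF \<open>0 \<in> K\<close>] scoeff_def split_paired_All fst_conv snd_conv by blast
qed

lemma superpolys_closed:
  assumes K: "subring_set K"
  shows superpolys_add: "f \<in> superpolys K n \<Longrightarrow> g \<in> superpolys K n \<Longrightarrow> f + g \<in> superpolys K n"
    and superpolys_1: "1 \<in> superpolys K n"
    and superpolys_times: "f \<in> superpolys K n \<Longrightarrow> g \<in> superpolys K n \<Longrightarrow> f * g \<in> superpolys K n"
    and superpolys_xvar: "j < n \<Longrightarrow> xvar j \<in> superpolys K n"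
    and superpolys_tvar: "j < n \<Longrightarrow> tvar j \<in> superpolys K n"
    and superpolys_const: "c \<in> K \<Longrightarrow> super_const c \<in> superpolys K n"
    and superpolys_x_deriv: "f \<in> superpolys K n \<Longrightarrow> x_deriv i f \<in> superpolys K n"
    and superpolys_t_deriv: "f \<in> superpolys K n \<Longrightarrow> t_deriv i f \<in> superpolys K n"
proof -
  note iff = superpolys_iff_scoeff[OF K]
  note K' = K[unfolded subring_set_def]
  show "f + g \<in> superpolys K n" if "f \<in> superpolys K n" "g \<in> superpolys K n"
    unfolding iff scoeff_add
  proof (intro allI conjI impI)
    fix \<alpha> I
    show "scoeff f (\<alpha>, I) + scoeff g (\<alpha>, I) \<in> K" using that K' unfolding iff by blast
    assume "scoeff f (\<alpha>, I) + scoeff g (\<alpha>, I) \<noteq> 0"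
    hence "scoeff f (\<alpha>, I) \<noteq> 0 \<or> scoeff g (\<alpha>, I) \<noteq> 0" by auto
    thus "keys \<alpha> \<subseteq> {..<n}" "fset I \<subseteq> {..<n}" using that unfolding iff by blast+
  qed
  show "super_const c \<in> superpolys K n" if "c \<in> K" for c
    using that K' unfolding iff super_const_def by (auto simp: scoeff_monom)
  from this[of 1] K' show "1 \<in> superpolys K n" by simp
  show "f * g \<in> superpolys K n" if "f \<in> superpolys K n" "g \<in> superpolys K n"
    using that K' by (intro superpolys_mult) auto
  show "j < n \<Longrightarrow> xvar j \<in> superpolys K n" "j < n \<Longrightarrow> tvar j \<in> superpolys K n"
    using K' unfolding iff xvar_def tvar_def by (auto simp: scoeff_monom)
  show "x_deriv i f \<in> superpolys K n" if f: "f \<in> superpolys K n"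
    unfolding iff scoeff_x_deriv
  proof (intro allI conjI impI)
    fix \<alpha> I
    show "of_nat (Suc (lookup \<alpha> i)) * scoeff f (\<alpha> + single i 1, I) \<in> K"
      using f[unfolded iff] K' of_nat_in_subring[OF K] by blast
    assume "of_nat (Suc (lookup \<alpha> i)) * scoeff f (\<alpha> + single i 1, I) \<noteq> 0"
    hence *: "keys (\<alpha> + single i 1) \<subseteq> {..<n}" "fset I \<subseteq> {..<n}"
      using f[unfolded iff] by (metis mult_zero_right)+
    have "keys \<alpha> \<subseteq> keys (\<alpha> + single i 1)"
      by (auto simp: in_keys_iff lookup_add)
    with * show "keys \<alpha> \<subseteq> {..<n}" "fset I \<subseteq> {..<n}" by blast+
  qed
  show "t_deriv i f \<in> superpolys K n" if f: "f \<in> superpolys K n"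
    unfolding iff scoeff_t_deriv
  proof (intro allI conjI impI)
    fix \<alpha> I
    show "(if i |\<in>| I then 0 else (-1) ^ below i I * scoeff f (\<alpha>, finsert i I)) \<in> K"
      using f[unfolded iff] K' sign_in_subring[OF K] by (auto split: if_splits)
    assume "(if i |\<in>| I then 0 else (-1) ^ below i I * scoeff f (\<alpha>, finsert i I)) \<noteq> 0"
    hence "scoeff f (\<alpha>, finsert i I) \<noteq> 0" by (auto split: if_splits)
    with f[unfolded iff] have "keys \<alpha> \<subseteq> {..<n} \<and> fset (finsert i I) \<subseteq> {..<n}" by blast
    thus "keys \<alpha> \<subseteq> {..<n}" "fset I \<subseteq> {..<n}" by auto
  qed
qed

lemma superpolys_sum:
  "subring_set K \<Longrightarrow> (\<And>a. a \<in> A \<Longrightarrow> f a \<in> superpolys K n) \<Longrightarrow> sum f A \<in> superpolys K n"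
  by (induction A rule: infinite_finite_induct) (auto intro: superpolys_add)

lemma superpolys_power: "subring_set K \<Longrightarrow> f \<in> superpolys K n \<Longrightarrow> f ^ e \<in> superpolys K n"
  by (induction e) (auto intro: superpolys_1 superpolys_times)

lemma superpolys_mono_UNIV: "f \<in> superpolys K n \<Longrightarrow> f \<in> superpolys UNIV n"
  by (auto simp: superpolys_def)

section \<open>Monomial matrices\<close>

text \<open>
  The entries are conjugated because the action on \<open>x\<^sub>j\<close> and \<open>\<theta>\<^sub>j\<close> conjugates them once more: this
  matrix sends \<open>x\<^sub>j\<close> to \<open>c\<^sub>j x\<^bsub>\<pi>(j)\<^esub>\<close>.
\<close>

definition monomial_mat :: "nat \<Rightarrow> (nat \<Rightarrow> nat) \<Rightarrow> (nat \<Rightarrow> complex) \<Rightarrow> complex mat" where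
  "monomial_mat n \<pi> c = mat n n (\<lambda>(i, j). if i = \<pi> j then cnj (c j) else 0)"

lemma monomial_mat_in_group:
  assumes "\<pi> permutes {..<n}" "\<And>j. j < n \<Longrightarrow> c j ^ m = 1" "m > 0"
  shows "monomial_mat n \<pi> c \<in> monomial_group m n"
proof -
  have c: "c j \<noteq> 0" if "j < n" for j using assms(2)[OF that] assms(3) by (auto simp: power_0_left)
  have \<pi>: "\<pi> j < n \<longleftrightarrow> j < n" for j using permutes_in_image[OF assms(1), of j] by simp
  have ex: "\<exists>!j. j < n \<and> monomial_mat n \<pi> c $$ (i, j) \<noteq> 0" if "i < n" for i
  proof -
    define j where "j = inv_into UNIV \<pi> i"
    have j: "\<pi> j = i" using permutes_inverses(1)[OF assms(1)] by (simp add: j_def)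
    with \<pi>[of j] that have "j < n" by simp
    have eq: "i = \<pi> j' \<longleftrightarrow> j' = j" for j'
      using inj_eq[OF permutes_inj[OF assms(1)], of j' j] unfolding j by blast
    have nz: "monomial_mat n \<pi> c $$ (i, j') \<noteq> 0 \<longleftrightarrow> j' = j" if "j' < n" for j'
      using c[OF \<open>j < n\<close>] that \<open>i < n\<close> by (simp add: monomial_mat_def eq)
    show ?thesis by (rule ex1I[of _ j]) (use nz \<open>j < n\<close> in blast)+
  qed
  have ex': "\<exists>!i. i < n \<and> monomial_mat n \<pi> c $$ (i, j) \<noteq> 0" if "j < n" for j
  proof -
    have nz: "monomial_mat n \<pi> c $$ (i, j) \<noteq> 0 \<longleftrightarrow> i = \<pi> j" if "i < n" for i
      using c that \<open>j < n\<close> by (auto simp: monomial_mat_def)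
    show ?thesis by (rule ex1I[of _ "\<pi> j"]) (use nz \<pi> that in blast)+
  qed
  have "cnj (c j) ^ m = 1" if "j < n" for j
    using assms(2)[OF that] by (metis complex_cnj_one complex_cnj_power)
  with ex ex' show ?thesis
    unfolding monomial_group_def by (auto simp: monomial_mat_def)
qed

lemma monomial_group_cases:
  assumes "\<sigma> \<in> monomial_group m n"
  obtains \<pi> c where "\<pi> permutes {..<n}" "\<forall>j<n. c j ^ m = 1" "\<sigma> = monomial_mat n \<pi> c"
proof -
  note group = assms[unfolded monomial_group_def mem_Collect_eq]
  note \<sigma> = group[THEN conjunct1]
    and row = group[THEN conjunct2, THEN conjunct1, rule_format]
    and col = group[THEN conjunct2, THEN conjunct2, THEN conjunct1, rule_format]
    and root = group[THEN conjunct2, THEN conjunct2, THEN conjunct2, rule_format]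
  define \<pi> where "\<pi> j = (if j < n then THE i. i < n \<and> \<sigma> $$ (i, j) \<noteq> 0 else j)" for j
  define c where "c j = cnj (\<sigma> $$ (\<pi> j, j))" for j
  have \<pi>: "\<pi> j < n" "\<sigma> $$ (\<pi> j, j) \<noteq> 0" if "j < n" for j
    using theI'[OF col[OF that]] that by (auto simp: \<pi>_def)
  have uniq: "i = \<pi> j" if "i < n" "j < n" "\<sigma> $$ (i, j) \<noteq> 0" for i j
    using col[OF that(2)] \<pi>[OF that(2)] that(1,3) by (elim ex1E) metis
  have "inj_on \<pi> {..<n}"
  proof (rule inj_onI)
    fix j j' assume j: "j \<in> {..<n}" "j' \<in> {..<n}" "\<pi> j = \<pi> j'"
    hence "\<exists>!l. l < n \<and> \<sigma> $$ (\<pi> j, l) \<noteq> 0" by (intro row \<pi>) simp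
    moreover have "\<sigma> $$ (\<pi> j, j) \<noteq> 0" "\<sigma> $$ (\<pi> j, j') \<noteq> 0" using \<pi>[of j] \<pi>[of j'] j by auto
    ultimately show "j = j'" using j by blast
  qed
  moreover from this have "\<pi> ` {..<n} = {..<n}"
    using \<pi>(1) by (intro endo_inj_surj) auto
  ultimately have "bij_betw \<pi> {..<n} {..<n}" by (simp add: bij_betw_def)
  hence "\<pi> permutes {..<n}" by (rule bij_imp_permutes) (simp add: \<pi>_def)
  moreover have "\<forall>j<n. c j ^ m = 1"
    using root[OF \<pi>(1) _ \<pi>(2)] unfolding c_def
    by (metis complex_cnj_one complex_cnj_power)
  moreover have "\<sigma> = monomial_mat n \<pi> c"
    using \<sigma> uniq by (intro eq_matI) (auto simp: monomial_mat_def c_def)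
  ultimately show thesis by (rule that)
qed

lemma mat_act_monomial_mat:
  assumes "\<pi> permutes {..<n}" "j < n"
  shows "mat_act (monomial_mat n \<pi> c) (xvar j * f) =
      super_const (c j) * (xvar (\<pi> j) * mat_act (monomial_mat n \<pi> c) f)"
    and "mat_act (monomial_mat n \<pi> c) (tvar j * f) =
      super_const (c j) * (tvar (\<pi> j) * mat_act (monomial_mat n \<pi> c) f)"
proof -
  have \<pi>: "\<pi> j < n" using permutes_in_image[OF assms(1), of j] assms(2) by simp
  have "(\<Sum>i<n. super_const (cnj (monomial_mat n \<pi> c $$ (i, j))) * f i) = super_const (c j) * f (\<pi> j)" for f
  proof -
    have "(\<Sum>i<n. super_const (cnj (monomial_mat n \<pi> c $$ (i, j))) * f i)
        = (\<Sum>i<n. if i = \<pi> j then super_const (c j) * f i else 0)"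
      using assms(2) by (intro sum.cong) (auto simp: monomial_mat_def)
    thus ?thesis using \<pi> by simp
  qed
  hence "row_x (monomial_mat n \<pi> c) j = super_const (c j) * xvar (\<pi> j)"
    "row_t (monomial_mat n \<pi> c) j = super_const (c j) * tvar (\<pi> j)"
    by (simp_all add: row_x_def row_t_def monomial_mat_def)
  thus "mat_act (monomial_mat n \<pi> c) (xvar j * f) =
      super_const (c j) * (xvar (\<pi> j) * mat_act (monomial_mat n \<pi> c) f)"
    "mat_act (monomial_mat n \<pi> c) (tvar j * f) =
      super_const (c j) * (tvar (\<pi> j) * mat_act (monomial_mat n \<pi> c) f)"
    by (simp_all add: mat_act_xvar mat_act_tvar mult.assoc)
qed

lemma mat_act_monomial_mat_power:
  assumes "\<pi> permutes {..<n}" "j < n"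
  shows "mat_act (monomial_mat n \<pi> c) (xvar j ^ e * f) =
      super_const (c j ^ e) * (xvar (\<pi> j) ^ e * mat_act (monomial_mat n \<pi> c) f)"
proof (induction e)
  case (Suc e)
  show ?case
    by (simp only: power_Suc mult.assoc mat_act_monomial_mat(1)[OF assms] Suc
        const_left_commute[of "xvar (\<pi> j)"] const_mult)
qed simp

section \<open>Constant coefficient operators\<close>

definition diff_act :: "((nat \<Rightarrow>\<^sub>0 nat) \<Rightarrow>\<^sub>0 complex) \<Rightarrow> superpoly \<Rightarrow> superpoly" where
  "diff_act p v = (\<Sum>\<alpha>\<in>keys p. super_const (lookup p \<alpha>) * x_derivs \<alpha> v)"

lemma diff_act_superset:
  assumes "finite A" "keys p \<subseteq> A"
  shows "diff_act p v = (\<Sum>\<alpha>\<in>A. super_const (lookup p \<alpha>) * x_derivs \<alpha> v)"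
  unfolding diff_act_def
  by (rule sum.mono_neutral_left) (use assms in \<open>auto simp: in_keys_iff\<close>)

lemma diff_act_add_left: "diff_act (p + q) v = diff_act p v + diff_act q v"
proof -
  let ?A = "keys p \<union> keys q"
  show ?thesis
    using keys_add[of p q]
    by (subst (1 2 3) diff_act_superset[of ?A])
      (auto simp: lookup_add const_add distrib_right sum.distrib)
qed

lemma diff_act_single: "diff_act (single \<alpha> c) v = super_const c * x_derivs \<alpha> v"
  by (subst diff_act_superset[of "{\<alpha>}"]) auto

lemma diff_act_add_right: "diff_act p (v + w) = diff_act p v + diff_act p w"
  by (simp add: diff_act_def x_derivs_linear distrib_left sum.distrib)

lemma diff_act_const_right: "diff_act p (super_const c * v) = super_const c * diff_act p v"
  by (simp add: diff_act_def x_derivs_linear sum_distrib_left const_mult mult.commute)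

lemma poly_single_induct [case_names single add]:
  assumes "\<And>\<alpha> c. P (single \<alpha> (c :: complex))" "\<And>p q. P p \<Longrightarrow> P q \<Longrightarrow> P (p + q)"
  shows "P (p :: (nat \<Rightarrow>\<^sub>0 nat) \<Rightarrow>\<^sub>0 complex)"
proof (induction p rule: update_induct)
  case const
  show ?case using assms(1)[of 0 0] by simp
next
  case (update p \<alpha> c)
  have "Poly_Mapping.update \<alpha> c p = p + single \<alpha> c"
    using update(1) by (intro poly_mapping_eqI)
      (auto simp: lookup_update lookup_add lookup_single when_def in_keys_iff)
  thus ?case using assms update by simp
qed

lemma x_derivs_add: "x_derivs (\<alpha> + \<beta>) v = x_derivs \<alpha> (x_derivs \<beta> v)"
proof (induction \<alpha> arbitrary: v rule: x_monom_induct)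
  case (single j \<alpha>)
  show ?case unfolding add.assoc x_derivs_single_add single x_deriv_x_derivs ..
qed simp

lemma diff_act_mult: "diff_act (p * q) v = diff_act p (diff_act q v)"
proof (induction p rule: poly_single_induct)
  case (single \<alpha> c)
  show ?case
  proof (induction q rule: poly_single_induct)
    case (single \<beta> d)
    show ?case
      by (simp add: mult_single diff_act_single x_derivs_add x_derivs_linear const_mult)
  qed (simp add: distrib_left diff_act_add_left diff_act_add_right)
qed (simp add: distrib_right diff_act_add_left)

definition dvar :: "nat \<Rightarrow> (nat \<Rightarrow>\<^sub>0 nat) \<Rightarrow>\<^sub>0 complex" where
  "dvar j = single (single j 1) 1"

lemma diff_act_one: "diff_act 1 v = v"
  using diff_act_single[of 0 1 v] by simp

lemma diff_act_dvar: "diff_act (dvar j) v = x_deriv j v"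
  using x_derivs_single_add[of j 0 v] by (simp add: dvar_def diff_act_single)

lemma diff_act_dvar_power: "diff_act (dvar j ^ e) v = (x_deriv j ^^ e) v"
  by (induction e) (simp_all add: diff_act_one diff_act_mult diff_act_dvar)

definition integrate :: "nat \<Rightarrow> superpoly \<Rightarrow> superpoly" where
  "integrate j = linear_ext (\<lambda>(\<alpha>, I). super_monom (\<alpha> + single j 1) I
     (1 / of_nat (Suc (lookup \<alpha> j))))"

lemma integrate_add: "integrate j (f + g) = integrate j f + integrate j g"
  by (simp add: integrate_def linear_ext_add)

lemma integrate_monom: "integrate j (super_monom \<alpha> I c) =
    super_monom (\<alpha> + single j 1) I (c / of_nat (Suc (lookup \<alpha> j)))"
  by (simp add: integrate_def linear_ext_monom const_mult_monom)

lemma x_deriv_integrate: "x_deriv j (integrate j f) = f"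
proof (induction f rule: superpoly_monom_induct)
  case (monom \<alpha> I c)
  have "complex_of_nat (Suc (lookup \<alpha> j)) \<noteq> 0" by (simp del: of_nat_Suc)
  thus ?case by (simp add: integrate_monom x_deriv_monom lookup_add del: of_nat_Suc)
qed (simp add: integrate_add)

lemma x_deriv_integrate_commute: "i \<noteq> j \<Longrightarrow> x_deriv i (integrate j f) = integrate j (x_deriv i f)"
proof (induction f rule: superpoly_monom_induct)
  case (monom \<alpha> I c)
  have "\<alpha> + single j 1 - single i 1 =
      \<alpha> - single i 1 + single j (1 :: nat)"
    using monom by (intro poly_mapping_eqI) (auto simp: lookup_add lookup_minus lookup_single when_def)
  thus ?case using monom
    by (simp add: integrate_monom x_deriv_monom lookup_add lookup_minus lookup_single when_def
        del: One_nat_def)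
qed (simp add: integrate_add)

lemma x_deriv_funpow_add: "(x_deriv j ^^ l) (f + g) = (x_deriv j ^^ l) f + (x_deriv j ^^ l) g"
  by (induction l) auto

lemma x_deriv_power_const: "(x_deriv j ^^ l) (super_const c * f) = super_const c * (x_deriv j ^^ l) f"
  by (induction l) auto

lemma x_deriv_funpow_0 [simp]: "(x_deriv j ^^ l) 0 = 0"
  by (induction l) auto

lemma x_deriv_nilpotent: "\<exists>l. (x_deriv j ^^ l) f = 0"
proof (induction f rule: superpoly_monom_induct)
  case (monom \<alpha> I c)
  show ?case
  proof (induction "lookup \<alpha> j" arbitrary: \<alpha> c)
    case 0
    hence "(x_deriv j ^^ 1) (super_monom \<alpha> I c) = 0" by (simp add: x_deriv_monom)
    thus ?case ..
  next
    case (Suc e)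
    have "e = lookup (\<alpha> - single j 1) j"
      using Suc(2) by (simp add: lookup_minus)
    from Suc(1)[OF this, of "c * of_nat (lookup \<alpha> j)"] obtain l
      where "(x_deriv j ^^ l) (x_deriv j (super_monom \<alpha> I c)) = 0"
      unfolding x_deriv_monom by blast
    hence "(x_deriv j ^^ Suc l) (super_monom \<alpha> I c) = 0" by (simp add: funpow_swap1)
    thus ?case ..
  qed
next
  case (add f g)
  then obtain k l where "(x_deriv j ^^ k) f = 0" "(x_deriv j ^^ l) g = 0" by blast
  hence "(x_deriv j ^^ (l + k)) f = 0" "(x_deriv j ^^ (k + l)) g = 0"
    by (simp_all only: funpow_add comp_def x_deriv_funpow_0)
  hence "(x_deriv j ^^ (k + l)) (f + g) = 0" by (simp add: x_deriv_funpow_add add.commute)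
  thus ?case ..
qed

lemma nilpotent_action_superpoly:
  assumes "m > 0"
  shows "nilpotent_action diff_act dvar integrate n m"
proof
  show "\<exists>u :: (nat \<Rightarrow>\<^sub>0 nat) \<Rightarrow>\<^sub>0 complex. u * of_nat (Suc k) = 1" for k
  proof
    have "complex_of_nat (Suc k) \<noteq> 0" by (simp del: of_nat_Suc)
    thus "(single 0 (1 / of_nat (Suc k)) :: (nat \<Rightarrow>\<^sub>0 nat) \<Rightarrow>\<^sub>0 complex) * of_nat (Suc k) = 1"
      unfolding single_of_nat[symmetric] mult_single by (simp del: of_nat_Suc)
  qed
  show "integrate j 0 = 0" for j using integrate_add[of j 0 0] by simp
qed (use assms in \<open>auto simp: diff_act_add_left diff_act_add_right diff_act_mult diff_act_one
       diff_act_dvar diff_act_dvar_power x_deriv_nilpotent x_deriv_integrate x_deriv_integrate_commute\<close>)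

section \<open>The degree bound for harmonic elements\<close>

text \<open>
  The power sums of the \<open>x\<^sub>j\<^sup>m\<close> and, up to a constant, their differentials; shifting \<open>r\<close> by one leaves
  out the power sum of degree zero.
\<close>

definition power_sum :: "nat \<Rightarrow> nat \<Rightarrow> nat \<Rightarrow> superpoly" where
  "power_sum m n r = (\<Sum>j<n. xvar j ^ (m * Suc r))"

definition dpower_sum :: "nat \<Rightarrow> nat \<Rightarrow> nat \<Rightarrow> superpoly" where
  "dpower_sum m n r = (\<Sum>j<n. xvar j ^ (m - 1 + m * r) * tvar j)"

lemma super_deriv_xvar_power: "super_deriv (xvar j ^ e * f) v = super_deriv f ((x_deriv j ^^ e) v)"
proof (induction e arbitrary: v)
  case (Suc e)
  show ?case by (simp only: power_Suc mult.assoc super_deriv_xvar Suc funpow_Suc_right comp_def)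
qed simp

lemma super_deriv_power_sum: "super_deriv (power_sum m n r) v = (\<Sum>j<n. (x_deriv j ^^ (m * Suc r)) v)"
  unfolding power_sum_def super_deriv_sum_left
  using super_deriv_xvar_power[where f = 1] by (intro sum.cong) simp_all

lemma super_deriv_dpower_sum:
  "super_deriv (dpower_sum m n r) v = (\<Sum>j<n. t_deriv j ((x_deriv j ^^ (m - 1 + m * r)) v))"
  unfolding dpower_sum_def super_deriv_sum_left super_deriv_xvar_power
  using super_deriv_tvar[where \<omega> = 1] by (intro sum.cong) simp_all

lemma bihomogeneous_xvar_power:
  "bihomogeneous i k f \<Longrightarrow> bihomogeneous (i + int e) k (xvar j ^ e * f)"
proof (induction e)
  case (Suc e)
  from bihomogeneous_xvar[OF Suc.IH[OF Suc.prems], of j]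
  show ?case by (simp add: mult.assoc algebra_simps)
qed simp

lemma bihomogeneous_1: "bihomogeneous 0 0 1"
  using bihomogeneous_monom[of 0 "{||}" 1] const_1 by (simp add: super_const_def fcard_fempty)

lemma power_sums_in_ideal:
  assumes K: "subring_set K" and m: "m > 0"
  shows "power_sum m n r \<in> super_invariant_ideal K n (monomial_group m n)"
    and "dpower_sum m n r \<in> super_invariant_ideal K n (monomial_group m n)"
proof -
  have x: "xvar j ^ e \<in> superpolys K n" if "j < n" for j e
    using that by (intro superpolys_power superpolys_xvar K)
  have "power_sum m n r \<in> superpolys K n" "dpower_sum m n r \<in> superpolys K n"
    unfolding power_sum_def dpower_sum_def
    using x by (auto intro!: superpolys_sum K superpolys_times superpolys_tvar)
  moreover have "bihomogeneous (int (m * Suc r)) 0 (power_sum m n r)"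
    unfolding power_sum_def
    using bihomogeneous_xvar_power[OF bihomogeneous_1, of "m * Suc r"]
    by (intro bihomogeneous_sum) simp
  moreover have "bihomogeneous (int (m - 1 + m * r)) 1 (dpower_sum m n r)"
    unfolding dpower_sum_def
    using bihomogeneous_xvar_power[OF bihomogeneous_tvar[OF bihomogeneous_1], of "m - 1 + m * r"]
    by (intro bihomogeneous_sum) simp
  moreover have "mat_act \<sigma> (power_sum m n r) = power_sum m n r \<and> mat_act \<sigma> (dpower_sum m n r) = dpower_sum m n r"
    if "\<sigma> \<in> monomial_group m n" for \<sigma>
  proof -
    from that obtain \<pi> c where \<pi>: "\<pi> permutes {..<n}" and c': "\<forall>j<n. c j ^ m = 1"
      and \<sigma>: "\<sigma> = monomial_mat n \<pi> c" by (rule monomial_group_cases)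
    note c = c'[rule_format]
    note p = mat_act_monomial_mat_power[OF \<pi>, where c = c, folded \<sigma>]
    have 1: "mat_act \<sigma> (xvar j ^ (m * Suc r)) = xvar (\<pi> j) ^ (m * Suc r)" if "j < n" for j
    proof -
      have "c j ^ (m * Suc r) = 1" by (simp only: power_mult c[OF that] power_one)
      thus ?thesis using p[OF that, where f = 1 and e = "m * Suc r"] by (simp del: mult_Suc_right)
    qed
    have e: "c j ^ (m - 1 + m * r) * c j = 1" if "j < n" for j
    proof -
      have "c j ^ (m - 1 + m * r) * c j = c j ^ (m * Suc r)"
        using m by (simp flip: power_Suc2)
      thus ?thesis using c[OF that] by (simp add: power_mult del: mult_Suc_right)
    qed
    have 2: "mat_act \<sigma> (xvar j ^ (m - 1 + m * r) * tvar j) = xvar (\<pi> j) ^ (m - 1 + m * r) * tvar (\<pi> j)"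
      if "j < n" for j
    proof -
      have t: "mat_act \<sigma> (tvar j) = super_const (c j) * tvar (\<pi> j)"
        using mat_act_monomial_mat(2)[OF \<pi> that, where c = c and f = 1, folded \<sigma>] by simp
      show ?thesis
        unfolding p[OF that] t const_left_commute[of "xvar (\<pi> j) ^ _"] const_mult e[OF that] by simp
    qed
    show ?thesis
      unfolding power_sum_def dpower_sum_def mat_act_sum
      using sum.permute[OF \<pi>, of "\<lambda>j. xvar j ^ (m * Suc r)"]
        sum.permute[OF \<pi>, of "\<lambda>j. xvar j ^ (m - 1 + m * r) * tvar j"] 1 2
      by (simp add: comp_def)
  qed
  moreover have "int (m * Suc r) + 0 > 0"
    using m by (simp only: add_0_right of_nat_0_less_iff) simp
  moreover have "int (m - 1 + m * r) + 1 > 0" by linarith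
  ultimately show "power_sum m n r \<in> super_invariant_ideal K n (monomial_group m n)"
    "dpower_sum m n r \<in> super_invariant_ideal K n (monomial_group m n)"
    unfolding super_invariant_ideal_def genideal_def by blast+
qed

lemma t_list_x_deriv: "foldr t_deriv is (x_deriv j v) = x_deriv j (foldr t_deriv is v)"
  by (induction "is") (simp_all add: x_t_deriv_commute)

lemma t_list_x_deriv_power:
  "foldr t_deriv is ((x_deriv j ^^ e) v) = (x_deriv j ^^ e) (foldr t_deriv is v)"
  by (induction e) (simp_all add: t_list_x_deriv)

lemma t_deriv_x_deriv_power: "t_deriv i ((x_deriv j ^^ e) v) = (x_deriv j ^^ e) (t_deriv i v)"
  using t_list_x_deriv_power[of "[i]"] by simp

lemma t_list_add: "foldr t_deriv is (v + w) = foldr t_deriv is v + foldr t_deriv is w"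
  by (induction "is") simp_all

lemma t_list_0 [simp]: "foldr t_deriv is 0 = 0"
  by (induction "is") simp_all

lemma t_list_sum: "foldr t_deriv is (sum f A) = (\<Sum>a\<in>A. foldr t_deriv is (f a))"
  by (induction A rule: infinite_finite_induct) (simp_all add: t_list_add)

lemma t_list_t_deriv:
  "foldr t_deriv is (t_deriv j v) = super_const ((-1) ^ length is) * t_deriv j (foldr t_deriv is v)"
proof (induction "is")
  case (Cons i js)
  show ?case
    by (rule superpoly_eqI) (simp add: Cons t_deriv_anticommute[of i j])
qed simp

text \<open>
  The factor \<open>c\<close> is a sign, but only its being invertible matters.
\<close>

lemma t_list_front:
  "a \<in> set is \<Longrightarrow> \<exists>c. c * c = 1 \<and> foldr t_deriv is v = super_const c * t_deriv a (foldr t_deriv (remove1 a is) v)"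
proof (induction "is")
  case (Cons i js)
  show ?case
  proof (cases "a = i")
    case True
    thus ?thesis by (intro exI[of _ 1]) simp
  next
    case False
    with Cons obtain c where c: "c * c = 1"
      "foldr t_deriv js v = super_const c * t_deriv a (foldr t_deriv (remove1 a js) v)" by auto
    show ?thesis
      by (rule exI[of _ "- c"], intro conjI superpoly_eqI)
        (use c False in \<open>simp_all add: t_deriv_anticommute[of i a]\<close>)
  qed
qed simp

lemma scoeff_t_list:
  assumes "distinct is" "set is \<inter> fset J = {}"
  shows "\<exists>c. c \<noteq> 0 \<and> scoeff (foldr t_deriv is v) (\<alpha>, J) = c * scoeff v (\<alpha>, J |\<union>| fset_of_list is)"
  using assms
proof (induction "is" arbitrary: J)
  case (Cons i js)
  have "\<exists>c. c \<noteq> 0 \<and> scoeff (foldr t_deriv js v) (\<alpha>, finsert i J) =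
      c * scoeff v (\<alpha>, finsert i J |\<union>| fset_of_list js)"
    by (rule Cons.IH) (use Cons.prems in auto)
  then obtain c where c: "c \<noteq> 0" "scoeff (foldr t_deriv js v) (\<alpha>, finsert i J) =
      c * scoeff v (\<alpha>, finsert i J |\<union>| fset_of_list js)" by blast
  show ?case
    by (rule exI[of _ "(-1) ^ below i J * c"]) (use c Cons.prems in \<open>simp add: scoeff_t_deriv\<close>)
qed (auto intro: exI[of _ 1])

lemma scoeff_x_derivs: "\<exists>c. c \<noteq> 0 \<and> scoeff (x_derivs \<gamma> v) (\<beta>, I) = c * scoeff v (\<beta> + \<gamma>, I)"
proof (induction \<gamma> arbitrary: v \<beta> rule: x_monom_induct)
  case zero
  show ?case by (intro exI[of _ 1]) simp
next
  case (single j \<gamma>)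
  from single[of "x_deriv j v" \<beta>] obtain c where c: "c \<noteq> 0"
    "scoeff (x_derivs \<gamma> (x_deriv j v)) (\<beta>, I) = c * scoeff (x_deriv j v) (\<beta> + \<gamma>, I)" by blast
  have "complex_of_nat (Suc (lookup (\<beta> + \<gamma>) j)) \<noteq> 0" by (simp del: of_nat_Suc)
  with c show ?case
    by (intro exI[of _ "c * of_nat (Suc (lookup (\<beta> + \<gamma>) j))"])
      (unfold x_derivs_single_add, simp add: scoeff_x_deriv add_ac del: of_nat_Suc One_nat_def)
qed

lemma x_derivs_as_product:
  "\<exists>js. (\<forall>v. diff_act (prod_list (map dvar js)) v = x_derivs \<alpha> v) \<and>
     set js \<subseteq> keys \<alpha> \<and> length js = xdeg \<alpha>"
proof (induction \<alpha> rule: x_monom_induct)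
  case zero
  show ?case by (intro exI[of _ "[]"]) (simp add: diff_act_one)
next
  case (single j \<alpha>)
  then obtain js where js: "\<And>v. diff_act (prod_list (map dvar js)) v = x_derivs \<alpha> v"
    "set js \<subseteq> keys \<alpha>" "length js = xdeg \<alpha>" by blast
  have "keys \<alpha> \<subseteq> keys (single j 1 + \<alpha>)" "j \<in> keys (single j 1 + \<alpha>)"
    by (auto simp: in_keys_iff lookup_add)
  moreover have "diff_act (prod_list (map dvar (j # js))) v = x_derivs (single j 1 + \<alpha>) v" for v
    unfolding x_derivs_single_add x_deriv_x_derivs by (simp add: diff_act_mult diff_act_dvar js(1))
  ultimately show ?case using js by (intro exI[of _ "j # js"]) (auto simp: xdeg_add)
qed

text \<open>
  Take a monomial \<open>x\<^sup>\<alpha> \<theta>\<^sub>I\<close> of \<open>\<eta>\<close>.  Applying \<open>\<partial>\<^bsub>\<theta>i\<^esub>\<close> for \<open>i \<in> I\<close> leaves an \<open>F\<close> containing \<open>x\<^sup>\<alpha>\<close>, to which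
  \<open>degree_bound\<close> applies: it is killed by the symmetric polynomials because \<open>\<eta>\<close> is, and by the corner
  polynomial of \<open>a\<close> because applying \<open>\<partial>\<^bsub>\<theta>i\<^esub>\<close> for \<open>i \<in> I - {a}\<close> to the equations from
  the differentials gives the relations required by \<open>corner_kills\<close>.
\<close>

theorem harmonic_degree_bound:
  assumes K: "subring_set K" and m: "m \<ge> 1" and n: "n \<ge> 1"
    and \<eta>: "\<eta> \<in> super_harmonics_component K n (monomial_group m n) i k" and "\<eta> \<noteq> 0"
  shows "i + k + int m * int (nat k choose 2) \<le> int m * int (n choose 2) + (int m - 1) * int n"
proof -
  interpret nilpotent_action diff_act dvar integrate n m
    by (rule nilpotent_action_superpoly) (use m in simp)
  from \<eta> have \<eta>_in: "\<eta> \<in> superpolys K n" and bi: "bihomogeneous i k \<eta>"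
    and ps: "super_deriv (power_sum m n r) \<eta> = 0" and dps: "super_deriv (dpower_sum m n r) \<eta> = 0" for r
    using power_sums_in_ideal[OF K, of m n r] m
    by (auto simp: super_harmonics_component_def super_harmonics_def)
  obtain p where p: "scoeff \<eta> p \<noteq> 0" using \<open>\<eta> \<noteq> 0\<close> superpoly_eqI[of \<eta> 0] by auto
  obtain \<alpha> I where \<alpha>I: "scoeff \<eta> (\<alpha>, I) \<noteq> 0" using p by (cases p) auto
  have sub: "keys \<alpha> \<subseteq> {..<n}" "fset I \<subseteq> {..<n}"
    using \<eta>_in \<alpha>I by (auto simp: superpolys_iff_scoeff[OF K])
  have deg: "int (xdeg \<alpha>) = i" "int (fcard I) = k"
    using bi \<alpha>I unfolding bihomogeneous_iff by blast+
  define L where "L = sorted_list_of_fset I"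
  have L: "distinct L" "set L = fset I" "fset_of_list L = I" "length L = fcard I"
  proof -
    show "fset_of_list L = I" "set L = fset I" by (simp_all add: L_def)
    show "distinct L" "length L = fcard I"
      by (simp_all add: L_def sorted_list_of_fset.rep_eq fcard.rep_eq)
  qed
  define F where "F = foldr t_deriv L \<eta>"
  have sym: "symmetric_killed (foldr t_deriv js \<eta>)" for js
  proof (rule symmetric_killed_if_power_sums_kill)
    fix r
    have "diff_act (\<Sum>j<n. y j ^ Suc r) (foldr t_deriv js \<eta>) =
        (\<Sum>j<n. (x_deriv j ^^ (m * Suc r)) (foldr t_deriv js \<eta>))"
      unfolding act_sum_left y_def power_mult[symmetric] diff_act_dvar_power ..
    also have "\<dots> = foldr t_deriv js (super_deriv (power_sum m n r) \<eta>)"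
      by (simp only: super_deriv_power_sum t_list_sum t_list_x_deriv_power)
    finally show "diff_act (\<Sum>j<n. y j ^ Suc r) (foldr t_deriv js \<eta>) = 0" by (simp add: ps)
  qed
  have corner: "diff_act (corner L a) F = 0" if a: "a \<in> set L" for a
  proof -
    define w where "w j = t_deriv j (foldr t_deriv (remove1 a L) \<eta>)" for j
    have "diff_act (corner L a) (w a) = 0"
    proof (rule corner_kills)
      show "distinct L" "set L \<subseteq> {..<n}" "a \<in> set L" using L sub a by auto
      show "symmetric_killed (w j)" for j using sym[of "j # remove1 a L"] by (simp add: w_def)
      show "w j = 0" if "j \<in> set L" "j \<noteq> a" for j
      proof -
        have "j \<in> set (remove1 a L)" using that by simp
        from t_list_front[OF this, of \<eta>] show ?thesis by (auto simp: w_def t_deriv_square)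
      qed
      fix s
      have "0 = foldr t_deriv (remove1 a L) (super_deriv (dpower_sum m n s) \<eta>)" by (simp add: dps)
      also have "\<dots> = super_const ((-1) ^ length (remove1 a L)) * (\<Sum>j<n. (x_deriv j ^^ (m - 1 + m * s)) (w j))"
        unfolding super_deriv_dpower_sum t_list_sum t_list_t_deriv t_list_x_deriv_power
          t_deriv_x_deriv_power w_def sum_distrib_left x_deriv_power_const ..
      finally have "super_const ((-1) ^ length (remove1 a L)) *
          (super_const ((-1) ^ length (remove1 a L)) * (\<Sum>j<n. (x_deriv j ^^ (m - 1 + m * s)) (w j))) = 0"
        by simp
      moreover have "(-1 :: complex) ^ e * (-1) ^ e = 1" for e by (simp flip: power_mult_distrib)
      ultimately have "(\<Sum>j<n. (x_deriv j ^^ (m - 1 + m * s)) (w j)) = 0"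
        by (simp only: const_mult const_1 mult_1_left)
      thus "(\<Sum>j<n. diff_act (dvar j ^ (m - 1) * y j ^ s) (w j)) = 0"
        unfolding y_def power_mult[symmetric] power_add[symmetric] diff_act_dvar_power .
    qed
    thus ?thesis using t_list_front[OF a, of \<eta>]
      by (auto simp: F_def w_def diff_act_const_right)
  qed
  have "vanish_above (int m * int (n choose 2) + (int m - 1) * int n
    - int (length L) - int m * int (length L choose 2)) F"
    by (rule degree_bound) (use n L sub sym corner in \<open>auto simp: F_def\<close>)
  moreover obtain js where js: "\<And>v. diff_act (prod_list (map dvar js)) v = x_derivs \<alpha> v"
    "set js \<subseteq> keys \<alpha>" "length js = xdeg \<alpha>" using x_derivs_as_product by blast
  moreover have "diff_act (prod_list (map dvar js)) F \<noteq> 0"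
  proof -
    obtain c where c: "c \<noteq> 0" "scoeff (diff_act (prod_list (map dvar js)) F) (0, {||}) = c * scoeff F (\<alpha>, {||})"
      using scoeff_x_derivs[of \<alpha> F 0 "{||}"] js(1) by auto
    obtain d where d: "d \<noteq> 0" "scoeff F (\<alpha>, {||}) = d * scoeff \<eta> (\<alpha>, I)"
      using scoeff_t_list[of L "{||}" \<eta> \<alpha>] L by (auto simp: F_def)
    from c d \<alpha>I show ?thesis by auto
  qed
  ultimately have "\<not> int (length js) > int m * int (n choose 2) + (int m - 1) * int n
    - int (length L) - int m * int (length L choose 2)"
    using sub unfolding vanish_above_def by blast
  moreover have "nat k = length L" using deg L by simp
  ultimately show ?thesis using deg js(3) L by simp
qed

section \<open>Equivariance under monomial matrices\<close>

lemma scoeff_xvar_mult: "scoeff (xvar l * f) (\<beta>, I) =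
    (if lookup \<beta> l = 0 then 0 else scoeff f (\<beta> - single l 1, I))"
proof (induction f rule: superpoly_monom_induct)
  case (monom \<alpha> J c)
  have "\<beta> = single l 1 + \<alpha> \<longleftrightarrow>
      lookup \<beta> l \<noteq> 0 \<and> \<beta> - single l 1 = \<alpha>"
  proof
    assume "lookup \<beta> l \<noteq> 0 \<and> \<beta> - single l 1 = \<alpha>"
    thus "\<beta> = single l 1 + \<alpha>"
      by (intro poly_mapping_eqI) (auto simp: lookup_add lookup_minus lookup_single when_def)
  qed (simp add: lookup_add)
  thus ?case by (auto simp: xvar_monom scoeff_monom simp del: One_nat_def)
qed (simp add: distrib_left)

lemma scoeff_tvar_mult_empty: "scoeff (tvar l * f) (\<beta>, {||}) = 0"
  by (induction f rule: superpoly_monom_induct)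
    (auto simp: tvar_monom scoeff_monom distrib_left)

lemma scoeff_1: "scoeff 1 (\<beta>, I) = (if \<beta> = 0 \<and> I = {||} then 1 else 0)"
  using scoeff_monom[of 0 "{||}" 1 "(\<beta>, I)"] const_1 by (simp add: super_const_def)

lemma lookup_map_key: "inj f \<Longrightarrow> lookup (map_key f p) x = lookup p (f x)"
  by (simp add: map_key.rep_eq)

context
  fixes n :: nat and \<pi> :: "nat \<Rightarrow> nat" and c :: "nat \<Rightarrow> complex"
  assumes \<pi>: "\<pi> permutes {..<n}"
begin

abbreviation "monomial_act \<equiv> mat_act (monomial_mat n \<pi> c)"

lemma inj_\<pi>: "inj \<pi>"
  using \<pi> by (rule permutes_inj)

lemma x_deriv_mat_act:
  assumes "f \<in> superpolys UNIV n" "j < n"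
  shows "x_deriv (\<pi> j) (monomial_act f) = super_const (c j) * monomial_act (x_deriv j f)"
  using assms(1)
proof (induction rule: superpoly_induct)
  case (x l f)
  have "\<pi> j = \<pi> l \<longleftrightarrow> j = l" using inj_eq[OF inj_\<pi>] .
  thus ?case using x
    by (simp add: x_deriv_xvar_mult mat_act_monomial_mat[OF \<pi>] mat_act_add distrib_left
        const_left_commute[of "xvar _"] const_mult mult.commute)
next
  case (t l f)
  thus ?case
    by (simp add: x_deriv_tvar_mult mat_act_monomial_mat[OF \<pi>]
        const_left_commute[of "tvar _"] const_mult mult.commute)
next
  case (const d f)
  thus ?case by (simp add: mat_act_const const_mult mult.commute)
qed (simp_all add: mat_act_add distrib_left)

lemma t_deriv_mat_act:
  assumes "f \<in> superpolys UNIV n" "j < n"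
  shows "t_deriv (\<pi> j) (monomial_act f) = super_const (c j) * monomial_act (t_deriv j f)"
  using assms(1)
proof (induction rule: superpoly_induct)
  case (x l f)
  thus ?case
    by (simp add: t_deriv_xvar_mult mat_act_monomial_mat[OF \<pi>]
        const_left_commute[of "xvar _"] const_mult mult.commute)
next
  case (t l f)
  have "\<pi> j = \<pi> l \<longleftrightarrow> j = l" using inj_eq[OF inj_\<pi>] .
  moreover have "mat_act M (f - g) = mat_act M f - mat_act M g" for M f g
    using mat_act_add[of M "f - g" g] by simp
  ultimately show ?case using t
    by (simp add: t_deriv_tvar_mult mat_act_monomial_mat[OF \<pi>] right_diff_distrib
        const_left_commute[of "tvar _"] const_mult mult.commute)
next
  case (const d f)
  thus ?case by (simp add: mat_act_const const_mult mult.commute)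
qed (simp_all add: mat_act_add distrib_left)

text \<open>
  The conjugation of coefficients in \<open>\<partial>\<^sub>\<omega>\<close> makes the pairing equivariant for unitary matrices.
\<close>

lemma super_deriv_mat_act:
  assumes unit: "\<And>j. j < n \<Longrightarrow> cnj (c j) * c j = 1"
    and "\<omega> \<in> superpolys UNIV n" "v \<in> superpolys UNIV n"
  shows "super_deriv (monomial_act \<omega>) (monomial_act v) = monomial_act (super_deriv \<omega> v)"
  using assms(2,3)
proof (induction arbitrary: v rule: superpoly_induct)
  case (x j f)
  have "super_deriv (monomial_act (xvar j * f)) (monomial_act v) = super_const (cnj (c j)) *
      (super_const (c j) * super_deriv (monomial_act f) (monomial_act (x_deriv j v)))"
    using x by (simp add: mat_act_monomial_mat[OF \<pi>] super_deriv_const_left super_deriv_xvar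
        x_deriv_mat_act super_deriv_const_right)
  also have "\<dots> = monomial_act (super_deriv (xvar j * f) v)"
    using x by (simp add: const_mult unit super_deriv_xvar superpolys_x_deriv)
  finally show ?case .
next
  case (t j f)
  have "super_deriv (monomial_act (tvar j * f)) (monomial_act v) = super_const (cnj (c j)) *
      (super_const (c j) * super_deriv (monomial_act f) (monomial_act (t_deriv j v)))"
    using t by (simp add: mat_act_monomial_mat[OF \<pi>] super_deriv_const_left super_deriv_tvar
        t_deriv_mat_act super_deriv_const_right)
  also have "\<dots> = monomial_act (super_deriv (tvar j * f) v)"
    using t by (simp add: const_mult unit super_deriv_tvar superpolys_t_deriv)
  finally show ?case .
qed (simp_all add: mat_act_add mat_act_const super_deriv_add_left super_deriv_const_left)

lemma scoeff_mat_act: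
  assumes "f \<in> superpolys UNIV n"
  shows "scoeff (monomial_act f) (\<beta>, {||}) = (\<Prod>j<n. c j ^ lookup \<beta> (\<pi> j)) *
    scoeff f (map_key \<pi> \<beta>, {||})"
  using assms
proof (induction arbitrary: \<beta> rule: superpoly_induct)
  case one
  have "map_key \<pi> \<beta> = 0 \<longleftrightarrow> \<beta> = 0"
  proof
    assume "map_key \<pi> \<beta> = 0"
    hence "lookup \<beta> (\<pi> j) = 0" for j using lookup_map_key[OF inj_\<pi>, of \<beta> j] by simp
    thus "\<beta> = 0" using permutes_surj[OF \<pi>] by (intro poly_mapping_eqI) (metis surjD lookup_zero)
  qed (simp add: map_key_zero[OF inj_\<pi>])
  thus ?case by (auto simp: scoeff_1)
next
  case (x l f)
  let ?\<gamma> = "\<beta> - single (\<pi> l) 1"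
  show ?case
  proof (cases "lookup \<beta> (\<pi> l) = 0")
    case True
    thus ?thesis using x
      by (simp add: mat_act_monomial_mat[OF \<pi>] scoeff_xvar_mult lookup_map_key[OF inj_\<pi>])
  next
    case False
    have "map_key \<pi> ?\<gamma> = map_key \<pi> \<beta> - single l 1"
      by (intro poly_mapping_eqI)
        (simp add: lookup_map_key[OF inj_\<pi>] lookup_minus lookup_single when_def inj_eq[OF inj_\<pi>])
    moreover have "(\<Prod>j<n. c j ^ lookup \<beta> (\<pi> j)) =
        c l * (\<Prod>j<n. c j ^ lookup ?\<gamma> (\<pi> j))"
    proof -
      have "(\<Prod>j\<in>{..<n} - {l}. c j ^ lookup ?\<gamma> (\<pi> j)) =
          (\<Prod>j\<in>{..<n} - {l}. c j ^ lookup \<beta> (\<pi> j))"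
        by (intro prod.cong) (auto simp: lookup_minus lookup_single when_def inj_eq[OF inj_\<pi>])
      moreover have "c l ^ lookup \<beta> (\<pi> l) = c l * c l ^ lookup ?\<gamma> (\<pi> l)"
        using False by (cases "lookup \<beta> (\<pi> l)") (auto simp: lookup_minus)
      ultimately show ?thesis using x(1) by (simp add: prod.remove[of _ l])
    qed
    ultimately show ?thesis using x False
      by (simp add: mat_act_monomial_mat[OF \<pi>] scoeff_xvar_mult lookup_map_key[OF inj_\<pi>])
  qed
next
  case (t l f)
  thus ?case by (simp add: mat_act_monomial_mat[OF \<pi>] scoeff_tvar_mult_empty)
qed (simp_all add: mat_act_add mat_act_const distrib_left)

lemma mat_act_power_monom:
  assumes "finite S" "S \<subseteq> {..<n}"
  shows "monomial_act (super_monom (\<Sum>j\<in>S. single j (e j)) {||} d) =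
    super_monom (\<Sum>j\<in>S. single (\<pi> j) (e j)) {||} ((\<Prod>j\<in>S. c j ^ e j) * d)"
  using assms
proof (induction S)
  case empty
  have "super_monom 0 {||} d = super_const d * 1" by (simp add: super_const_def)
  thus ?case by (simp only: mat_act_const mat_act_1 sum.empty prod.empty mult_1_left)
next
  case (insert a S)
  have x: "super_monom (single l k + \<alpha>) I b = xvar l ^ k * super_monom \<alpha> I b" for l k \<alpha> I b
  proof (induction k)
    case (Suc k)
    have "xvar l ^ Suc k * super_monom \<alpha> I b = xvar l * super_monom (single l k + \<alpha>) I b"
      by (simp add: mult.assoc Suc)
    thus ?case by (simp add: xvar_monom add.assoc[symmetric] flip: single_add)
  qed simp
  show ?case using insert
    by (simp add: x mat_act_monomial_mat_power[OF \<pi>] mult.assoc flip: const_mult_monom const_mult)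
      (simp only: const_left_commute const_mult_monom x[symmetric] mult_ac)
qed

lemma x_derivs_mat_act:
  assumes "\<And>j. c j = 1" "keys \<gamma> \<subseteq> {..<n}" "v \<in> superpolys UNIV n"
  shows "x_derivs \<gamma> (monomial_act v) = monomial_act (x_derivs (map_key \<pi> \<gamma>) v)"
  using assms(2,3)
proof (induction \<gamma> arbitrary: v rule: x_monom_induct)
  case zero
  thus ?case by (simp add: map_key_zero[OF inj_\<pi>])
next
  case (single j \<gamma>)
  have k: "j \<in> keys (single j 1 + \<gamma>)"
    "keys \<gamma> \<subseteq> keys (single j 1 + \<gamma>)"
    by (auto simp: in_keys_iff lookup_add)
  obtain j' where j': "j = \<pi> j'" using permutes_surj[OF \<pi>] by (metis surjD)
  have "j' < n" using k(1) single.prems(1) permutes_in_image[OF \<pi>, of j'] j' by auto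
  have "x_derivs (single j 1 + \<gamma>) (monomial_act v) = x_derivs \<gamma> (monomial_act (x_deriv j' v))"
    using x_deriv_mat_act[OF single.prems(2) \<open>j' < n\<close>] assms(1)
    unfolding x_derivs_single_add by (simp add: j')
  also have "\<dots> = monomial_act (x_derivs (map_key \<pi> \<gamma>) (x_deriv j' v))"
    using k single.prems by (intro single.IH) (auto intro: superpolys_x_deriv)
  also have "\<dots> = monomial_act (x_derivs (map_key \<pi> (single j 1 + \<gamma>)) v)"
    unfolding map_key_plus[OF inj_\<pi>] j' map_key_single[OF inj_\<pi>] x_derivs_single_add ..
  finally show ?case .
qed

end

section \<open>Elements annihilated by all invariants\<close>

text \<open>
  The class is taken over the complex numbers, so that it contains the invariants over every
  coefficient ring \<open>K\<close>.
\<close>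

definition invariant :: "nat \<Rightarrow> nat \<Rightarrow> superpoly \<Rightarrow> bool" where
  "invariant m n \<omega> \<longleftrightarrow> \<omega> \<in> superpolys UNIV n \<and> (\<exists>a b. bihomogeneous a b \<omega> \<and> a + b > 0) \<and>
     (\<forall>\<sigma>\<in>monomial_group m n. mat_act \<sigma> \<omega> = \<omega>)"

definition annihilated :: "nat \<Rightarrow> nat \<Rightarrow> superpoly \<Rightarrow> bool" where
  "annihilated m n v \<longleftrightarrow> (\<forall>\<omega>. invariant m n \<omega> \<longrightarrow> super_deriv \<omega> v = 0)"

text \<open>
  The operator \<open>d\<^sub>l\<close>, a generalised exterior derivative.  It commutes with the group, since
  \<open>\<partial>\<^bsub>x\<^sub>j\<^esub>\<close> and \<open>\<theta>\<^sub>j\<close> are scaled by inverse \<open>m\<close>-th roots of unity.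
\<close>

definition theta_op :: "nat \<Rightarrow> nat \<Rightarrow> nat \<Rightarrow> superpoly \<Rightarrow> superpoly" where
  "theta_op m n l v = (\<Sum>j<n. (x_deriv j ^^ (m * l + 1)) (tvar j * v))"

lemma annihilated_add: "annihilated m n v \<Longrightarrow> annihilated m n w \<Longrightarrow> annihilated m n (v + w)"
  and annihilated_const: "annihilated m n v \<Longrightarrow> annihilated m n (super_const c * v)"
  and annihilated_x_deriv: "annihilated m n v \<Longrightarrow> annihilated m n (x_deriv j v)"
  by (simp_all add: annihilated_def super_deriv_add_right super_deriv_const_right super_deriv_x_deriv)

lemma t_derivs_t_deriv:
  "t_derivs I (t_deriv j v) = super_const ((-1) ^ fcard I) * t_deriv j (t_derivs I v)"
proof (induction I arbitrary: v rule: fset_min_induct)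
  case (insert i I)
  have i: "i |\<notin>| I" using insert.hyps by fastforce
  have neg: "t_derivs I (- v) = - t_derivs I v" for v
    using t_derivs_linear(1)[of I v "- v"] t_derivs_linear(2)[of I 0 0]
    by (simp add: eq_neg_iff_add_eq_0 add.commute)
  show ?case using i insert
    by (intro superpoly_eqI)
      (simp add: t_derivs_finsert_less t_deriv_anticommute[of i j] neg fcard_finsert_disjoint)
qed (simp add: fcard_fempty)

lemma super_deriv_t_deriv:
  assumes "bihomogeneous a b \<omega>"
  shows "super_deriv \<omega> (t_deriv j v) = super_const ((-1) ^ nat b) * t_deriv j (super_deriv \<omega> v)"
proof -
  have x: "x_derivs \<alpha> (t_deriv j v) = t_deriv j (x_derivs \<alpha> v)" for \<alpha> v
    by (induction \<alpha> arbitrary: v rule: x_monom_induct)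
      (simp_all add: x_derivs_single_add x_t_deriv_commute del: One_nat_def)
  have "fcard (snd p) = nat b" if "p \<in> supp \<omega>" for p
    using assms[unfolded bihomogeneous_iff, rule_format, of "fst p" "snd p"] that
    by (auto simp: in_supp_iff)
  thus ?thesis
    unfolding super_deriv_eq t_deriv_sum sum_distrib_left
    by (intro sum.cong refl superpoly_eqI) (simp add: t_derivs_t_deriv x_derivs_linear x)
qed

lemma super_deriv_monom_tvar:
  "super_deriv (super_monom \<alpha> I c) (tvar j * v) =
     super_const ((-1) ^ fcard I) * (tvar j * super_deriv (super_monom \<alpha> I c) v) +
     super_deriv (t_deriv j (super_monom \<alpha> I c)) v"
proof (induction I arbitrary: v rule: fset_min_induct)
  case empty
  have "x_derivs \<alpha> (tvar j * v) = tvar j * x_derivs \<alpha> v" for v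
    by (induction \<alpha> arbitrary: v rule: x_monom_induct)
      (simp_all add: x_derivs_single_add x_deriv_tvar_mult del: One_nat_def)
  thus ?case by (simp add: super_deriv_monom t_deriv_monom fcard_fempty const_left_commute)
next
  case (insert i I)
  let ?\<omega> = "super_monom \<alpha> I c"
  have i: "super_monom \<alpha> (finsert i I) c = tvar i * ?\<omega>"
    using insert.hyps by (simp add: tvar_monom_less)
  have "i |\<notin>| I" using insert.hyps by fastforce
  have minus: "super_deriv \<omega> (f - g) = super_deriv \<omega> f - super_deriv \<omega> g"
    "super_deriv (f - g) \<omega> = super_deriv f \<omega> - super_deriv g \<omega>" for \<omega> f g
    using super_deriv_add_right[of \<omega> "f - g" g] super_deriv_add_left[of "f - g" g \<omega>] by simp_all
  have if_0: "super_deriv ?\<omega> (if i = j then v else 0) = super_deriv (if j = i then ?\<omega> else 0) v" by simp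
  show ?case
    unfolding i super_deriv_tvar t_deriv_tvar_mult minus insert.IH if_0
    by (intro superpoly_eqI) (simp add: fcard_finsert_disjoint[OF \<open>i |\<notin>| I\<close>])
qed

lemma super_deriv_tvar_right:
  assumes "bihomogeneous a b \<omega>"
  shows "super_deriv \<omega> (tvar j * v) = super_const ((-1) ^ nat b) * (tvar j * super_deriv \<omega> v) +
     super_deriv (t_deriv j \<omega>) v"
proof -
  let ?M = "\<lambda>p. super_monom (fst p) (snd p) (scoeff \<omega> p)"
  have b: "fcard (snd p) = nat b" if "p \<in> supp \<omega>" for p
    using assms[unfolded bihomogeneous_iff, rule_format, of "fst p" "snd p"] that
    by (auto simp: in_supp_iff)
  have "super_deriv (\<Sum>p\<in>supp \<omega>. ?M p) (tvar j * v) =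
      super_const ((-1) ^ nat b) * (tvar j * super_deriv (\<Sum>p\<in>supp \<omega>. ?M p) v) +
      super_deriv (t_deriv j (\<Sum>p\<in>supp \<omega>. ?M p)) v"
    unfolding super_deriv_sum_left t_deriv_sum sum_distrib_left sum.distrib[symmetric]
    by (intro sum.cong refl) (simp add: super_deriv_monom_tvar b)
  thus ?thesis by (simp flip: superpoly_expand)
qed

lemma annihilated_t_deriv:
  assumes "annihilated m n v"
  shows "annihilated m n (t_deriv j v)"
  unfolding annihilated_def
proof (intro allI impI)
  fix \<omega> assume \<omega>: "invariant m n \<omega>"
  then obtain a b where "bihomogeneous a b \<omega>" by (auto simp: invariant_def)
  from super_deriv_t_deriv[OF this, of j v] assms \<omega>
  show "super_deriv \<omega> (t_deriv j v) = 0" by (simp add: annihilated_def)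
qed

text \<open>
  This is the interior product of \<open>\<omega>\<close> with the invariant vector field \<open>\<Sum>\<^sub>j x\<^sub>j\<^sup>m\<^sup>l\<^sup>+\<^sup>1 \<partial>\<^bsub>x\<^sub>j\<^esub>\<close>.  The total
  degree does not drop, as at least one \<open>x\<^sub>j\<close> replaces the lost \<open>\<theta>\<^sub>j\<close>.
\<close>

lemma invariant_contract:
  assumes "invariant m n \<omega>"
  shows "invariant m n (\<Sum>j<n. xvar j ^ (m * l + 1) * t_deriv j \<omega>)"
proof -
  from assms obtain a b where \<omega>: "\<omega> \<in> superpolys UNIV n" and ab: "bihomogeneous a b \<omega>" "a + b > 0"
    and inv: "\<And>\<sigma>. \<sigma> \<in> monomial_group m n \<Longrightarrow> mat_act \<sigma> \<omega> = \<omega>" by (auto simp: invariant_def)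
  let ?\<omega> = "\<Sum>j<n. xvar j ^ (m * l + 1) * t_deriv j \<omega>"
  have "?\<omega> \<in> superpolys UNIV n"
    using \<omega> by (intro superpolys_sum superpolys_times superpolys_power superpolys_xvar superpolys_t_deriv) auto
  moreover have "bihomogeneous (a + int (m * l + 1)) (b - 1) ?\<omega>"
    by (intro bihomogeneous_sum bihomogeneous_xvar_power bihomogeneous_t_deriv ab)
  moreover have "a + int (m * l + 1) + (b - 1) > 0" using ab(2) by linarith
  moreover have "mat_act \<sigma> ?\<omega> = ?\<omega>" if \<sigma>: "\<sigma> \<in> monomial_group m n" for \<sigma>
  proof -
    from \<sigma> obtain \<pi> c where \<pi>: "\<pi> permutes {..<n}" and c: "\<forall>j<n. c j ^ m = 1"
      and eq: "\<sigma> = monomial_mat n \<pi> c" by (rule monomial_group_cases)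
    have "mat_act \<sigma> (xvar j ^ (m * l + 1) * t_deriv j \<omega>) =
        xvar (\<pi> j) ^ (m * l + 1) * t_deriv (\<pi> j) \<omega>" if j: "j < n" for j
    proof -
      have "c j ^ (m * l + 1) = c j" using c j by (simp add: power_add power_mult)
      hence "mat_act \<sigma> (xvar j ^ (m * l + 1) * t_deriv j \<omega>) =
          xvar (\<pi> j) ^ (m * l + 1) * (super_const (c j) * mat_act \<sigma> (t_deriv j \<omega>))"
        unfolding eq mat_act_monomial_mat_power[OF \<pi> j] by (simp only: const_left_commute)
      also have "super_const (c j) * mat_act \<sigma> (t_deriv j \<omega>) = t_deriv (\<pi> j) \<omega>"
        using t_deriv_mat_act[OF \<pi> \<omega> j, of c] inv[OF \<sigma>] by (simp add: eq)
      finally show ?thesis .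
    qed
    thus ?thesis unfolding mat_act_sum
      using sum.permute[OF \<pi>, of "\<lambda>j. xvar j ^ (m * l + 1) * t_deriv j \<omega>"] by (simp add: comp_def)
  qed
  ultimately show ?thesis unfolding invariant_def by blast
qed

lemma super_deriv_x_deriv_power:
  "super_deriv \<omega> ((x_deriv j ^^ e) v) = (x_deriv j ^^ e) (super_deriv \<omega> v)"
  by (induction e) (simp_all add: super_deriv_x_deriv)

text \<open>
  Moving \<open>\<partial>\<^sub>\<omega>\<close> past \<open>\<theta>\<^sub>j\<close> produces \<open>\<partial>\<^sub>\<omega>\<close> again and a contraction; the sum over \<open>j\<close> of the contractions is
  the operator of the invariant in \<open>invariant_contract\<close>.
\<close>

lemma annihilated_theta_op:
  assumes v: "annihilated m n v"
  shows "annihilated m n (theta_op m n l v)"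
  unfolding annihilated_def
proof (intro allI impI)
  fix \<omega> assume \<omega>: "invariant m n \<omega>"
  then obtain a b where ab: "bihomogeneous a b \<omega>" by (auto simp: invariant_def)
  have 0: "super_deriv \<omega> v = 0" using v \<omega> by (simp add: annihilated_def)
  have "super_deriv \<omega> (theta_op m n l v) =
      (\<Sum>j<n. (x_deriv j ^^ (m * l + 1)) (super_deriv (t_deriv j \<omega>) v))"
    unfolding theta_op_def super_deriv_sum_right super_deriv_x_deriv_power super_deriv_tvar_right[OF ab]
    by (simp add: 0)
  also have "\<dots> = super_deriv (\<Sum>j<n. xvar j ^ (m * l + 1) * t_deriv j \<omega>) v"
    unfolding super_deriv_sum_left super_deriv_xvar_power super_deriv_x_deriv_power ..
  also have "\<dots> = 0" using v invariant_contract[OF \<omega>] by (simp add: annihilated_def)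
  finally show "super_deriv \<omega> (theta_op m n l v) = 0" .
qed

lemma annihilated_super_deriv: "annihilated m n v \<Longrightarrow> annihilated m n (super_deriv f v)"
proof (induction f arbitrary: v rule: superpoly_induct_all)
  case (x j f) thus ?case by (simp add: super_deriv_xvar annihilated_x_deriv)
next
  case (t j f) thus ?case by (simp add: super_deriv_tvar annihilated_t_deriv)
qed (simp_all add: super_deriv_const_left super_deriv_add_left annihilated_add annihilated_const)

text \<open>
  The \<open>\<omega>\<close> with \<open>\<partial>\<^sub>\<omega> w = 0\<close> for every annihilated \<open>w\<close> form a two-sided ideal: right multiples are clear,
  and left multiples by \<open>f\<close> are because \<open>\<partial>\<^sub>f w\<close> is annihilated again.
\<close>

lemma annihilated_ideal:
  assumes K: "subfield K (ring_of_type_algebra :: complex ring)" and v: "annihilated m n v"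
    and \<omega>: "\<omega> \<in> super_invariant_ideal K n (monomial_group m n)"
  shows "super_deriv \<omega> v = 0"
proof -
  note sub = subring_set_subfield[OF K]
  interpret R: ring "super_ring K n" by (rule ring_super_ring[OF K])
  define Z where "Z = {\<omega> \<in> superpolys K n. \<forall>w. annihilated m n w \<longrightarrow> super_deriv \<omega> w = 0}"
  have minus: "- f \<in> superpolys K n" if "f \<in> superpolys K n" for f
    using that sub by (simp add: superpolys_iff_scoeff[OF sub] subring_set_def)
  have "ideal Z (super_ring K n)"
  proof (rule idealI)
    show "ring (super_ring K n)" by (rule R.ring_axioms)
    show "subgroup Z (add_monoid (super_ring K n))"
    proof (rule subgroup.intro)
      show "Z \<subseteq> carrier (add_monoid (super_ring K n))" by (auto simp: Z_def super_ring_def)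
      show "\<one>\<^bsub>add_monoid (super_ring K n)\<^esub> \<in> Z" by (simp add: Z_def super_ring_def)
      show "f \<otimes>\<^bsub>add_monoid (super_ring K n)\<^esub> g \<in> Z" if "f \<in> Z" "g \<in> Z" for f g
        using that superpolys_add[OF sub] by (auto simp: Z_def super_ring_def super_deriv_add_left)
      show "inv\<^bsub>add_monoid (super_ring K n)\<^esub> f \<in> Z" if "f \<in> Z" for f
      proof -
        have "\<ominus>\<^bsub>super_ring K n\<^esub> f = - f"
          using that minus by (intro R.minus_equality) (auto simp: Z_def super_ring_def)
        thus ?thesis using that minus
          by (simp add: a_inv_def Z_def super_deriv_uminus_left)
      qed
    qed
  next
    fix f g assume fg: "f \<in> Z" "g \<in> carrier (super_ring K n)"
    thus "g \<otimes>\<^bsub>super_ring K n\<^esub> f \<in> Z" "f \<otimes>\<^bsub>super_ring K n\<^esub> g \<in> Z"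
      using superpolys_times[OF sub]
      by (auto simp: Z_def super_ring_def super_deriv_mult annihilated_super_deriv)
  qed
  moreover have "{f \<in> superpolys K n. (\<exists>i k. bihomogeneous i k f \<and> i + k > 0) \<and>
      (\<forall>\<sigma>\<in>monomial_group m n. mat_act \<sigma> f = f)} \<subseteq> Z" (is "?G \<subseteq> Z")
  proof
    fix f assume f: "f \<in> ?G"
    hence "invariant m n f" unfolding invariant_def using superpolys_mono_UNIV by blast
    with f show "f \<in> Z" by (simp add: Z_def annihilated_def)
  qed
  ultimately have "super_invariant_ideal K n (monomial_group m n) \<subseteq> Z"
    unfolding super_invariant_ideal_def by (rule R.genideal_minimal)
  with \<omega> v show ?thesis by (auto simp: Z_def)
qed

section \<open>The alternant\<close>

definition staircase :: "nat \<Rightarrow> nat \<Rightarrow> (nat \<Rightarrow> nat) \<Rightarrow> nat \<Rightarrow>\<^sub>0 nat" where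
  "staircase m n p = (\<Sum>j<n. single j (m - 1 + m * p j))"

text \<open>
  The product of \<open>\<Prod>\<^sub>j x\<^sub>j\<^sup>m\<^sup>-\<^sup>1\<close> with the Vandermonde determinant of the \<open>x\<^sub>j\<^sup>m\<close>.
\<close>

definition alternant :: "nat \<Rightarrow> nat \<Rightarrow> superpoly" where
  "alternant m n = (\<Sum>p | p permutes {..<n}. super_monom (staircase m n p) {||} (of_int (sign p)))"

definition top_degree :: "nat \<Rightarrow> nat \<Rightarrow> nat" where
  "top_degree m n = (\<Sum>j<n. m - 1 + m * j)"

lemma lookup_sum_single:
  assumes "finite S"
  shows "lookup (\<Sum>j\<in>S. single j (e j)) i = (if i \<in> S then e i else (0 :: nat))"
  using assms by (simp add: lookup_sum lookup_single when_def)

lemma lookup_staircase: "lookup (staircase m n p) i = (if i < n then m - 1 + m * p i else 0)"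
  unfolding staircase_def by (subst lookup_sum_single) auto

lemma keys_staircase: "keys (staircase m n p) \<subseteq> {..<n}"
  by (auto simp: in_keys_iff lookup_staircase split: if_splits)

lemma xdeg_sum_lookup: "keys \<alpha> \<subseteq> {..<n} \<Longrightarrow> xdeg \<alpha> = (\<Sum>j<n. lookup \<alpha> j)"
  unfolding xdeg_def by (rule sum.mono_neutral_left) (auto simp: in_keys_iff)

lemma xdeg_staircase:
  assumes "p permutes {..<n}"
  shows "xdeg (staircase m n p) = top_degree m n"
proof -
  have "xdeg (staircase m n p) = (\<Sum>j<n. m - 1 + m * p j)"
    unfolding xdeg_sum_lookup[OF keys_staircase] by (simp add: lookup_staircase)
  also have "\<dots> = top_degree m n"
    unfolding top_degree_def using sum.permute[OF assms, of "\<lambda>j. m - 1 + m * j"] by (simp add: comp_def)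
  finally show ?thesis .
qed

lemma bihomogeneous_alternant: "bihomogeneous (int (top_degree m n)) 0 (alternant m n)"
  unfolding alternant_def
proof (rule bihomogeneous_sum)
  fix p assume "p \<in> {p. p permutes {..<n}}"
  thus "bihomogeneous (int (top_degree m n)) 0 (super_monom (staircase m n p) {||} (of_int (sign p)))"
    using bihomogeneous_monom[of "staircase m n p" "{||}"] by (simp add: xdeg_staircase fcard_fempty)
qed

lemma of_int_in_subring: "subring_set K \<Longrightarrow> of_int z \<in> K"
  by (cases z rule: int_cases2) (auto simp: subring_set_def of_nat_in_subring)

lemma alternant_in_superpolys: "subring_set K \<Longrightarrow> alternant m n \<in> superpolys K n"
  unfolding alternant_def
proof (intro superpolys_sum)
  fix p assume K: "subring_set K"
  thus "super_monom (staircase m n p) {||} (of_int (sign p)) \<in> superpolys K n"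
    using keys_staircase[of m n p] of_int_in_subring[OF K, of "sign p"]
    by (auto simp: superpolys_iff_scoeff[OF K] scoeff_monom subring_set_def)
qed

lemma mat_act_alternant:
  assumes "\<pi> permutes {..<n}"
  shows "mat_act (monomial_mat n \<pi> c) (alternant m n) =
    (\<Sum>p | p permutes {..<n}. super_monom (\<Sum>j<n. single (\<pi> j) (m - 1 + m * p j)) {||}
      ((\<Prod>j<n. c j ^ (m - 1 + m * p j)) * of_int (sign p)))"
  unfolding alternant_def staircase_def mat_act_sum
  by (intro sum.cong refl mat_act_power_monom[OF assms]) auto

lemma diagonal_alternant:
  assumes "\<zeta> ^ m = 1" "a < n"
  shows "mat_act (monomial_mat n id (\<lambda>j. if j = a then \<zeta> else 1)) (alternant m n) =
    super_const (\<zeta> ^ (m - 1)) * alternant m n"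
proof -
  have "(\<Prod>j<n. (if j = a then \<zeta> else 1) ^ (m - 1 + m * p j)) = \<zeta> ^ (m - 1)" for p
  proof -
    have "(\<Prod>j<n. (if j = a then \<zeta> else 1) ^ (m - 1 + m * p j)) =
        (\<Prod>j<n. if j = a then \<zeta> ^ (m - 1 + m * p j) else 1)" by (intro prod.cong) auto
    also have "\<dots> = \<zeta> ^ (m - 1 + m * p a)" using assms(2) by (simp add: prod.delta)
    also have "\<dots> = \<zeta> ^ (m - 1)" using assms(1) by (simp add: power_add power_mult)
    finally show ?thesis .
  qed
  thus ?thesis
    unfolding mat_act_alternant[OF permutes_id]
    by (simp add: alternant_def staircase_def sum_distrib_left const_mult_monom)
qed

lemma transposition_alternant:
  assumes "a < n" "b < n" "a \<noteq> b"
  shows "mat_act (monomial_mat n (transpose a b) (\<lambda>_. 1)) (alternant m n) = - alternant m n"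
proof -
  let ?\<tau> = "transpose a b"
  have \<tau>: "?\<tau> permutes {..<n}" using assms by (intro permutes_swap_id) auto
  have st: "(\<Sum>j<n. single (?\<tau> j) (m - 1 + m * p j)) = staircase m n (p \<circ> ?\<tau>)" for p
    unfolding staircase_def
    using sum.permute[OF \<tau>, of "\<lambda>j. single (?\<tau> j) (m - 1 + m * p j)"]
    by (simp add: comp_def)
  have "mat_act (monomial_mat n ?\<tau> (\<lambda>_. 1)) (alternant m n) =
      (\<Sum>p | p permutes {..<n}. super_monom (staircase m n (p \<circ> ?\<tau>)) {||} (of_int (sign p)))"
    unfolding mat_act_alternant[OF \<tau>] st by simp
  also have "\<dots> = (\<Sum>p | p permutes {..<n}. - super_monom (staircase m n (p \<circ> ?\<tau>)) {||} (of_int (sign (p \<circ> ?\<tau>))))"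
  proof (intro sum.cong refl)
    fix p assume "p \<in> {p. p permutes {..<n}}"
    hence "permutation p" by (auto simp: permutation_permutes)
    hence "sign (p \<circ> ?\<tau>) = - sign p"
      using assms by (simp add: sign_compose permutation_swap_id sign_swap_id)
    thus "super_monom (staircase m n (p \<circ> ?\<tau>)) {||} (of_int (sign p)) =
        - super_monom (staircase m n (p \<circ> ?\<tau>)) {||} (of_int (sign (p \<circ> ?\<tau>)))"
      by (simp add: super_monom_uminus)
  qed
  also have "\<dots> = - alternant m n"
    unfolding sum_negf alternant_def
    using sum_permutations_compose_right[OF \<tau>, of "\<lambda>q. super_monom (staircase m n q) {||} (of_int (sign q))"]
    by simp
  finally show ?thesis .
qed

lemma sum_distinct_ge: "finite S \<Longrightarrow> (\<Sum>j<card S. j) \<le> \<Sum>(S :: nat set)"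
proof (induction "card S" arbitrary: S)
  case (Suc k)
  let ?M = "Max S"
  have M: "?M \<in> S" using Suc by (intro Max_in) auto
  have "S \<subseteq> {..?M}" using Suc by auto
  hence "card S \<le> ?M + 1" using card_mono[of "{..?M}" S] by simp
  hence k: "k \<le> ?M" using Suc(2) by simp
  have "card (S - {?M}) = k" using M Suc by simp
  hence "(\<Sum>j<k. j) \<le> \<Sum>(S - {?M})" using Suc(1)[of "S - {?M}"] Suc(3) by simp
  thus ?case using k M Suc(3) by (simp add: Suc(2)[symmetric] sum.remove[of _ ?M])
qed simp

lemma root_of_unity_order:
  assumes "m > 0"
  obtains \<zeta> :: complex where "\<zeta> ^ m = 1" "\<And>k. \<zeta> ^ k = 1 \<Longrightarrow> m dvd k"
proof
  let ?\<zeta> = "cis (2 * pi / real m)"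
  have pow: "?\<zeta> ^ k = cis (2 * pi * real k / real m)" for k
    by (simp add: DeMoivre mult_ac)
  show 1: "?\<zeta> ^ m = 1" unfolding pow using assms by simp
  fix k assume k: "?\<zeta> ^ k = 1"
  have "?\<zeta> ^ k = ?\<zeta> ^ (m * (k div m) + k mod m)" by simp
  hence "?\<zeta> ^ (k mod m) = ?\<zeta> ^ 0"
    using k 1 by (simp only: power_add power_mult power_one mult_1_left power_0)
  hence eq: "cis (2 * pi * real (k mod m) / real m) = cis (2 * pi * real 0 / real m)"
    unfolding pow .
  have "inj_on (\<lambda>k. cis (2 * pi * real k / real m)) {..<m}"
    using bij_betw_roots_unity[OF assms] by (rule bij_betw_imp_inj_on)
  from inj_onD[OF this eq] have "k mod m = 0" using assms by simp
  thus "m dvd k" by (rule mod_0_imp_dvd)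
qed

lemma root_of_unity_unit:
  assumes "c ^ m = 1" "m > 0"
  shows "cnj c * c = 1"
proof -
  have "cmod c ^ m = 1 ^ m" using arg_cong[OF assms(1), of cmod] by (simp add: norm_power)
  hence "cmod c = 1" by (rule power_eq_imp_eq_base) (use assms in auto)
  thus ?thesis using complex_norm_square[of c] by (simp add: mult.commute)
qed

lemma superpolys_super_deriv: "v \<in> superpolys UNIV n \<Longrightarrow> super_deriv f v \<in> superpolys UNIV n"
proof (induction f arbitrary: v rule: superpoly_induct_all)
  case (const c f)
  thus ?case unfolding super_deriv_const_left by (intro superpolys_times superpolys_const) auto
next
  case (x j f)
  thus ?case unfolding super_deriv_xvar by (simp add: superpolys_x_deriv)
next
  case (t j f)
  thus ?case unfolding super_deriv_tvar by (simp add: superpolys_t_deriv)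
qed (simp_all add: super_deriv_add_left superpolys_add)

text \<open>
  \<open>\<partial>\<^sub>\<omega> \<Delta>\<close> transforms under diagonal matrices and transpositions in the same way as \<open>\<Delta>\<close>.  Hence the
  exponents of its monomials are congruent to \<open>-1\<close> modulo \<open>m\<close> and distinct, and \<open>\<Delta>\<close> has the least
  degree among such polynomials.
\<close>

lemma annihilated_alternant:
  assumes m: "m > 0"
  shows "annihilated m n (alternant m n)"
  unfolding annihilated_def
proof (intro allI impI, rule ccontr)
  fix \<omega> assume \<omega>: "invariant m n \<omega>" and nz: "super_deriv \<omega> (alternant m n) \<noteq> 0"
  define u where "u = super_deriv \<omega> (alternant m n)"
  from \<omega> obtain a b where \<omega>_in: "\<omega> \<in> superpolys UNIV n" and ab: "bihomogeneous a b \<omega>" "a + b > 0"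
    and inv: "\<And>\<sigma>. \<sigma> \<in> monomial_group m n \<Longrightarrow> mat_act \<sigma> \<omega> = \<omega>" by (auto simp: invariant_def)
  have \<Delta>: "alternant m n \<in> superpolys UNIV n" by (rule alternant_in_superpolys) simp
  have u_in: "u \<in> superpolys UNIV n"
    unfolding u_def by (rule superpolys_super_deriv[OF \<Delta>])
  have bi: "bihomogeneous (int (top_degree m n) - a) (0 - b) u"
    unfolding u_def by (rule bihomogeneous_super_deriv[OF ab(1) bihomogeneous_alternant])
  have "\<omega> \<noteq> 0" using nz by auto
  hence b: "b = 0"
    using bihomogeneous_degree_nonneg[OF bi] bihomogeneous_degree_nonneg[OF ab(1)] nz by (simp add: u_def)
  have semi: "mat_act (monomial_mat n \<pi> c) u = super_const \<chi> * u"
    if "\<pi> permutes {..<n}" "\<And>j. j < n \<Longrightarrow> c j ^ m = 1"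
      "mat_act (monomial_mat n \<pi> c) (alternant m n) = super_const \<chi> * alternant m n" for \<pi> c \<chi>
  proof -
    note root = that(2)
    have unit: "cnj (c j) * c j = 1" if "j < n" for j
      using root[OF that] m by (rule root_of_unity_unit)
    have "mat_act (monomial_mat n \<pi> c) u =
        super_deriv (mat_act (monomial_mat n \<pi> c) \<omega>) (mat_act (monomial_mat n \<pi> c) (alternant m n))"
      unfolding u_def using super_deriv_mat_act[OF that(1) unit \<omega>_in \<Delta>] by simp
    thus ?thesis
      using inv[OF monomial_mat_in_group[OF that(1,2) m]] that(3)
      by (simp add: u_def super_deriv_const_right)
  qed
  obtain p where "scoeff u p \<noteq> 0" using nz superpoly_eqI[of u 0] by (auto simp: u_def)
  then obtain \<beta> I where \<beta>I: "scoeff u (\<beta>, I) \<noteq> 0" by (cases p) auto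
  with bi b have "I = {||}" and deg: "int (xdeg \<beta>) = int (top_degree m n) - a"
    unfolding bihomogeneous_iff by (force, force)
  with \<beta>I have \<beta>: "scoeff u (\<beta>, {||}) \<noteq> 0" by simp
  have keys: "keys \<beta> \<subseteq> {..<n}"
    using u_in \<beta> by (auto simp: superpolys_iff_scoeff)
  \<comment> \<open>Reflections \<open>diag(1, \<dots>, \<zeta>, \<dots>, 1)\<close> force every exponent to be \<open>-1\<close> modulo \<open>m\<close>,
    transpositions force the exponents to be distinct; so the degree is at least that of the
    alternant.\<close>
  obtain \<zeta> :: complex where \<zeta>: "\<zeta> ^ m = 1" "\<And>k. \<zeta> ^ k = 1 \<Longrightarrow> m dvd k"
    using root_of_unity_order[OF m] by blast
  have dvd: "m dvd lookup \<beta> j + 1" if j: "j < n" for j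
  proof -
    let ?c = "\<lambda>i. if i = j then \<zeta> else 1"
    have "mat_act (monomial_mat n id ?c) u = super_const (\<zeta> ^ (m - 1)) * u"
      by (rule semi[OF permutes_id]) (use \<zeta> diagonal_alternant[OF \<zeta>(1) j] in auto)
    hence "scoeff (mat_act (monomial_mat n id ?c) u) (\<beta>, {||}) = \<zeta> ^ (m - 1) * scoeff u (\<beta>, {||})" by simp
    moreover have "(\<Prod>i<n. ?c i ^ lookup \<beta> (id i)) = \<zeta> ^ lookup \<beta> j"
    proof -
      have "(\<Prod>i<n. ?c i ^ lookup \<beta> (id i)) =
          (\<Prod>i<n. if i = j then \<zeta> ^ lookup \<beta> i else 1)" by (intro prod.cong) auto
      thus ?thesis using j by simp
    qed
    ultimately have "\<zeta> ^ lookup \<beta> j = \<zeta> ^ (m - 1)"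
      using scoeff_mat_act[OF permutes_id u_in, of ?c \<beta>] \<beta> by (simp add: id_def map_key_id)
    hence "\<zeta> ^ (lookup \<beta> j + 1) = \<zeta> ^ (m - 1) * \<zeta>" by simp
    also have "\<dots> = \<zeta> ^ m" using m by (rule power_minus_mult)
    finally show ?thesis using \<zeta> by simp
  qed
  have inj: "inj_on (lookup \<beta>) {..<n}"
  proof (rule inj_onI, rule ccontr)
    fix i j assume ij: "i \<in> {..<n}" "j \<in> {..<n}" "lookup \<beta> i = lookup \<beta> j" "i \<noteq> j"
    let ?\<tau> = "transpose i j"
    have \<tau>: "?\<tau> permutes {..<n}" using ij by (intro permutes_swap_id) auto
    have "mat_act (monomial_mat n ?\<tau> (\<lambda>_. 1)) u = super_const (-1) * u"
    proof (rule semi[OF \<tau>])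
      show "mat_act (monomial_mat n ?\<tau> (\<lambda>_. 1)) (alternant m n) = super_const (-1) * alternant m n"
        using ij transposition_alternant[of i n j m] by (intro superpoly_eqI) simp
    qed simp
    moreover have "map_key ?\<tau> \<beta> = \<beta>"
      using ij by (intro poly_mapping_eqI) (auto simp: lookup_map_key transpose_def)
    ultimately have "scoeff u (\<beta>, {||}) = - scoeff u (\<beta>, {||})"
      using scoeff_mat_act[OF \<tau> u_in, of "\<lambda>_. 1" \<beta>] by simp
    with \<beta> show False by simp
  qed
  define b' where "b' j = (lookup \<beta> j + 1) div m - 1" for j
  have \<beta>_eq: "lookup \<beta> j = m - 1 + m * b' j" if j: "j < n" for j
  proof -
    obtain q where q: "lookup \<beta> j + 1 = m * q" using dvd[OF j] by auto
    hence "q > 0" by (cases q) auto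
    then obtain q' where q': "q = Suc q'" by (cases q) auto
    have "b' j = q'" using q q' m by (simp add: b'_def)
    thus ?thesis using q q' m by simp
  qed
  have "inj_on b' {..<n}"
    using inj \<beta>_eq by (auto simp: inj_on_def)
  hence "(\<Sum>j<n. j) \<le> (\<Sum>j<n. b' j)"
    using sum_distinct_ge[of "b' ` {..<n}"] by (simp add: card_image sum.reindex)
  hence "top_degree m n \<le> (\<Sum>j<n. m - 1 + m * b' j)"
    unfolding top_degree_def sum.distrib sum_distrib_left[symmetric] by simp
  also have "\<dots> = xdeg \<beta>" unfolding xdeg_sum_lookup[OF keys] using \<beta>_eq by simp
  finally show False using deg ab(2) b by simp
qed

section \<open>Nonvanishing of the top harmonic elements\<close>

lemma sum_lessThan_choose: "(\<Sum>j<n. j) = n choose 2"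
  by (induction n) (simp_all add: numeral_2_eq_2)

lemma top_degree_eq:
  assumes "m > 0"
  shows "int (top_degree m n) = int m * int (n choose 2) + (int m - 1) * int n"
proof -
  have "top_degree m n = n * (m - 1) + m * (n choose 2)"
    unfolding top_degree_def sum.distrib sum_distrib_left[symmetric] sum_lessThan_choose by simp
  thus ?thesis using assms by (cases m) (simp_all add: algebra_simps)
qed

abbreviation const_coeff :: "superpoly \<Rightarrow> complex" where
  "const_coeff f \<equiv> scoeff f (0, {||})"

text \<open>
  Up to the nonzero factor \<open>\<gamma>!\<close> this is the coefficient of \<open>x\<^sup>\<gamma>\<close> in \<open>\<Delta>\<close>; only the derivatives and their
  antisymmetry in \<open>\<gamma>\<close> enter.
\<close>

definition alternant_value :: "nat \<Rightarrow> nat \<Rightarrow> (nat \<Rightarrow>\<^sub>0 nat) \<Rightarrow> complex" where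
  "alternant_value m n \<gamma> = const_coeff (x_derivs \<gamma> (alternant m n))"

lemma superpolys_x_derivs: "v \<in> superpolys UNIV n \<Longrightarrow> x_derivs \<gamma> v \<in> superpolys UNIV n"
  using superpolys_super_deriv[of v n "super_monom \<gamma> {||} 1"] by (simp add: super_deriv_monom)

lemma alternant_value_transpose:
  assumes "a < n" "b < n" "a \<noteq> b" "keys \<gamma> \<subseteq> {..<n}"
  shows "alternant_value m n (map_key (transpose a b) \<gamma>) = - alternant_value m n \<gamma>"
proof -
  let ?\<tau> = "transpose a b" and ?\<Delta> = "alternant m n"
  have \<tau>: "?\<tau> permutes {..<n}" using assms by (intro permutes_swap_id) auto
  have \<Delta>: "?\<Delta> \<in> superpolys UNIV n" by (rule alternant_in_superpolys) simp
  let ?v = "x_derivs (map_key ?\<tau> \<gamma>) ?\<Delta>"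
  have "const_coeff (mat_act (monomial_mat n ?\<tau> (\<lambda>_. 1)) ?v) = const_coeff ?v"
    using scoeff_mat_act[OF \<tau>, of ?v "\<lambda>_. 1" 0] superpolys_x_derivs[OF \<Delta>] by simp
  also have "mat_act (monomial_mat n ?\<tau> (\<lambda>_. 1)) ?v = x_derivs \<gamma> (mat_act (monomial_mat n ?\<tau> (\<lambda>_. 1)) ?\<Delta>)"
    using x_derivs_mat_act[OF \<tau> _ assms(4) \<Delta>, of "\<lambda>_. 1"] by simp
  also have "\<dots> = x_derivs \<gamma> (super_const (-1) * ?\<Delta>)"
    unfolding transposition_alternant[OF assms(1-3)]
    by (intro arg_cong[where f = "x_derivs \<gamma>"] superpoly_eqI) simp
  also have "const_coeff \<dots> = - const_coeff (x_derivs \<gamma> ?\<Delta>)" unfolding x_derivs_linear by simp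
  finally show ?thesis by (simp add: alternant_value_def)
qed

text \<open>
  The exponent vector of \<open>\<Prod>\<^sub>q \<partial>\<^sub>x\<^sup>m\<^sup>l\<^sup>+\<^sup>1\<close>, where \<open>l\<close> is the \<open>q\<close>-th entry of the first list and \<open>x\<close> the
  variable with the \<open>q\<close>-th index of the second.
\<close>

fun assigned :: "nat \<Rightarrow> nat list \<Rightarrow> nat list \<Rightarrow> nat \<Rightarrow>\<^sub>0 nat" where
  "assigned m (l # ls) (i # js) = single i (m * l + 1) + assigned m ls js"
| "assigned m _ _ = 0"

lemma lookup_assigned_notin: "i \<notin> set js \<Longrightarrow> lookup (assigned m ls js) i = 0"
  by (induction m ls js rule: assigned.induct) (auto simp: lookup_add lookup_single)

lemma lookup_assigned_nth:
  "distinct js \<Longrightarrow> length ls = length js \<Longrightarrow> q < length js \<Longrightarrow>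
    lookup (assigned m ls js) (js ! q) = m * ls ! q + 1"
proof (induction m ls js arbitrary: q rule: assigned.induct)
  case (1 m l ls i js)
  show ?case
  proof (cases q)
    case 0
    thus ?thesis using 1 by (simp add: lookup_add lookup_assigned_notin)
  next
    case (Suc q')
    hence "js ! q' \<noteq> i" using 1 by (auto simp: in_set_conv_nth)
    thus ?thesis using 1 Suc by (simp add: lookup_add lookup_single)
  qed
qed simp_all

lemma keys_assigned: "keys (assigned m ls js) \<subseteq> set js"
  using lookup_assigned_notin[of _ js m ls] by (metis in_keys_iff subsetI)

text \<open>
  Moving an entry to the front takes \<open>p\<close> adjacent transpositions.  Each is a transposition of
  variables, since \<open>\<kappa>\<close> is constant on the indices involved, and changes the sign.
\<close>

lemma alternant_value_move_front:
  assumes "distinct js" "set js \<subseteq> {..<n}" "length ls = length js" "p < length ls"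
    and "\<And>i. i \<in> set js \<Longrightarrow> lookup \<kappa> i = e" "keys \<kappa> \<subseteq> {..<n}"
  shows "alternant_value m n (\<kappa> + assigned m (ls ! p # take p ls @ drop (Suc p) ls) js) =
    (-1) ^ p * alternant_value m n (\<kappa> + assigned m ls js)"
  using assms
proof (induction p arbitrary: ls js \<kappa>)
  case 0
  thus ?case by (cases ls) auto
next
  case (Suc p)
  from Suc.prems(3,4) obtain l ls' where ls: "ls = l # ls'" "p < length ls'" by (cases ls) auto
  obtain i js' where js: "js = i # js'" using Suc.prems(3) ls by (cases js) auto
  obtain i' js'' where js': "js' = i' # js''" using Suc.prems(3) ls js by (cases js') auto
  define q where "q = ls' ! p"
  define R where "R = take p ls' @ drop (Suc p) ls'"
  have ii: "i < n" "i' < n" "i \<noteq> i'" "i \<notin> set js''" "i' \<notin> set js''"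
    using Suc.prems(1,2) js js' by auto
  let ?\<gamma> = "\<kappa> + assigned m (l # q # R) js"
  have "map_key (transpose i i') ?\<gamma> = \<kappa> + assigned m (q # l # R) js"
  proof (rule poly_mapping_eqI)
    fix x
    have "lookup \<kappa> i = lookup \<kappa> i'" using Suc.prems(5) js js' by simp
    thus "lookup (map_key (transpose i i') ?\<gamma>) x =
        lookup (\<kappa> + assigned m (q # l # R) js) x"
      using ii lookup_assigned_notin[of i js'' m R] lookup_assigned_notin[of i' js'' m R]
      by (auto simp: js js' lookup_map_key lookup_add lookup_single when_def transpose_def)
  qed
  moreover have "keys ?\<gamma> \<subseteq> {..<n}"
    using keys_add[of \<kappa> "assigned m (l # q # R) js"] keys_assigned[of m "l # q # R" js]
      Suc.prems(2,6) by blast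
  ultimately have "alternant_value m n (\<kappa> + assigned m (q # l # R) js) = - alternant_value m n ?\<gamma>"
    using alternant_value_transpose[OF ii(1-3), of ?\<gamma> m] by simp
  also have "?\<gamma> = (\<kappa> + single i (m * l + 1)) + assigned m (q # R) js'"
    by (simp add: js add.assoc)
  also have "alternant_value m n \<dots> =
      (-1) ^ p * alternant_value m n ((\<kappa> + single i (m * l + 1)) + assigned m ls' js')"
    unfolding q_def R_def
  proof (rule Suc.IH)
    show "lookup (\<kappa> + single i (m * l + 1)) x = e" if "x \<in> set js'" for x
      using that Suc.prems(1,5) js by (auto simp: lookup_add lookup_single when_def)
    show "keys (\<kappa> + single i (m * l + 1)) \<subseteq> {..<n}"
      using keys_add[of \<kappa> "single i (m * l + 1)"] ii Suc.prems(6) by auto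
  qed (use Suc.prems ls js in auto)
  finally show ?case by (simp add: ls js q_def R_def add.assoc)
qed

lemma theta_op_linear:
  "theta_op m n l (v + w) = theta_op m n l v + theta_op m n l w"
  "theta_op m n l (super_const c * v) = super_const c * theta_op m n l v"
  by (simp_all add: theta_op_def distrib_left x_deriv_funpow_add sum.distrib const_left_commute
      x_deriv_power_const sum_distrib_left)

lemma theta_op_sum: "theta_op m n l (sum f A) = (\<Sum>a\<in>A. theta_op m n l (f a))"
proof -
  have "theta_op m n l 0 = 0" using theta_op_linear(1)[of m n l 0 0] by simp
  thus ?thesis by (induction A rule: infinite_finite_induct) (simp_all add: theta_op_linear)
qed

lemma x_deriv_power_commute:
  "(x_deriv i ^^ a) ((x_deriv j ^^ b) v) = (x_deriv j ^^ b) ((x_deriv i ^^ a) v)"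
proof -
  have "x_deriv i ((x_deriv j ^^ b) v) = (x_deriv j ^^ b) (x_deriv i v)" for v
    by (induction b) (simp_all add: x_deriv_commute[of i])
  thus ?thesis by (induction a) simp_all
qed

lemma theta_op_x_deriv_power:
  "theta_op m n l ((x_deriv i ^^ e) v) = (x_deriv i ^^ e) (theta_op m n l v)"
proof -
  have t: "(x_deriv i ^^ e) (tvar j * v) = tvar j * (x_deriv i ^^ e) v" for j
    by (induction e) (simp_all add: x_deriv_tvar_mult)
  have s: "(x_deriv i ^^ e) (sum f A) = (\<Sum>a\<in>A. (x_deriv i ^^ e) (f a))" for f and A :: "nat set"
    by (induction A rule: infinite_finite_induct) (simp_all add: x_deriv_funpow_add)
  show ?thesis
    unfolding theta_op_def s x_deriv_power_commute[where i = i and a = e and b = "m * l + 1"] t ..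
qed

lemma t_deriv_theta_op:
  assumes "i < n"
  shows "t_deriv i (theta_op m n l v) = (x_deriv i ^^ (m * l + 1)) v - theta_op m n l (t_deriv i v)"
proof -
  have diff: "(x_deriv j ^^ e) (f - g) = (x_deriv j ^^ e) f - (x_deriv j ^^ e) g" for j e f g
    using x_deriv_funpow_add[of e j "f - g" g] by (simp add: algebra_simps)
  have if_0: "(x_deriv j ^^ (m * l + 1)) (if i = j then v else 0) =
      (if i = j then (x_deriv j ^^ (m * l + 1)) v else 0)" for j by (simp del: funpow.simps)
  have "t_deriv i (theta_op m n l v) =
      (\<Sum>j<n. if i = j then (x_deriv j ^^ (m * l + 1)) v else 0) - theta_op m n l (t_deriv i v)"
    unfolding theta_op_def t_deriv_sum t_deriv_x_deriv_power t_deriv_tvar_mult diff sum_subtractf if_0 ..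
  thus ?thesis using assms by simp
qed

lemma t_deriv_theta_ops:
  assumes "i < n" "t_deriv i v = 0"
  shows "t_deriv i (foldr (theta_op m n) ls v) = (\<Sum>p<length ls. super_const ((-1) ^ p) *
    (x_deriv i ^^ (m * ls ! p + 1)) (foldr (theta_op m n) (take p ls @ drop (Suc p) ls) v))"
proof (induction ls)
  case (Cons l ls)
  have "(\<Sum>p<length (l # ls). super_const ((-1) ^ p) * (x_deriv i ^^ (m * (l # ls) ! p + 1))
        (foldr (theta_op m n) (take p (l # ls) @ drop (Suc p) (l # ls)) v)) =
      (x_deriv i ^^ (m * l + 1)) (foldr (theta_op m n) ls v) +
      (\<Sum>p<length ls. super_const ((-1) ^ Suc p) * (x_deriv i ^^ (m * ls ! p + 1))
        (theta_op m n l (foldr (theta_op m n) (take p ls @ drop (Suc p) ls) v)))"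
    unfolding length_Cons by (subst sum.lessThan_Suc_shift) (simp del: funpow.simps)
  also have "(\<Sum>p<length ls. super_const ((-1) ^ Suc p) * (x_deriv i ^^ (m * ls ! p + 1))
        (theta_op m n l (foldr (theta_op m n) (take p ls @ drop (Suc p) ls) v))) =
      - theta_op m n l (t_deriv i (foldr (theta_op m n) ls v))"
    unfolding Cons theta_op_sum theta_op_linear theta_op_x_deriv_power sum_negf[symmetric]
    by (intro sum.cong refl superpoly_eqI) simp
  finally show ?case by (simp add: t_deriv_theta_op[OF assms(1)] del: funpow.simps)
qed (simp add: assms)

lemma t_deriv_alternant: "t_deriv i (alternant m n) = 0"
  by (simp add: alternant_def t_deriv_sum t_deriv_monom)

lemma fold_t_deriv_rev: "fold t_deriv js = foldr t_deriv (rev js)"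
  by (simp add: foldr_conv_fold)

lemma fold_t_deriv_const: "fold t_deriv js (super_const c * v) = super_const c * fold t_deriv js v"
  by (induction js arbitrary: v) simp_all

text \<open>
  Expand along the first \<open>\<partial>\<^bsub>\<theta>i\<^esub>\<close>.  The \<open>p\<close>-th term has sign \<open>(-1)\<^sup>p\<close>, and by antisymmetry its value differs
  from the first one by the same sign, so all terms agree and nothing cancels.
\<close>

lemma Laplace_expansion:
  assumes "distinct js" "set js \<subseteq> {..<n}" "length ls = length js"
    and "\<And>i. i \<in> set js \<Longrightarrow> lookup \<kappa> i = e" "keys \<kappa> \<subseteq> {..<n}"
  shows "const_coeff (x_derivs \<kappa> (fold t_deriv js (foldr (theta_op m n) ls (alternant m n)))) =
    fact (length js) * alternant_value m n (\<kappa> + assigned m ls js)"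
  using assms
proof (induction js arbitrary: ls \<kappa>)
  case Nil
  thus ?case by (simp add: alternant_value_def)
next
  case (Cons i js)
  let ?\<Delta> = "alternant m n"
  define D where "D ls = foldr (theta_op m n) ls ?\<Delta>" for ls
  define del where "del p = take p ls @ drop (Suc p) ls" for p
  have i: "i < n" "i \<notin> set js" using Cons.prems by auto
  have xs: "x_derivs \<kappa> (sum f A) = (\<Sum>a\<in>A. x_derivs \<kappa> (f a))" for f and A :: "nat set"
  proof -
    have "x_derivs \<kappa> 0 = 0" using x_derivs_linear(1)[of \<kappa> 0 0] by simp
    thus ?thesis by (induction A rule: infinite_finite_induct) (simp_all add: x_derivs_linear)
  qed
  have ts: "fold t_deriv js (sum f A) = (\<Sum>a\<in>A. fold t_deriv js (f a))" for f and A :: "nat set"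
    unfolding fold_t_deriv_rev t_list_sum ..
  have tx: "fold t_deriv js ((x_deriv i ^^ b) v) = (x_deriv i ^^ b) (fold t_deriv js v)" for b v
    unfolding fold_t_deriv_rev t_list_x_deriv_power ..
  have summand: "const_coeff (x_derivs \<kappa> ((x_deriv i ^^ (m * ls ! p + 1)) (fold t_deriv js (D (del p))))) =
      fact (length js) * ((-1) ^ p * alternant_value m n (\<kappa> + assigned m ls (i # js)))"
    if p: "p < length ls" for p
  proof -
    let ?\<kappa>' = "single i (m * ls ! p + 1) + \<kappa>"
    have "const_coeff (x_derivs ?\<kappa>' (fold t_deriv js (D (del p)))) =
        fact (length js) * alternant_value m n (?\<kappa>' + assigned m (del p) js)"
      unfolding D_def
    proof (rule Cons.IH)
      show "length (del p) = length js" using Cons.prems(3) p by (simp add: del_def)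
      show "lookup ?\<kappa>' x = e" if "x \<in> set js" for x
        using that i Cons.prems(4) by (auto simp: lookup_add lookup_single when_def)
      show "keys ?\<kappa>' \<subseteq> {..<n}"
        using keys_add[of "single i (m * ls ! p + 1)" \<kappa>] i Cons.prems(5) by auto
    qed (use Cons.prems in auto)
    also have "?\<kappa>' + assigned m (del p) js = \<kappa> + assigned m (ls ! p # del p) (i # js)"
      by (simp add: add_ac)
    also have "alternant_value m n \<dots> = (-1) ^ p * alternant_value m n (\<kappa> + assigned m ls (i # js))"
      unfolding del_def by (rule alternant_value_move_front) (use Cons.prems p in auto)
    finally show ?thesis unfolding x_derivs_single .
  qed
  have "const_coeff (x_derivs \<kappa> (fold t_deriv (i # js) (D ls))) =
      (\<Sum>p<length ls. (-1) ^ p *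
        const_coeff (x_derivs \<kappa> ((x_deriv i ^^ (m * ls ! p + 1)) (fold t_deriv js (D (del p))))))"
    unfolding D_def del_def fold_simps t_deriv_theta_ops[OF i(1) t_deriv_alternant] ts
      fold_t_deriv_const tx xs x_derivs_linear scoeff_sum scoeff_const_mult ..
  also have "\<dots> = (\<Sum>p<length ls. fact (length js) * alternant_value m n (\<kappa> + assigned m ls (i # js)))"
  proof (intro sum.cong refl)
    fix p assume "p \<in> {..<length ls}"
    moreover have "(-1 :: complex) ^ p * (-1) ^ p = 1" by (simp flip: power_mult_distrib)
    ultimately show "(-1) ^ p *
        const_coeff (x_derivs \<kappa> ((x_deriv i ^^ (m * ls ! p + 1)) (fold t_deriv js (D (del p))))) =
        fact (length js) * alternant_value m n (\<kappa> + assigned m ls (i # js))"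
      using summand[of p] by (simp del: funpow.simps assigned.simps)
  qed
  also have "\<dots> = fact (length (i # js)) * alternant_value m n (\<kappa> + assigned m ls (i # js))"
    using Cons.prems(3) by (simp del: assigned.simps)
  finally show ?case by (simp only: D_def)
qed

lemma alternant_value_staircase: "m > 0 \<Longrightarrow> alternant_value m n (staircase m n id) \<noteq> 0"
proof -
  assume m: "m > 0"
  have "p = id" if "p permutes {..<n}" "staircase m n p = staircase m n id" for p
  proof
    fix j
    have eq: "lookup (staircase m n p) j = lookup (staircase m n id) j"
      using that(2) by simp
    show "p j = id j"
    proof (cases "j < n")
      case True
      hence "m - 1 + m * p j = m - 1 + m * j" using eq by (simp only: lookup_staircase if_True id_apply)
      hence "m * p j = m * j" by (rule add_left_imp_eq)
      thus ?thesis using m by simp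
    qed (use that(1) in \<open>auto simp: permutes_def\<close>)
  qed
  hence "scoeff (alternant m n) (staircase m n id, {||}) = (\<Sum>p | p permutes {..<n}. if p = id then 1 else 0)"
    unfolding alternant_def scoeff_sum by (intro sum.cong refl) (auto simp: scoeff_monom)
  also have "\<dots> = 1" by (simp add: finite_permutations permutes_id)
  finally have "scoeff (alternant m n) (staircase m n id, {||}) \<noteq> 0" by simp
  moreover obtain c where "c \<noteq> 0" "alternant_value m n (staircase m n id) =
      c * scoeff (alternant m n) (0 + staircase m n id, {||})"
    unfolding alternant_value_def using scoeff_x_derivs by blast
  ultimately show ?thesis by simp
qed

lemma top_harmonic_nonzero:
  assumes k: "k \<le> n" and m: "m * (n - k) + m \<ge> 2"
  shows "foldr (theta_op m n) [0..<k] (alternant m n) \<noteq> 0"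
proof
  assume 0: "foldr (theta_op m n) [0..<k] (alternant m n) = 0"
  \<comment> \<open>Constant on the last \<open>k\<close> variables and such that the total exponent is the one of the diagonal
    term of the alternant.  The lower bound on \<open>m\<close> and \<open>n - k\<close> keeps the subtraction of 2 exact.\<close>
  define \<kappa> where "\<kappa> = (\<Sum>j<n. single j (if j < n - k then m - 1 + m * j else m * (n - k) + m - 2))"
  have l\<kappa>: "lookup \<kappa> j =
      (if j < n then if j < n - k then m - 1 + m * j else m * (n - k) + m - 2 else 0)" for j
    unfolding \<kappa>_def by (subst lookup_sum_single) auto
  have m0: "m > 0" using m by (cases m) auto
  have "\<kappa> + assigned m [0..<k] [n - k..<n] = staircase m n id"
  proof (rule poly_mapping_eqI)
    fix j
    show "lookup (\<kappa> + assigned m [0..<k] [n - k..<n]) j = lookup (staircase m n id) j"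
    proof (cases "n - k \<le> j \<and> j < n")
      case True
      define q where "q = j - (n - k)"
      have q: "q < k" "j = n - k + q" using True k by (auto simp: q_def)
      have "lookup (assigned m [0..<k] [n - k..<n]) ([n - k..<n] ! q) = m * [0..<k] ! q + 1"
        by (rule lookup_assigned_nth) (use q k in auto)
      hence "lookup (assigned m [0..<k] [n - k..<n]) j = m * q + 1" using q k by simp
      moreover have "m * j = m * (n - k) + m * q" using q by (simp add: distrib_left)
      ultimately show ?thesis using True m m0 by (simp add: lookup_add l\<kappa> lookup_staircase)
    next
      case False
      thus ?thesis by (auto simp: lookup_add l\<kappa> lookup_staircase lookup_assigned_notin)
    qed
  qed
  moreover have "const_coeff (x_derivs \<kappa> (fold t_deriv [n - k..<n] (foldr (theta_op m n) [0..<k] (alternant m n)))) =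
      fact (length [n - k..<n]) * alternant_value m n (\<kappa> + assigned m [0..<k] [n - k..<n])"
  proof (rule Laplace_expansion)
    show "lookup \<kappa> i = m * (n - k) + m - 2" if "i \<in> set [n - k..<n]" for i
      using that by (auto simp: l\<kappa>)
    show "keys \<kappa> \<subseteq> {..<n}" by (auto simp: in_keys_iff l\<kappa> split: if_splits)
  qed (use k in auto)
  moreover have "x_derivs \<kappa> (fold t_deriv js 0) = 0" for js
    using x_derivs_linear(1)[of \<kappa> 0 0] by (simp add: fold_t_deriv_rev)
  ultimately show False using alternant_value_staircase[OF m0, of n] by (simp add: 0)
qed

section \<open>The bidegrees of nonzero harmonics\<close>

lemma bihomogeneous_x_deriv_power:
  "bihomogeneous i k f \<Longrightarrow> bihomogeneous (i - int e) k ((x_deriv j ^^ e) f)"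
proof (induction e)
  case (Suc e)
  from bihomogeneous_x_deriv[OF Suc.IH[OF Suc.prems], of j] show ?case by (simp add: algebra_simps)
qed simp

lemma bihomogeneous_theta_op:
  assumes "bihomogeneous i k f"
  shows "bihomogeneous (i - int (m * l + 1)) (k + 1) (theta_op m n l f)"
  unfolding theta_op_def
  by (intro bihomogeneous_sum bihomogeneous_x_deriv_power bihomogeneous_tvar assms)

lemma superpolys_theta_op:
  assumes K: "subring_set K" and f: "f \<in> superpolys K n"
  shows "theta_op m n l f \<in> superpolys K n"
  unfolding theta_op_def
proof (intro superpolys_sum K)
  fix j assume "j \<in> {..<n}"
  moreover have "(x_deriv j ^^ e) g \<in> superpolys K n" if "g \<in> superpolys K n" for e g
    using that by (induction e) (simp_all add: superpolys_x_deriv K)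
  ultimately show "(x_deriv j ^^ (m * l + 1)) (tvar j * f) \<in> superpolys K n"
    using f by (simp add: superpolys_times superpolys_tvar K del: funpow.simps)
qed

lemma top_harmonic:
  fixes k n :: nat
  assumes K: "subring_set K" and m: "m > 0"
  defines "D \<equiv> foldr (theta_op m n) [0..<k] (alternant m n)"
  shows "D \<in> superpolys K n" "annihilated m n D"
    "bihomogeneous (int (top_degree m n) - int k - int m * int (k choose 2)) (int k) D"
proof -
  have "foldr (theta_op m n) ls (alternant m n) \<in> superpolys K n" for ls
    by (induction ls) (simp_all add: alternant_in_superpolys superpolys_theta_op K)
  thus "D \<in> superpolys K n" by (simp add: D_def)
  have "annihilated m n (foldr (theta_op m n) ls (alternant m n))" for ls
    by (induction ls) (simp_all add: annihilated_alternant annihilated_theta_op m)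
  thus "annihilated m n D" by (simp add: D_def)
  have "bihomogeneous (int (top_degree m n) - int (\<Sum>l\<leftarrow>ls. m * l + 1)) (int (length ls))
      (foldr (theta_op m n) ls (alternant m n))" for ls
  proof (induction ls)
    case (Cons l ls)
    from bihomogeneous_theta_op[OF Cons, of m l n] show ?case by (simp add: algebra_simps)
  qed (simp add: bihomogeneous_alternant)
  from this[of "[0..<k]"] have "bihomogeneous (int (top_degree m n) - int (\<Sum>l<k. m * l + 1)) (int k) D"
    by (simp add: D_def interv_sum_list_conv_sum_set_nat atLeast0LessThan)
  also have "(\<Sum>l<k. m * l + 1) = m * (k choose 2) + k"
    by (induction k) (simp_all add: numeral_2_eq_2 algebra_simps)
  finally show "bihomogeneous (int (top_degree m n) - int k - int m * int (k choose 2)) (int k) D"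
    by (simp add: algebra_simps)
qed

lemma lower_x_degree:
  assumes K: "subring_set K"
    and "f \<in> superpolys K n" "annihilated m n f" "bihomogeneous (i + int e) k f" "f \<noteq> 0" "i \<ge> 0"
  shows "\<exists>g. g \<in> superpolys K n \<and> annihilated m n g \<and> bihomogeneous i k g \<and> g \<noteq> 0"
  using assms(2-5)
proof (induction e arbitrary: f)
  case 0
  thus ?case by auto
next
  case (Suc e)
  obtain p where "scoeff f p \<noteq> 0" using Suc.prems(4) superpoly_eqI[of f 0] by auto
  then obtain \<alpha> I where \<alpha>: "scoeff f (\<alpha>, I) \<noteq> 0" by (cases p) auto
  hence "int (xdeg \<alpha>) = i + int (Suc e)" using Suc.prems(3) unfolding bihomogeneous_iff by blast
  hence "xdeg \<alpha> \<noteq> 0" using assms(6) by auto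
  hence "\<alpha> \<noteq> 0" by auto
  then obtain j where "lookup \<alpha> j \<noteq> 0" by (metis lookup_zero poly_mapping_eqI)
  hence "\<alpha> - single j 1 + single j 1 = \<alpha>"
    by (intro poly_mapping_eqI) (auto simp: lookup_add lookup_minus lookup_single when_def)
  moreover have "complex_of_nat (Suc a) \<noteq> 0" for a by (simp del: of_nat_Suc)
  ultimately have "scoeff (x_deriv j f) (\<alpha> - single j 1, I) \<noteq> 0"
    using \<alpha> by (simp add: scoeff_x_deriv del: of_nat_Suc One_nat_def)
  hence "x_deriv j f \<noteq> 0" by auto
  moreover have "bihomogeneous (i + int e) k (x_deriv j f)"
    using bihomogeneous_x_deriv[OF Suc.prems(3), of j] by (simp add: algebra_simps)
  ultimately show ?case
    using Suc.prems by (intro Suc.IH[of "x_deriv j f"]) (auto intro: superpolys_x_deriv K annihilated_x_deriv)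
qed

theorem theorem1p12:
  fixes K :: "complex set" and m n :: nat and i k :: int
  assumes "subfield K (ring_of_type_algebra :: complex ring)"
    and "\<And>z. z \<in> K \<Longrightarrow> cnj z \<in> K"
    and "\<And>z. z ^ m = 1 \<Longrightarrow> z \<in> K"
    and "m \<ge> 1" and "n \<ge> 1"
  shows "super_harmonics_component K n (monomial_group m n) i k \<noteq> {0} \<longleftrightarrow>
    i \<ge> 0 \<and> k \<ge> 0 \<and>
    i + k + int m * int (nat k choose 2) \<le> int m * int (n choose 2) + (int m - 1) * int n"
proof -
  let ?SH = "super_harmonics_component K n (monomial_group m n) i k"
  have K: "subring_set K" by (rule subring_set_subfield[OF assms(1)])
  have m: "m > 0" using assms(4) by simp
  have zero: "0 \<in> ?SH" by (simp add: super_harmonics_component_def super_harmonics_def)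
  show ?thesis
  proof
    assume "?SH \<noteq> {0}"
    with zero obtain \<eta> where \<eta>: "\<eta> \<in> ?SH" "\<eta> \<noteq> 0" by auto
    hence "bihomogeneous i k \<eta>" by (simp add: super_harmonics_component_def)
    with \<eta> show "i \<ge> 0 \<and> k \<ge> 0 \<and>
        i + k + int m * int (nat k choose 2) \<le> int m * int (n choose 2) + (int m - 1) * int n"
      using bihomogeneous_degree_nonneg harmonic_degree_bound[OF K assms(4,5)] by blast
  next
    assume ik: "i \<ge> 0 \<and> k \<ge> 0 \<and>
        i + k + int m * int (nat k choose 2) \<le> int m * int (n choose 2) + (int m - 1) * int n"
    define q where "q = nat k"
    have k: "k = int q" using ik by (simp add: q_def)
    have le: "i + int q + int m * int (q choose 2) + int n \<le> int m * int (n choose 2) + int m * int n"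
      using ik by (simp add: q_def algebra_simps)
    \<comment> \<open>For \<open>q > n\<close>, and for \<open>q = n\<close> with \<open>m = 1\<close>, the inequality would force \<open>i < 0\<close>.\<close>
    have q: "q \<le> n"
    proof (rule ccontr)
      assume "\<not> q \<le> n"
      hence "Suc n choose 2 \<le> q choose 2" unfolding sum_lessThan_choose[symmetric] by (intro sum_mono2) auto
      hence "int m * (int (n choose 2) + int n) \<le> int m * int (q choose 2)"
        by (intro mult_left_mono) (simp_all add: numeral_2_eq_2)
      with le \<open>\<not> q \<le> n\<close> ik show False by (simp add: algebra_simps)
    qed
    have "m * (n - q) + m \<ge> 2"
    proof (rule ccontr)
      assume not: "\<not> m * (n - q) + m \<ge> 2"
      hence "m = 1" "n - q = 0" using m by (cases "n - q"; cases m; auto)+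
      with le ik q assms(5) show False by auto
    qed
    with q have nz: "foldr (theta_op m n) [0..<q] (alternant m n) \<noteq> 0" by (rule top_harmonic_nonzero)
    define e where "e = nat (int (top_degree m n) - int q - int m * int (q choose 2) - i)"
    have "int (top_degree m n) - int q - int m * int (q choose 2) = i + int e"
      using le by (simp add: e_def top_degree_eq[OF m] algebra_simps)
    with top_harmonic[OF K m, where n = n and k = q]
    have "\<exists>g. g \<in> superpolys K n \<and> annihilated m n g \<and> bihomogeneous i (int q) g \<and> g \<noteq> 0"
      using nz ik by (intro lower_x_degree[OF K, where e = e]) auto
    then obtain g where "g \<in> superpolys K n" "annihilated m n g" "bihomogeneous i k g" "g \<noteq> 0"
      unfolding k by blast
    hence "g \<in> ?SH"
      using annihilated_ideal[OF assms(1)] by (auto simp: super_harmonics_component_def super_harmonics_def)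
    with \<open>g \<noteq> 0\<close> show "?SH \<noteq> {0}" by blast
  qed
qed

end
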